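(* Let $M$ be a stochastically complete surface immersed in $\mathbb{R}^3$, and let $N$ be a complete surface properly immersed in $\mathbb{R}^3$ with bounded curvature. If $N$ is well-oriented with respect to $M$ and $\sup_M|H_M|=\inf_N H_N>0$, then $\mathrm{dist}(M,N)=0$.
   Context: Surfaces are smooth, connected, without boundary; $M$ carries the induced metric and is not assumed geodesically complete. The mean curvature is the trace of the second fundamental form (the sum of the principal curvatures). "Bounded curvature" for $N$ means that the principal curvatures of $N$ are bounded. $\mathrm{dist}(M,N)$ is the Euclidean distance in $\mathbb{R}^3$ between the images of $M$ and $N$. For a complete oriented properly immersed surface $N$ of $\mathbb{R}^3$, $\xi$ denotes the unit normal vector field along $N$ for which the mean curvature vector is $\overrightarrow{H}_N=H_N\,\xi$ with $H_N\ge 0$. Let $W$ be a connected component of $\mathbb{R}^3\setminus N$. The mean curvature vector field of $N$ at $z_0\in N\cap\partial W$ is said to point into $W$ if, for any sequence $y_n\in W$ with $y_n\to z_0$, we have $y_n=\exp_z(t\,\xi(z))=z+t\,\xi(z)$ for some $0<t<\varepsilon$ and some $z$ in a neighborhood $V\subset N$ of $z_0$. Well-oriented: let $M$ be a surface immersed in $\mathbb{R}^3$. A properly immersed surface $N$ of $\mathbb{R}^3$, disjoint from $M$, is well-oriented with respect to $M$ if $M$ lies in a connected component $W$ of $\mathbb{R}^3\setminus N$ into which the mean curvature vector field of $N$ points (at the points of $N\cap\partial W$). A Riemannian manifold $M$ is stochastically complete if its heat kernel $p$ satisfies $\int_M p(t,x,y)\,d\mu(y)=1$ for some (equivalently every)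 $x\in M$ and all $t>0$; equivalently, for every $\lambda>0$, any bounded non-negative weak solution of $\Delta u\ge\lambda u$ on $M$ is identically zero. *)

theory Defs
  imports "HOL-Analysis.Analysis"
begin

section \<open>Smooth maps between open subsets of Euclidean spaces\<close>

text \<open>Only meaningful for open \<open>S\<close>; \<open>frechet_derivative f (at x) v\<close> is the directional
  derivative of \<open>f\<close> at \<open>x\<close> along \<open>v\<close>.\<close>

primrec Ck_on :: "nat \<Rightarrow> ('a::euclidean_space \<Rightarrow> 'b::real_normed_vector) \<Rightarrow> 'a set \<Rightarrow> bool" where
  "Ck_on 0 f S \<longleftrightarrow> continuous_on S f"
| "Ck_on (Suc k) f S \<longleftrightarrow>
     (\<forall>x\<in>S. f differentiable (at x)) \<and> (\<forall>v. Ck_on k (\<lambda>x. frechet_derivative f (at x) v) S)"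

definition smooth_on :: "'a set \<Rightarrow> ('a::euclidean_space \<Rightarrow> 'b::real_normed_vector) \<Rightarrow> bool" where
  "smooth_on S f \<longleftrightarrow> (\<forall>k. Ck_on k f S)"

definition pd :: "2 \<Rightarrow> (real^2 \<Rightarrow> 'b::real_normed_vector) \<Rightarrow> real^2 \<Rightarrow> 'b" where
  "pd i f x = frechet_derivative f (at x) (axis i 1)"


section \<open>Immersed surfaces\<close>

text \<open>An abstract surface together with a map to Euclidean 3-space. The atlas consists of local
  parametrizations \<open>(V, \<psi>)\<close>, i.e. inverses \<open>\<psi>\<close> of charts, defined on open sets \<open>V\<close> of the plane.\<close>

record 'a surface_in_space =
  topo :: "'a topology"
  params :: "((real^2) set \<times> (real^2 \<Rightarrow> 'a)) set"
  imm :: "'a \<Rightarrow> real^3"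

abbreviation points :: "'a surface_in_space \<Rightarrow> 'a set" where
  "points S \<equiv> topspace (topo S)"

definition smooth_atlas :: "'a surface_in_space \<Rightarrow> bool" where
  "smooth_atlas S \<longleftrightarrow>
     (\<forall>(V, \<psi>)\<in>params S. open V \<and> openin (topo S) (\<psi> ` V) \<and>
        homeomorphic_map (top_of_set V) (subtopology (topo S) (\<psi> ` V)) \<psi>) \<and>
     (\<Union>(V, \<psi>)\<in>params S. \<psi> ` V) = points S \<and>
     (\<forall>(V, \<psi>)\<in>params S. \<forall>(W, \<phi>)\<in>params S.
        smooth_on (V \<inter> \<psi> -` (\<phi> ` W)) (the_inv_into W \<phi> \<circ> \<psi>))"

definition smooth_surface :: "'a surface_in_space \<Rightarrow> bool" where
  "smooth_surface S \<longleftrightarrow>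
     Hausdorff_space (topo S) \<and> second_countable (topo S) \<and>
     connected_space (topo S) \<and> points S \<noteq> {} \<and> smooth_atlas S"

definition smooth_map :: "'a surface_in_space \<Rightarrow> ('a \<Rightarrow> 'b::real_normed_vector) \<Rightarrow> bool" where
  "smooth_map S f \<longleftrightarrow> (\<forall>(V, \<psi>)\<in>params S. smooth_on V (f \<circ> \<psi>))"

definition immersed_surface :: "'a surface_in_space \<Rightarrow> bool" where
  "immersed_surface S \<longleftrightarrow> smooth_surface S \<and> smooth_map S (imm S) \<and>
     (\<forall>(V, \<psi>)\<in>params S. \<forall>x\<in>V. inj (frechet_derivative (imm S \<circ> \<psi>) (at x)))"

definition properly_immersed_surface :: "'a surface_in_space \<Rightarrow> bool" where
  "properly_immersed_surface S \<longleftrightarrow>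
     immersed_surface S \<and> proper_map (topo S) euclidean (imm S)"

text \<open>The image of the tangent plane at \<open>p\<close> under the differential of the immersion.\<close>

definition tangent_space :: "'a surface_in_space \<Rightarrow> 'a \<Rightarrow> (real^3) set" where
  "tangent_space S p = {w. \<exists>(V, \<psi>)\<in>params S. \<exists>x\<in>V. \<psi> x = p \<and>
     w \<in> range (frechet_derivative (imm S \<circ> \<psi>) (at x))}"

definition unit_normals :: "'a surface_in_space \<Rightarrow> 'a \<Rightarrow> (real^3) set" where
  "unit_normals S p = {n. norm n = 1 \<and> (\<forall>w\<in>tangent_space S p. n \<bullet> w = 0)}"

text \<open>The quantities below are invariant under reparametrization, so that evaluating them in an
  arbitrarily chosen parametrization around each point is harmless.\<close>

definition param_at :: "'a surface_in_space \<Rightarrow> 'a \<Rightarrow> (real^2) set \<times> (real^2 \<Rightarrow> 'a)" where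
  "param_at S p = (SOME c. c \<in> params S \<and> p \<in> snd c ` fst c)"

definition coord_map :: "'a surface_in_space \<Rightarrow> 'a \<Rightarrow> real^2 \<Rightarrow> 'a" where
  "coord_map S p = snd (param_at S p)"

definition coord :: "'a surface_in_space \<Rightarrow> 'a \<Rightarrow> real^2" where
  "coord S p = the_inv_into (fst (param_at S p)) (coord_map S p) p"


section \<open>First and second fundamental form\<close>

definition first_form :: "(real^2 \<Rightarrow> real^3) \<Rightarrow> real^2 \<Rightarrow> real^2^2" where
  "first_form X x = (\<chi> i j. pd i X x \<bullet> pd j X x)"

definition second_form :: "(real^2 \<Rightarrow> real^3) \<Rightarrow> real^3 \<Rightarrow> real^2 \<Rightarrow> real^2^2" where
  "second_form X n x = (\<chi> i j. pd i (pd j X) x \<bullet> n)"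

definition shape_operator :: "'a surface_in_space \<Rightarrow> real^3 \<Rightarrow> 'a \<Rightarrow> real^2^2" where
  "shape_operator S n p =
     (let X = imm S \<circ> coord_map S p; x = coord S p
      in matrix_inv (first_form X x) ** second_form X n x)"

definition principal_curvatures :: "'a surface_in_space \<Rightarrow> real^3 \<Rightarrow> 'a \<Rightarrow> real set" where
  "principal_curvatures S n p = {k. \<exists>v. v \<noteq> 0 \<and> shape_operator S n p *v v = k *\<^sub>R v}"

text \<open>Sum (not average) of the principal curvatures, with respect to the unit normal \<open>n\<close>.\<close>

definition mean_curvature :: "'a surface_in_space \<Rightarrow> real^3 \<Rightarrow> 'a \<Rightarrow> real" where
  "mean_curvature S n p = trace (shape_operator S n p)"

text \<open>Independent of the choice between the two unit normals.\<close>

definition mean_curvature_vector :: "'a surface_in_space \<Rightarrow> 'a \<Rightarrow> real^3" where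
  "mean_curvature_vector S p =
     (let n = (SOME n. n \<in> unit_normals S p) in mean_curvature S n p *\<^sub>R n)"

definition bounded_curvature :: "'a surface_in_space \<Rightarrow> bool" where
  "bounded_curvature S \<longleftrightarrow> (\<exists>C. \<forall>p\<in>points S. \<forall>n\<in>unit_normals S p.
     \<forall>k\<in>principal_curvatures S n p. \<bar>k\<bar> \<le> C)"

text \<open>\<open>\<xi>\<close> is a global unit normal field along \<open>S\<close> for which the mean curvature vector is \<open>H \<xi>\<close>
  with \<open>H \<ge> 0\<close>. Such a field orients \<open>S\<close>.\<close>

definition mean_curvature_normal :: "'a surface_in_space \<Rightarrow> ('a \<Rightarrow> real^3) \<Rightarrow> bool" where
  "mean_curvature_normal S \<xi> \<longleftrightarrow> smooth_map S \<xi> \<and>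
     (\<forall>p\<in>points S. \<xi> p \<in> unit_normals S p \<and>
        mean_curvature_vector S p = mean_curvature S (\<xi> p) p *\<^sub>R \<xi> p \<and>
        mean_curvature S (\<xi> p) p \<ge> 0)"


section \<open>Geodesic completeness of the induced metric\<close>

definition smooth_curve :: "'a surface_in_space \<Rightarrow> (real \<Rightarrow> 'a) \<Rightarrow> bool" where
  "smooth_curve S \<gamma> \<longleftrightarrow> continuous_map euclideanreal (topo S) \<gamma> \<and>
     (\<forall>(V, \<psi>)\<in>params S. smooth_on (\<gamma> -` (\<psi> ` V)) (the_inv_into V \<psi> \<circ> \<gamma>))"

definition velocity :: "'a surface_in_space \<Rightarrow> (real \<Rightarrow> 'a) \<Rightarrow> real \<Rightarrow> real^3" where
  "velocity S \<gamma> t = vector_derivative (imm S \<circ> \<gamma>) (at t)"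

text \<open>The covariant derivative of the induced metric is the tangential part of the derivative in
  space, so a geodesic is a curve whose acceleration in space is normal to the surface.\<close>

definition geodesic_line :: "'a surface_in_space \<Rightarrow> (real \<Rightarrow> 'a) \<Rightarrow> bool" where
  "geodesic_line S \<gamma> \<longleftrightarrow> smooth_curve S \<gamma> \<and>
     (\<forall>t. \<forall>w\<in>tangent_space S (\<gamma> t). vector_derivative (velocity S \<gamma>) (at t) \<bullet> w = 0)"

definition geodesically_complete :: "'a surface_in_space \<Rightarrow> bool" where
  "geodesically_complete S \<longleftrightarrow> (\<forall>p\<in>points S. \<forall>v\<in>tangent_space S p.
     \<exists>\<gamma>. geodesic_line S \<gamma> \<and> \<gamma> 0 = p \<and> velocity S \<gamma> 0 = v)"


section \<open>Riemannian measure, Laplacian, heat kernel, stochastic completeness\<close>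

definition area_density :: "(real^2 \<Rightarrow> real^3) \<Rightarrow> real^2 \<Rightarrow> real" where
  "area_density X x = sqrt (det (first_form X x))"

definition riemannian_measure :: "'a surface_in_space \<Rightarrow> 'a measure \<Rightarrow> bool" where
  "riemannian_measure S \<mu> \<longleftrightarrow> space \<mu> = points S \<and>
     sets \<mu> = sigma_sets (points S) {U. openin (topo S) U} \<and>
     (\<forall>(V, \<psi>)\<in>params S. \<forall>A\<in>sets \<mu>. A \<subseteq> \<psi> ` V \<longrightarrow>
        emeasure \<mu> A =
          (\<integral>\<^sup>+ x\<in>{x\<in>V. \<psi> x \<in> A}. ennreal (area_density (imm S \<circ> \<psi>) x) \<partial>lborel))"

text \<open>Laplace-Beltrami operator of the induced metric \<open>g\<close> (not its negative):
  \<open>\<Delta>u = (det g)^(-1/2) \<Sum>\<^sub>i \<partial>\<^sub>i ((det g)^(1/2) \<Sum>\<^sub>j g^(ij) \<partial>\<^sub>j u)\<close>.\<close>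

definition laplacian_coord :: "(real^2 \<Rightarrow> real^3) \<Rightarrow> (real^2 \<Rightarrow> real) \<Rightarrow> real^2 \<Rightarrow> real" where
  "laplacian_coord X u x =
     (\<Sum>i\<in>UNIV. pd i (\<lambda>z. area_density X z *
        (\<Sum>j\<in>UNIV. matrix_inv (first_form X z) $ i $ j * pd j u z)) x) / area_density X x"

definition laplacian :: "'a surface_in_space \<Rightarrow> ('a \<Rightarrow> real) \<Rightarrow> 'a \<Rightarrow> real" where
  "laplacian S u p = laplacian_coord (imm S \<circ> coord_map S p) (u \<circ> coord_map S p) (coord S p)"

text \<open>The heat kernel of a relatively compact open set \<open>\<Omega>\<close> with Dirichlet boundary condition, extended
  by zero. Continuity of the extension expresses the boundary condition (and forces the boundary
  of \<open>\<Omega>\<close> to be regular enough); by the maximum principle there is at most one such \<open>p\<close> (for \<open>t > 0\<close>).\<close>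

definition dirichlet_heat_kernel ::
  "'a surface_in_space \<Rightarrow> 'a measure \<Rightarrow> 'a set \<Rightarrow> (real \<Rightarrow> 'a \<Rightarrow> 'a \<Rightarrow> real) \<Rightarrow> bool" where
  "dirichlet_heat_kernel S \<mu> \<Omega> p \<longleftrightarrow>
     (\<forall>t>0. \<forall>x y. 0 \<le> p t x y) \<and>
     (\<forall>t>0. \<forall>x y. x \<notin> \<Omega> \<or> y \<notin> \<Omega> \<longrightarrow> p t x y = 0) \<and>
     continuous_map (prod_topology (top_of_set {0<..}) (prod_topology (topo S) (topo S)))
       euclideanreal (\<lambda>(t, x, y). p t x y) \<and>
     (\<forall>(V, \<psi>)\<in>params S. \<forall>(W, \<phi>)\<in>params S.
        smooth_on {(t, a, b). 0 < t \<and> a \<in> V \<and> \<psi> a \<in> \<Omega> \<and> b \<in> W \<and> \<phi> b \<in> \<Omega>}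
          (\<lambda>(t, a, b). p t (\<psi> a) (\<phi> b))) \<and>
     (\<forall>t>0. \<forall>x\<in>\<Omega>. \<forall>y\<in>\<Omega>.
        ((\<lambda>s. p s x y) has_real_derivative laplacian S (\<lambda>z. p t z y) x) (at t)) \<and>
     (\<forall>f. continuous_map (topo S) euclideanreal f \<and>
          (\<exists>K. compactin (topo S) K \<and> K \<subseteq> \<Omega> \<and> (\<forall>x\<in>points S - K. f x = 0)) \<longrightarrow>
        uniform_limit \<Omega> (\<lambda>t x. LINT y|\<mu>. p t x y * f y) f (at_right 0))"

definition compact_exhaustion :: "'a topology \<Rightarrow> (nat \<Rightarrow> 'a set) \<Rightarrow> bool" where
  "compact_exhaustion X \<Omega> \<longleftrightarrow>
     (\<forall>k. openin X (\<Omega> k) \<and> compactin X (X closure_of \<Omega> k) \<and> X closure_of \<Omega> k \<subseteq> \<Omega> (Suc k)) \<and>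
     (\<Union>k. \<Omega> k) = topspace X"

text \<open>The (minimal) heat kernel of a possibly incomplete manifold: the increasing limit of the
  Dirichlet heat kernels along an exhaustion. The limit does not depend on the exhaustion.\<close>

definition heat_kernel ::
  "'a surface_in_space \<Rightarrow> 'a measure \<Rightarrow> (real \<Rightarrow> 'a \<Rightarrow> 'a \<Rightarrow> real) \<Rightarrow> bool" where
  "heat_kernel S \<mu> p \<longleftrightarrow> (\<exists>\<Omega> q. compact_exhaustion (topo S) \<Omega> \<and>
     (\<forall>k. dirichlet_heat_kernel S \<mu> (\<Omega> k) (q k)) \<and>
     (\<forall>t>0. \<forall>x\<in>points S. \<forall>y\<in>points S.
        incseq (\<lambda>k. q k t x y) \<and> (\<lambda>k. q k t x y) \<longlonglongrightarrow> p t x y))"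

text \<open>The measure and the heat kernel exist and are unique (the latter for \<open>t > 0\<close> and on the surface).\<close>

definition stochastically_complete :: "'a surface_in_space \<Rightarrow> bool" where
  "stochastically_complete S \<longleftrightarrow> (\<exists>\<mu> p. riemannian_measure S \<mu> \<and> heat_kernel S \<mu> p \<and>
     (\<forall>x\<in>points S. \<forall>t>0. (LINT y|\<mu>. p t x y) = 1))"


section \<open>Well-oriented surfaces\<close>

text \<open>The condition is local: \<open>V\<close> and \<open>\<epsilon>\<close> are arbitrarily small, and accordingly \<open>y n\<close> has the
  required form for all large \<open>n\<close>. For large \<open>V\<close> or \<open>\<epsilon>\<close> it would hold on both sides of a round
  sphere. Points and neighbourhoods are taken in the image of \<open>N\<close>.\<close>

definition points_into ::
  "'b surface_in_space \<Rightarrow> ('b \<Rightarrow> real^3) \<Rightarrow> (real^3) set \<Rightarrow> real^3 \<Rightarrow> bool" where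
  "points_into N \<xi> W z\<^sub>0 \<longleftrightarrow>
     (\<forall>y. (\<forall>n. y n \<in> W) \<and> y \<longlonglongrightarrow> z\<^sub>0 \<longrightarrow>
        (\<forall>V \<epsilon>. openin (top_of_set (imm N ` points N)) V \<and> z\<^sub>0 \<in> V \<and> 0 < \<epsilon> \<longrightarrow>
           (\<forall>\<^sub>F n in sequentially. \<exists>q\<in>points N. \<exists>t. imm N q \<in> V \<and> 0 < t \<and> t < \<epsilon> \<and>
              y n = imm N q + t *\<^sub>R \<xi> q)))"

definition well_oriented ::
  "'b surface_in_space \<Rightarrow> ('b \<Rightarrow> real^3) \<Rightarrow> 'a surface_in_space \<Rightarrow> bool" where
  "well_oriented N \<xi> M \<longleftrightarrow>
     imm M ` points M \<inter> imm N ` points N = {} \<and>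
     (\<exists>W\<in>components (- (imm N ` points N)). imm M ` points M \<subseteq> W \<and>
        (\<forall>z\<^sub>0\<in>imm N ` points N \<inter> frontier W. points_into N \<xi> W z\<^sub>0))"

end

theory Submission
  imports Defs
begin

text \<open>Let \<open>\<rho>\<close> be the distance to \<open>N\<close> and suppose \<open>\<rho> \<ge> d > 0\<close> on \<open>M\<close>. For suitable \<open>b\<close> the bounded function
  \<open>u = exp (-b \<rho>\<^sup>2)\<close> satisfies \<open>\<Delta>u \<ge> \<kappa>u\<close> on \<open>M\<close> with some \<open>\<kappa> > 0\<close> in the viscosity sense, against stochastic
  completeness. Indeed \<open>\<rho>\<close> is bounded above by the distance to any point of \<open>N\<close> that moves smoothly with
  the point of \<open>M\<close>, so the inequality is a second variation of \<open>\<bar>X(x) - Y(y)\<bar>\<^sup>2\<close> in both variables at a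
  pair where \<open>y\<close> is a foot point of \<open>x\<close>; no smoothness of \<open>\<rho>\<close> is needed. On the side of \<open>M\<close>, nearby parallel surfaces have
  mean curvature above that of \<open>N\<close>, which gives a strict inequality where the tangent planes are parallel,
  and the convexity of the exponential absorbs the error elsewhere. Well-orientedness is used only to
  see that the segment from some preimage of the foot point to \<open>x\<close> points in the direction of \<open>\<xi>\<close>.\<close>


section \<open>Calculus of \<open>C\<^sup>k\<close> functions\<close>

text \<open>Since the two curvature bounds are equal, there is no slack: at parallel tangent planes,
  foot points that move rigidly with the first surface give only \<open>0\<close> on the right. A
  positive rate has to come from \<open>d > 0\<close>; in the end it is
  \<open>2 * b * s * d * H\<close>. Here \<open>s\<close> is small enough that the quadratic cost of
  dilating the foot-point displacement stays below its linear gain, and \<open>b\<close> is large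
  enough that the convexity of the exponential beats all tilt errors, which amount to at most five
  times the squared sine of the angle between the tangent planes.

  The geometry of the first surface enters only through the Laplacian of its immersion, a normal
  vector of length equal to the absolute mean curvature: a test function \<open>g\<close> touching
  at a foot pair has gradient proportional to \<open>c \<bullet> DX\<close>, so its first-order
  terms complete the second derivatives of \<open>X\<close> to that vector.

  As stochastic completeness is given by the heat kernel, the test function must be built from it.
  It is a finite combination of time slices of one Dirichlet kernel on a relatively compact domain,
  hence smooth in charts, with its Laplacian computed term by term.\<close>

lemma Ck_on_cong:
  assumes "open S" "\<And>x. x \<in> S \<Longrightarrow> f x = g x" "Ck_on k f S"
  shows "Ck_on k g S"
  using assms
proof (induction k arbitrary: f g)
  case 0 then show ?case by (simp cong: continuous_on_cong)
next
  case (Suc k)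
  have d: "g differentiable (at x)" "frechet_derivative f (at x) = frechet_derivative g (at x)"
    if "x \<in> S" for x
  proof -
    have fd: "f differentiable (at x)" using Suc that by simp
    show "frechet_derivative f (at x) = frechet_derivative g (at x)"
      using frechet_derivative_transform_within_open[OF fd \<open>open S\<close> that] Suc by blast
    obtain D where "(f has_derivative D) (at x)" using fd differentiable_def by blast
    then have "(g has_derivative D) (at x)"
      using has_derivative_transform_within_open[of f D x UNIV S g] Suc that by simp
    then show "g differentiable (at x)" using differentiable_def by blast
  qed
  have "Ck_on k (\<lambda>x. frechet_derivative g (at x) v) S" for v
    using Suc.IH[of "\<lambda>x. frechet_derivative f (at x) v" "\<lambda>x. frechet_derivative g (at x) v"] Suc.prems d
    by simp
  then show ?case using d by simp
qed

lemma Ck_on_subset: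
  assumes "Ck_on k f S" "T \<subseteq> S"
  shows "Ck_on k f T"
  using assms by (induction k arbitrary: f) (auto intro: continuous_on_subset)

text \<open>Used with \<open>L\<close> an inclusion of one factor of a product: this freezes the
  time and the second point of the heat kernel.\<close>

lemma Ck_on_compose_affine:
  fixes L :: "'a::euclidean_space \<Rightarrow> 'b::euclidean_space"
  assumes "open S" "bounded_linear L" "Ck_on k f S"
  shows "Ck_on k (\<lambda>x. f (c + L x)) ((\<lambda>x. c + L x) -` S)"
  using assms
proof (induction k arbitrary: f)
  case 0
  have "continuous_on ((\<lambda>x. c + L x) -` S) (\<lambda>x. c + L x)"
    using bounded_linear.linear linear_continuous_on[OF 0(2)] by (intro continuous_intros) 
  then show ?case using 0 by (auto intro!: continuous_on_compose2[of S f])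
next
  case (Suc k)
  let ?l = "\<lambda>x. c + L x" and ?T = "(\<lambda>x. c + L x) -` S"
  have cont: "continuous_on UNIV ?l"
    using linear_continuous_on[OF Suc(3)] by (intro continuous_intros)
  have oT: "open ?T" using open_vimage[OF \<open>open S\<close> cont] .
  have der: "((\<lambda>x. f (?l x)) has_derivative (\<lambda>v. frechet_derivative f (at (?l x)) (L v))) (at x)"
    if "x \<in> ?T" for x
  proof -
    have "(f has_derivative frechet_derivative f (at (?l x))) (at (?l x))"
      using Suc that by (simp add: frechet_derivative_works)
    moreover have "(?l has_derivative L) (at x)"
      by (auto intro!: derivative_eq_intros bounded_linear_imp_has_derivative Suc)
    ultimately show ?thesis using has_derivative_compose[of ?l L x UNIV f] by simp
  qed
  have "Ck_on k (\<lambda>x. frechet_derivative (\<lambda>x. f (?l x)) (at x) v) ?T" for v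
  proof (rule Ck_on_cong[OF oT])
    show "Ck_on k (\<lambda>x. frechet_derivative f (at (?l x)) (L v)) ?T"
      using Suc.IH[of "\<lambda>y. frechet_derivative f (at y) (L v)"] Suc.prems by simp
    show "frechet_derivative f (at (?l x)) (L v) = frechet_derivative (\<lambda>x. f (?l x)) (at x) v"
      if "x \<in> ?T" for x
      using frechet_derivative_at[OF der[OF that]] by metis
  qed
  moreover have "(\<lambda>x. f (?l x)) differentiable (at x)" if "x \<in> ?T" for x
    using der[OF that] differentiable_def by blast
  ultimately show ?case by auto
qed

lemma Ck_on_const: "Ck_on k (\<lambda>x. c) S"
  by (induction k arbitrary: c) auto

lemma frechet_derivative_add:
  assumes "f differentiable at x" "g differentiable at x"
  shows "frechet_derivative (\<lambda>x. f x + g x) (at x) v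
    = frechet_derivative f (at x) v + frechet_derivative g (at x) v"
proof -
  have "((\<lambda>x. f x + g x) has_derivative
    (\<lambda>v. frechet_derivative f (at x) v + frechet_derivative g (at x) v)) (at x)"
    using assms by (intro has_derivative_add) (auto simp: frechet_derivative_works)
  then show ?thesis using frechet_derivative_at by metis
qed

lemma frechet_derivative_scaleR_left:
  assumes "f differentiable at x"
  shows "frechet_derivative (\<lambda>x. c *\<^sub>R f x) (at x) v = c *\<^sub>R frechet_derivative f (at x) v"
proof -
  have "((\<lambda>x. c *\<^sub>R f x) has_derivative (\<lambda>v. c *\<^sub>R frechet_derivative f (at x) v)) (at x)"
    using assms by (intro has_derivative_scaleR_right) (auto simp: frechet_derivative_works)
  then show ?thesis using frechet_derivative_at by metis
qed

lemma Ck_on_add: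
  assumes "open S" "Ck_on k f S" "Ck_on k g S"
  shows "Ck_on k (\<lambda>x. f x + g x) S"
  using assms
proof (induction k arbitrary: f g)
  case 0 then show ?case by (simp add: continuous_on_add)
next
  case (Suc k)
  have "Ck_on k (\<lambda>x. frechet_derivative (\<lambda>x. f x + g x) (at x) v) S" for v
  proof (rule Ck_on_cong[OF \<open>open S\<close>])
    show "Ck_on k (\<lambda>x. frechet_derivative f (at x) v + frechet_derivative g (at x) v) S"
      using Suc.prems by (intro Suc.IH) auto
  qed (use Suc.prems in \<open>simp add: frechet_derivative_add\<close>)
  then show ?case using Suc by auto
qed

lemma Ck_on_scaleR:
  assumes "open S" "Ck_on k f S"
  shows "Ck_on k (\<lambda>x. c *\<^sub>R f x) S"
  using assms
proof (induction k arbitrary: f)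
  case 0 then show ?case by (simp add: continuous_on_scaleR)
next
  case (Suc k)
  have "Ck_on k (\<lambda>x. frechet_derivative (\<lambda>x. c *\<^sub>R f x) (at x) v) S" for v
  proof (rule Ck_on_cong[OF \<open>open S\<close>])
    show "Ck_on k (\<lambda>x. c *\<^sub>R frechet_derivative f (at x) v) S"
      using Suc.prems by (intro Suc.IH) auto
  qed (use Suc.prems in \<open>simp add: frechet_derivative_scaleR_left\<close>)
  then show ?case using Suc by auto
qed

lemma Ck_on_sum:
  assumes "open S" "\<And>i. i \<in> I \<Longrightarrow> Ck_on k (f i) S"
  shows "Ck_on k (\<lambda>x. \<Sum>i\<in>I. f i x) S"
  using assms(2)
  by (induction I rule: infinite_finite_induct) (auto intro: Ck_on_const Ck_on_add assms(1))

text \<open>The Hessian quadratic form, iterated exactly as in \<open>Ck_on\<close>. It is the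
  second derivative of \<open>f\<close> along the line through \<open>x\<close> with velocity
  \<open>v\<close>.\<close>

definition second_dd :: "('a::euclidean_space \<Rightarrow> 'b::real_normed_vector) \<Rightarrow> 'a \<Rightarrow> 'a \<Rightarrow> 'b" where
  "second_dd f x v = frechet_derivative (\<lambda>y. frechet_derivative f (at y) v) (at x) v"

lemma Ck_on_2D:
  assumes "Ck_on 2 f S" "x \<in> S"
  shows "f differentiable (at x)" "(\<lambda>y. frechet_derivative f (at y) v) differentiable (at x)"
    "continuous_on S (\<lambda>y. frechet_derivative (\<lambda>z. frechet_derivative f (at z) v) (at y) w)"
  using assms by (auto simp: numeral_2_eq_2)

lemma has_vector_derivative_along_line:
  assumes "f differentiable (at (x + s *\<^sub>R v))"
  shows "((\<lambda>s. f (x + s *\<^sub>R v)) has_vector_derivative frechet_derivative f (at (x + s *\<^sub>R v)) v) (at s)"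
proof -
  have 1: "((\<lambda>s. x + s *\<^sub>R v) has_derivative (\<lambda>s. s *\<^sub>R v)) (at s)"
    by (auto intro!: derivative_eq_intros)
  have "(f has_derivative frechet_derivative f (at (x + s *\<^sub>R v))) (at (x + s *\<^sub>R v))"
    using assms by (simp add: frechet_derivative_works)
  from has_derivative_compose[OF 1 this]
  show ?thesis unfolding has_vector_derivative_def
    using linear_cmul[OF linear_frechet_derivative[OF assms]] by simp
qed

lemma eventually_along_line:
  fixes x v :: "'a::real_normed_vector"
  assumes "open S" "x \<in> S"
  shows "\<forall>\<^sub>F s::real in nhds 0. x + s *\<^sub>R v \<in> S"
proof -
  have "continuous_on UNIV (\<lambda>s::real. x + s *\<^sub>R v)" by (intro continuous_intros)
  from open_vimage[OF assms(1) this] assms(2) show ?thesis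
    unfolding eventually_nhds by (intro exI[of _ "(\<lambda>s::real. x + s *\<^sub>R v) -` S"]) auto
qed

lemma twice_along_line:
  assumes "open S" "x \<in> S" "Ck_on 2 f S"
  shows "\<forall>\<^sub>F s in nhds 0. ((\<lambda>s. f (x + s *\<^sub>R v)) has_vector_derivative
            frechet_derivative f (at (x + s *\<^sub>R v)) v) (at s)"
    "((\<lambda>s. frechet_derivative f (at (x + s *\<^sub>R v)) v) has_vector_derivative second_dd f x v) (at 0)"
proof -
  show "\<forall>\<^sub>F s in nhds 0. ((\<lambda>s. f (x + s *\<^sub>R v)) has_vector_derivative
            frechet_derivative f (at (x + s *\<^sub>R v)) v) (at s)"
    using eventually_along_line[OF assms(1,2), of v]
    by eventually_elim (auto intro!: has_vector_derivative_along_line Ck_on_2D assms)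
  show "((\<lambda>s. frechet_derivative f (at (x + s *\<^sub>R v)) v) has_vector_derivative second_dd f x v) (at 0)"
    using has_vector_derivative_along_line[of "\<lambda>y. frechet_derivative f (at y) v" x 0 v]
      Ck_on_2D(2)[OF assms(3,2)] by (simp add: second_dd_def)
qed

section \<open>Partial derivatives in the plane\<close>

lemma real2_expand: "v = (\<Sum>i\<in>UNIV. (v $ i) *\<^sub>R axis i (1::real))"
  by (simp add: vec_eq_iff axis_def if_distrib cong: if_cong)

lemma frechet_derivative_pd:
  fixes f :: "real^2 \<Rightarrow> 'b::real_normed_vector"
  assumes "f differentiable (at x)"
  shows "frechet_derivative f (at x) v = (\<Sum>i\<in>UNIV. v $ i *\<^sub>R pd i f x)"
proof -
  interpret linear "frechet_derivative f (at x)" using assms by (rule linear_frechet_derivative)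
  show ?thesis
    by (subst real2_expand[of v]) (simp only: sum scaleR pd_def)
qed

lemma second_dd_pd:
  fixes f :: "real^2 \<Rightarrow> 'b::real_normed_vector"
  assumes "open S" "x \<in> S" "Ck_on 2 f S"
  shows "second_dd f x v = (\<Sum>i\<in>UNIV. \<Sum>j\<in>UNIV. (v $ i * v $ j) *\<^sub>R pd i (pd j f) x)"
proof -
  have d: "pd j f differentiable (at x)" for j
    unfolding pd_def using Ck_on_2D(2)[OF assms(3,2)] .
  have "((\<lambda>y. \<Sum>j\<in>UNIV. v $ j *\<^sub>R pd j f y) has_derivative
     (\<lambda>w. \<Sum>j\<in>UNIV. v $ j *\<^sub>R frechet_derivative (pd j f) (at x) w)) (at x)"
    using d by (intro derivative_intros) (auto simp: frechet_derivative_works)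
  then have D: "((\<lambda>y. frechet_derivative f (at y) v) has_derivative
     (\<lambda>w. \<Sum>j\<in>UNIV. v $ j *\<^sub>R frechet_derivative (pd j f) (at x) w)) (at x)"
    by (rule has_derivative_transform_within_open[OF _ assms(1,2)])
      (auto simp: frechet_derivative_pd Ck_on_2D[OF assms(3)])
  have "second_dd f x v = (\<Sum>j\<in>UNIV. v $ j *\<^sub>R frechet_derivative (pd j f) (at x) v)"
    by (simp only: second_dd_def frechet_derivative_at[OF D, symmetric])
  also have "\<dots> = (\<Sum>j\<in>UNIV. \<Sum>i\<in>UNIV. (v $ i * v $ j) *\<^sub>R pd i (pd j f) x)"
    by (simp add: frechet_derivative_pd[OF d] scaleR_sum_right mult.commute del: sum_2)
  finally show ?thesis by (subst sum.swap)
qed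

text \<open>Source of the factor \<open>(1 + s)\<^sup>2\<close> when the displacement of a foot
  point is dilated.\<close>

lemma second_dd_scaleR:
  fixes f :: "real^2 \<Rightarrow> 'b::real_normed_vector"
  assumes "open S" "x \<in> S" "Ck_on 2 f S"
  shows "second_dd f x (c *\<^sub>R v) = c\<^sup>2 *\<^sub>R second_dd f x v"
  by (simp add: second_dd_pd[OF assms] scaleR_sum_right power2_eq_square algebra_simps)

lemma pdI: "(f has_derivative f') (at x) \<Longrightarrow> pd i f x = f' (axis i 1)"
  unfolding pd_def by (metis frechet_derivative_at)

lemma pd_cong:
  assumes "open S" "x \<in> S" "f differentiable (at x)" "\<And>z. z \<in> S \<Longrightarrow> f z = g z"
  shows "pd i f x = pd i g x"
  unfolding pd_def using frechet_derivative_transform_within_open[OF assms(3,1,2,4)] by simp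

lemma pd_mult:
  fixes f g :: "real^2 \<Rightarrow> real"
  assumes "f differentiable (at x)" "g differentiable (at x)"
  shows "pd i (\<lambda>z. f z * g z) x = f x * pd i g x + pd i f x * g x"
  unfolding pd_def[of i f] pd_def[of i g]
  by (rule pdI) (use assms in \<open>auto intro!: has_derivative_mult simp: frechet_derivative_works[symmetric]\<close>)

lemma pd_inner:
  fixes f g :: "real^2 \<Rightarrow> 'a::real_inner"
  assumes "f differentiable (at x)" "g differentiable (at x)"
  shows "pd i (\<lambda>z. f z \<bullet> g z) x = f x \<bullet> pd i g x + pd i f x \<bullet> g x"
  unfolding pd_def[of i f] pd_def[of i g]
  by (rule pdI) (use assms in \<open>auto intro!: has_derivative_inner simp: frechet_derivative_works[symmetric]\<close>)

lemma pd_sum: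
  assumes "\<And>j. j \<in> I \<Longrightarrow> f j differentiable (at x)"
  shows "pd i (\<lambda>z. \<Sum>j\<in>I. f j z) x = (\<Sum>j\<in>I. pd i (f j) x)"
  unfolding pd_def[of i "f _"]
  by (rule pdI) (use assms in \<open>auto intro!: has_derivative_sum simp: frechet_derivative_works[symmetric]\<close>)

text \<open>The mean value theorem applied twice: along \<open>v\<close> to the increment of
  \<open>f\<close> under \<open>s *\<^sub>R w\<close>, then along \<open>w\<close> to the derivative
  so obtained. The left side is symmetric in \<open>v\<close> and \<open>w\<close>, whence the
  symmetry of second derivatives.\<close>

lemma second_difference:
  fixes f :: "'a::euclidean_space \<Rightarrow> real"
  assumes "Ck_on 2 f S" "0 < s"
    and S: "\<And>r r'. \<lbrakk>0 \<le> r; r \<le> s; 0 \<le> r'; r' \<le> s\<rbrakk> \<Longrightarrow> x + r *\<^sub>R v + r' *\<^sub>R w \<in> S"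
  shows "\<exists>r r'. 0 < r \<and> r < s \<and> 0 < r' \<and> r' < s \<and>
    f (x + s *\<^sub>R v + s *\<^sub>R w) - f (x + s *\<^sub>R v) - f (x + s *\<^sub>R w) + f x =
      s\<^sup>2 * frechet_derivative (\<lambda>y. frechet_derivative f (at y) v) (at (x + r *\<^sub>R v + r' *\<^sub>R w)) w"
proof -
  let ?D = "\<lambda>y. frechet_derivative f (at y) v"
  let ?g = "\<lambda>r. f ((x + s *\<^sub>R w) + r *\<^sub>R v) - f (x + r *\<^sub>R v)"
  have sw: "(x + s *\<^sub>R w) + r *\<^sub>R v = x + r *\<^sub>R v + s *\<^sub>R w" for r by (simp add: algebra_simps)
  have "(?g has_vector_derivative ?D ((x + s *\<^sub>R w) + r *\<^sub>R v) - ?D (x + r *\<^sub>R v)) (at r)"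
    if "0 \<le> r" "r \<le> s" for r
    using S[of r s] S[of r 0] that assms
    by (intro has_vector_derivative_diff has_vector_derivative_along_line Ck_on_2D[OF assms(1)])
       (auto simp: sw)
  then have "\<exists>r. 0 < r \<and> r < s \<and> ?g s - ?g 0 = (s - 0) * (?D ((x + s *\<^sub>R w) + r *\<^sub>R v) - ?D (x + r *\<^sub>R v))"
    by (intro MVT2 assms) (simp add: has_real_derivative_iff_has_vector_derivative)
  then obtain r where r: "0 < r" "r < s"
    "?g s - ?g 0 = s * (?D (x + r *\<^sub>R v + s *\<^sub>R w) - ?D (x + r *\<^sub>R v))" by (auto simp: sw)
  have "((\<lambda>q. ?D (x + r *\<^sub>R v + q *\<^sub>R w)) has_vector_derivative
      frechet_derivative ?D (at (x + r *\<^sub>R v + q *\<^sub>R w)) w) (at q)" if "0 \<le> q" "q \<le> s" for q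
    using S[of r q] that r by (intro has_vector_derivative_along_line Ck_on_2D[OF assms(1)]) auto
  then have "\<exists>q. 0 < q \<and> q < s \<and> ?D (x + r *\<^sub>R v + s *\<^sub>R w) - ?D (x + r *\<^sub>R v + 0 *\<^sub>R w) =
     (s - 0) * frechet_derivative ?D (at (x + r *\<^sub>R v + q *\<^sub>R w)) w"
    by (intro MVT2 assms) (simp add: has_real_derivative_iff_has_vector_derivative)
  then obtain q where "0 < q" "q < s" "?D (x + r *\<^sub>R v + s *\<^sub>R w) - ?D (x + r *\<^sub>R v) =
     s * frechet_derivative ?D (at (x + r *\<^sub>R v + q *\<^sub>R w)) w" by auto
  with r show ?thesis by (intro exI[of _ r] exI[of _ q]) (simp add: power2_eq_square algebra_simps)
qed

lemma mixed_derivatives_commute_real: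
  fixes f :: "'a::euclidean_space \<Rightarrow> real"
  assumes "open S" "x \<in> S" "Ck_on 2 f S"
  shows "frechet_derivative (\<lambda>y. frechet_derivative f (at y) v) (at x) w =
    frechet_derivative (\<lambda>y. frechet_derivative f (at y) w) (at x) v"
proof (rule ccontr)
  let ?A = "\<lambda>z. frechet_derivative (\<lambda>y. frechet_derivative f (at y) v) (at z) w"
  let ?B = "\<lambda>z. frechet_derivative (\<lambda>y. frechet_derivative f (at y) w) (at z) v"
  assume ne: "?A x \<noteq> ?B x"
  define e where "e = \<bar>?A x - ?B x\<bar> / 2"
  have e: "e > 0" using ne by (simp add: e_def)
  have "isCont ?A x" "isCont ?B x"
    using Ck_on_2D(3)[OF assms(3,2)] assms(1,2) by (auto simp: continuous_on_eq_continuous_at)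
  then obtain d1 d2 where d: "d1 > 0" "d2 > 0" "\<And>z. dist z x < d1 \<Longrightarrow> dist (?A z) (?A x) < e"
    "\<And>z. dist z x < d2 \<Longrightarrow> dist (?B z) (?B x) < e"
    unfolding continuous_at_eps_delta using e by (metis (no_types, lifting))
  obtain d3 where d3: "d3 > 0" "ball x d3 \<subseteq> S" using assms openE by blast
  define d where "d = min d1 (min d2 d3)"
  define c where "c = norm v + norm w + 1"
  \<comment> \<open>The parallelogram with sides \<open>s *\<^sub>R v\<close> and
    \<open>s *\<^sub>R w\<close> then stays within \<open>d / 2\<close> of \<open>x\<close>; the
    summand 1 in \<open>c\<close> covers \<open>v = w = 0\<close>.\<close>
  define s where "s = d / (2 * c)"
  have d0: "d > 0" using d d3 by (simp add: d_def)
  have nn: "c > 0" using norm_ge_zero[of v] norm_ge_zero[of w] unfolding c_def by linarith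
  have s0: "s > 0" using d0 nn by (simp add: s_def)
  have near: "dist (x + r *\<^sub>R v + r' *\<^sub>R w) x < d" if "0 \<le> r" "r \<le> s" "0 \<le> r'" "r' \<le> s" for r r'
  proof -
    have "dist (x + r *\<^sub>R v + r' *\<^sub>R w) x \<le> norm (r *\<^sub>R v) + norm (r' *\<^sub>R w)"
      using norm_triangle_ineq[of "r *\<^sub>R v" "r' *\<^sub>R w"] by (simp add: dist_norm algebra_simps)
    also have "\<dots> \<le> s * norm v + s * norm w" using that by (auto intro!: add_mono mult_right_mono)
    also have "\<dots> \<le> s * c" using s0 by (simp add: c_def algebra_simps)
    also have "\<dots> = d / 2" using nn by (simp add: s_def)
    finally show ?thesis using d0 by simp
  qed
  have inS: "x + r *\<^sub>R v + r' *\<^sub>R w \<in> S" if "0 \<le> r" "r \<le> s" "0 \<le> r'" "r' \<le> s" for r r'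
    using near[OF that] d3 by (auto simp: d_def dist_commute subset_iff)
  obtain r1 r1' where r1: "0 < r1" "r1 < s" "0 < r1'" "r1' < s"
    "f (x + s *\<^sub>R v + s *\<^sub>R w) - f (x + s *\<^sub>R v) - f (x + s *\<^sub>R w) + f x =
      s\<^sup>2 * ?A (x + r1 *\<^sub>R v + r1' *\<^sub>R w)"
    using second_difference[OF assms(3) s0 inS] by blast
  have inS': "x + r *\<^sub>R w + r' *\<^sub>R v \<in> S" if "0 \<le> r" "r \<le> s" "0 \<le> r'" "r' \<le> s" for r r'
    using inS[of r' r] that by (simp add: algebra_simps)
  obtain r2 r2' where r2: "0 < r2" "r2 < s" "0 < r2'" "r2' < s"
    "f (x + s *\<^sub>R w + s *\<^sub>R v) - f (x + s *\<^sub>R w) - f (x + s *\<^sub>R v) + f x =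
      s\<^sup>2 * ?B (x + r2 *\<^sub>R w + r2' *\<^sub>R v)"
    using second_difference[OF assms(3) s0 inS'] by blast
  have "s\<^sup>2 * ?A (x + r1 *\<^sub>R v + r1' *\<^sub>R w) = s\<^sup>2 * ?B (x + r2' *\<^sub>R v + r2 *\<^sub>R w)"
    using r1(5) r2(5) by (simp add: algebra_simps)
  then have eq: "?A (x + r1 *\<^sub>R v + r1' *\<^sub>R w) = ?B (x + r2' *\<^sub>R v + r2 *\<^sub>R w)" using s0 by simp
  have "dist (?A (x + r1 *\<^sub>R v + r1' *\<^sub>R w)) (?A x) < e"
    using near[of r1 r1'] r1 by (intro d(3)) (auto simp: d_def)
  moreover have "dist (?B (x + r2' *\<^sub>R v + r2 *\<^sub>R w)) (?B x) < e"
    using near[of r2' r2] r2 by (intro d(4)) (auto simp: d_def)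
  ultimately show False using eq by (simp add: e_def dist_real_def) argo
qed

lemma frechet_derivative_inner_const:
  assumes "f differentiable (at x)"
  shows "frechet_derivative (\<lambda>z. f z \<bullet> c) (at x) v = frechet_derivative f (at x) v \<bullet> c"
proof -
  have "((\<lambda>z. f z \<bullet> c) has_derivative (\<lambda>v. frechet_derivative f (at x) v \<bullet> c)) (at x)"
    using assms by (intro derivative_intros) (simp add: frechet_derivative_works)
  then show ?thesis using frechet_derivative_at by metis
qed

lemma Ck_on_inner_const:
  assumes "open S" "Ck_on k f S"
  shows "Ck_on k (\<lambda>x. f x \<bullet> c) S"
  using assms
proof (induction k arbitrary: f)
  case 0 then show ?case by (simp add: continuous_on_inner)
next
  case (Suc k)
  have "Ck_on k (\<lambda>x. frechet_derivative (\<lambda>x. f x \<bullet> c) (at x) v) S" for v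
  proof (rule Ck_on_cong[OF \<open>open S\<close>])
    show "Ck_on k (\<lambda>x. frechet_derivative f (at x) v \<bullet> c) S"
      using Suc.prems by (intro Suc.IH) auto
  qed (use Suc.prems in \<open>simp add: frechet_derivative_inner_const\<close>)
  then show ?case using Suc by auto
qed

text \<open>Pairing with every constant vector reduces the claim to real-valued functions.\<close>

lemma mixed_derivatives_commute:
  fixes f :: "'a::euclidean_space \<Rightarrow> 'b::real_inner"
  assumes "open S" "x \<in> S" "Ck_on 2 f S"
  shows "frechet_derivative (\<lambda>y. frechet_derivative f (at y) v) (at x) w =
    frechet_derivative (\<lambda>y. frechet_derivative f (at y) w) (at x) v"
proof -
  have *: "frechet_derivative (\<lambda>y. frechet_derivative f (at y) v) (at x) w \<bullet> c =
    frechet_derivative (\<lambda>y. frechet_derivative (\<lambda>z. f z \<bullet> c) (at y) v) (at x) w" for c v w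
  proof -
    have "frechet_derivative (\<lambda>y. frechet_derivative (\<lambda>z. f z \<bullet> c) (at y) v) (at x) w
      = frechet_derivative (\<lambda>y. frechet_derivative f (at y) v \<bullet> c) (at x) w"
      using frechet_derivative_transform_within_open[of "\<lambda>y. frechet_derivative f (at y) v \<bullet> c" x S
          "\<lambda>y. frechet_derivative (\<lambda>z. f z \<bullet> c) (at y) v"] assms Ck_on_2D(1,2)[OF assms(3)]
      by (simp add: frechet_derivative_inner_const)
    then show ?thesis using Ck_on_2D(2)[OF assms(3,2)] by (simp add: frechet_derivative_inner_const)
  qed
  have "frechet_derivative (\<lambda>y. frechet_derivative f (at y) v) (at x) w \<bullet> c =
    frechet_derivative (\<lambda>y. frechet_derivative f (at y) w) (at x) v \<bullet> c" for c
    unfolding * by (intro mixed_derivatives_commute_real[OF assms(1,2)] Ck_on_inner_const assms)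
  then show ?thesis by (metis inner_commute vector_eq_rdot)
qed

lemma pd_commute:
  fixes f :: "real^2 \<Rightarrow> 'b::real_inner"
  assumes "open S" "x \<in> S" "Ck_on 2 f S"
  shows "pd i (pd j f) x = pd j (pd i f) x"
  unfolding pd_def using mixed_derivatives_commute[OF assms] .

section \<open>The Laplacian in a parametrization\<close>

lemma matrix_inv_unique:
  fixes A B :: "real^'n^'n"
  assumes "A ** B = mat 1"
  shows "matrix_inv A = B"
proof -
  have BA: "B ** A = mat 1" using assms matrix_left_right_inverse by blast
  then have "A ** matrix_inv A = mat 1 \<and> matrix_inv A ** A = mat 1"
    unfolding matrix_inv_def using assms by (intro someI) auto
  then show ?thesis by (metis BA matrix_mul_assoc matrix_mul_lid matrix_mul_rid)
qed

text \<open>The cofactor formula shows the inverse metric to be a differentiable expression in the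
  first partial derivatives.\<close>

lemma matrix_inv_2:
  fixes A :: "real^2^2"
  assumes "det A \<noteq> 0"
  shows "matrix_inv A = (\<chi> i j. (if i = 1 then if j = 1 then A$2$2 else - A$1$2
    else if j = 1 then - A$2$1 else A$1$1) / det A)"
proof (rule matrix_inv_unique)
  define d where "d = det A"
  have n2: "(2::2) \<noteq> 1" by simp
  have d0: "d \<noteq> 0" using assms by (simp add: d_def)
  have d: "A$1$1 * A$2$2 - A$1$2 * A$2$1 = d" by (simp add: d_def det_2)
  have "A$1$1 * (A$2$2 / d) - A$1$2 * (A$2$1 / d) = 1" "A$2$2 * (A$1$1 / d) - A$2$1 * (A$1$2 / d) = 1"
    using d0 d by (simp_all add: field_simps)
  then show "A ** (\<chi> i j. (if i = 1 then if j = 1 then A$2$2 else - A$1$2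
    else if j = 1 then - A$2$1 else A$1$1) / det A) = mat 1"
    unfolding d_def[symmetric]
    by (simp add: vec_eq_iff forall_2 matrix_matrix_mult_def sum_2 mat_def n2 mult.commute)
qed

lemma det_first_form:
  "det (first_form X x) = (pd 1 X x \<bullet> pd 1 X x) * (pd 2 X x \<bullet> pd 2 X x) - (pd 1 X x \<bullet> pd 2 X x)\<^sup>2"
  by (simp add: det_2 first_form_def power2_eq_square inner_commute)

text \<open>Strict Cauchy-Schwarz: for independent \<open>a\<close>, \<open>b\<close> the nonzero
  vector \<open>(b \<bullet> b) *\<^sub>R a - (a \<bullet> b) *\<^sub>R b\<close> has squared length
  \<open>b \<bullet> b\<close> times the Gram determinant.\<close>

lemma det_first_form_pos:
  assumes "X differentiable (at x)" "inj (frechet_derivative X (at x))"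
  shows "det (first_form X x) > 0"
proof -
  let ?a = "pd 1 X x" and ?b = "pd 2 X x"
  have D: "frechet_derivative X (at x) v = v $ 1 *\<^sub>R ?a + v $ 2 *\<^sub>R ?b" for v
    using frechet_derivative_pd[OF assms(1)] by (simp add: sum_2)
  have ne: "v $ 1 *\<^sub>R ?a + v $ 2 *\<^sub>R ?b \<noteq> 0" if "v \<noteq> 0" for v :: "real^2"
    using assms that linear_injective_0[OF linear_frechet_derivative[OF assms(1)]] by (auto simp: D)
  have "axis 2 1 \<noteq> (0 :: real^2)" by (simp add: axis_eq_0_iff)
  from ne[OF this] have b: "?b \<noteq> 0" by (auto simp: axis_def)
  let ?v = "vector [?b \<bullet> ?b, - (?a \<bullet> ?b)] :: real^2"
  have "?v $ 1 \<noteq> 0" using b by simp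
  then have "?v \<noteq> 0" by (metis zero_index)
  from ne[OF this] have "(?b \<bullet> ?b) *\<^sub>R ?a - (?a \<bullet> ?b) *\<^sub>R ?b \<noteq> 0" by simp
  then have "0 < ((?b \<bullet> ?b) *\<^sub>R ?a - (?a \<bullet> ?b) *\<^sub>R ?b) \<bullet> ((?b \<bullet> ?b) *\<^sub>R ?a - (?a \<bullet> ?b) *\<^sub>R ?b)"
    by (rule inner_gt_zero_iff[THEN iffD2])
  also have "\<dots> = (?b \<bullet> ?b) * ((?a \<bullet> ?a) * (?b \<bullet> ?b) - (?a \<bullet> ?b)\<^sup>2)"
    by (simp add: inner_diff_left inner_diff_right inner_commute power2_eq_square algebra_simps)
  finally show ?thesis using b unfolding det_first_form
    by (simp add: zero_less_mult_iff) (metis inner_ge_zero leD)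
qed

text \<open>One chart seen through the immersion, without the abstract surface. It applies equally
  to a full chart domain and to a smaller open set on which a test function is defined.\<close>

locale immersion_patch =
  fixes V :: "(real^2) set" and X :: "real^2 \<Rightarrow> real^3"
  assumes open_V: "open V" and C2: "Ck_on 2 X V"
    and inj_D: "\<And>x. x \<in> V \<Longrightarrow> inj (frechet_derivative X (at x))"
begin

abbreviation gi :: "real^2 \<Rightarrow> real^2^2" where "gi x \<equiv> matrix_inv (first_form X x)"

text \<open>The coefficients under the divergence in the Laplacian.\<close>

definition weight :: "2 \<Rightarrow> 2 \<Rightarrow> real^2 \<Rightarrow> real" where
  "weight i j z = area_density X z * gi z $ i $ j"

text \<open>The first-order coefficients left when the divergence is carried out. They depend on the
  metric alone, so functions on the patch and the components of \<open>X\<close> share them.\<close>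

definition drift :: "2 \<Rightarrow> real^2 \<Rightarrow> real" where
  "drift j x = (\<Sum>i\<in>UNIV. pd i (weight i j) x) / area_density X x"

text \<open>The componentwise Laplacian of the immersion; up to identification of normals it is the
  mean curvature vector.\<close>

definition lap_imm :: "real^2 \<Rightarrow> real^3" where
  "lap_imm x = (\<Sum>i\<in>UNIV. \<Sum>j\<in>UNIV. gi x $ i $ j *\<^sub>R pd i (pd j X) x) + (\<Sum>j\<in>UNIV. drift j x *\<^sub>R pd j X x)"

lemma diff: "x \<in> V \<Longrightarrow> X differentiable (at x)"
  using C2 Ck_on_2D by blast

lemma det_pos: "x \<in> V \<Longrightarrow> det (first_form X x) > 0"
  by (intro det_first_form_pos diff inj_D)

lemma density_pos: "x \<in> V \<Longrightarrow> area_density X x > 0"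
  by (simp add: area_density_def det_pos)

lemma pd_diff: "x \<in> V \<Longrightarrow> pd j X differentiable (at x)"
  unfolding pd_def using C2 Ck_on_2D(2) by blast

lemma form_diff: "x \<in> V \<Longrightarrow> (\<lambda>z. pd i X z \<bullet> pd j X z) differentiable (at x)"
  by (intro differentiable_inner pd_diff)

lemma det_diff: "x \<in> V \<Longrightarrow> (\<lambda>z. det (first_form X z)) differentiable (at x)"
  unfolding det_first_form power2_eq_square by (intro derivative_intros form_diff)

lemma density_diff: "x \<in> V \<Longrightarrow> area_density X differentiable (at x)"
proof -
  assume x: "x \<in> V"
  have "(sqrt has_derivative ((*) (inverse (sqrt (det (first_form X x))) / 2))) (at (det (first_form X x)))"
    using DERIV_real_sqrt[OF det_pos[OF x]] by (simp add: has_field_derivative_def)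
  from has_derivative_compose[OF det_diff[OF x, unfolded frechet_derivative_works] this]
  show ?thesis unfolding area_density_def[abs_def] differentiable_def by blast
qed

text \<open>In dimension two the weight is the cofactor matrix over the area density, since the
  square of the density is the determinant. Differentiability can be read off from this
  form.\<close>

lemma weight_eq:
  assumes "z \<in> V"
  shows "weight i j z = (if i = 1 then if j = 1 then pd 2 X z \<bullet> pd 2 X z else - (pd 1 X z \<bullet> pd 2 X z)
    else if j = 1 then - (pd 2 X z \<bullet> pd 1 X z) else pd 1 X z \<bullet> pd 1 X z) / area_density X z"
proof -
  have "area_density X z * area_density X z = det (first_form X z)"
    using det_pos[OF assms] by (simp add: area_density_def)
  moreover have "area_density X z > 0" using density_pos assms .
  ultimately have *: "area_density X z / det (first_form X z) = 1 / area_density X z"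
    by (metis divide_divide_eq_left divide_self_if less_irrefl)
  have "area_density X z * (r / det (first_form X z)) = r / area_density X z" for r
    using arg_cong[OF *, of "\<lambda>t. r * t"] by (simp add: mult.commute)
  then show ?thesis unfolding weight_def matrix_inv_2[OF det_pos[OF assms, THEN less_imp_neq, THEN not_sym]]
    by (simp add: first_form_def)
qed

lemma weight_diff:
  assumes "x \<in> V"
  shows "weight i j differentiable (at x)"
proof -
  have "(\<lambda>z. (if i = 1 then if j = 1 then pd 2 X z \<bullet> pd 2 X z else - (pd 1 X z \<bullet> pd 2 X z)
    else if j = 1 then - (pd 2 X z \<bullet> pd 1 X z) else pd 1 X z \<bullet> pd 1 X z) / area_density X z) differentiable (at x)"
    using form_diff[OF assms] density_diff[OF assms] density_pos[OF assms]
    by (cases "i = 1"; cases "j = 1") (auto intro!: derivative_intros)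
  then obtain D where "((\<lambda>z. (if i = 1 then if j = 1 then pd 2 X z \<bullet> pd 2 X z else - (pd 1 X z \<bullet> pd 2 X z)
    else if j = 1 then - (pd 2 X z \<bullet> pd 1 X z) else pd 1 X z \<bullet> pd 1 X z) / area_density X z) has_derivative D) (at x)"
    unfolding differentiable_def by blast
  then have "(weight i j has_derivative D) (at x)"
    by (rule has_derivative_transform_within_open[OF _ open_V assms]) (simp add: weight_eq)
  then show ?thesis unfolding differentiable_def by blast
qed

lemma laplacian_coord_expand:
  assumes x: "x \<in> U" "x \<in> V" and U: "open U" and u: "Ck_on 2 u U"
  shows "laplacian_coord X u x =
    (\<Sum>i\<in>UNIV. \<Sum>j\<in>UNIV. gi x $ i $ j * pd i (pd j u) x) + (\<Sum>j\<in>UNIV. drift j x * pd j u x)"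
proof -
  have du: "pd j u differentiable (at x)" for j
    unfolding pd_def using Ck_on_2D(2)[OF u x(1)] .
  have "pd i (\<lambda>z. area_density X z * (\<Sum>j\<in>UNIV. gi z $ i $ j * pd j u z)) x
    = (\<Sum>j\<in>UNIV. weight i j x * pd i (pd j u) x + pd i (weight i j) x * pd j u x)" for i
  proof -
    have "(\<lambda>z. area_density X z * (\<Sum>j\<in>UNIV. gi z $ i $ j * pd j u z)) =
      (\<lambda>z. \<Sum>j\<in>UNIV. weight i j z * pd j u z)"
      by (simp add: weight_def sum_distrib_left mult.assoc)
    then show ?thesis using du weight_diff[OF x(2)] by (simp add: pd_sum pd_mult)
  qed
  then show ?thesis using density_pos[OF x(2)] unfolding laplacian_coord_def drift_def
    by (simp add: sum_2 weight_def field_simps)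
qed

lemma weight_form:
  assumes "z \<in> V"
  shows "(\<Sum>j\<in>UNIV. weight i j z * (pd j X z \<bullet> pd k X z)) = (if i = k then area_density X z else 0)"
proof -
  have "gi z ** first_form X z = mat 1"
    using det_pos[OF assms] by (metis invertible_det_nz less_irrefl invertible_def matrix_inv_unique)
  then have "(gi z ** first_form X z) $ i $ k = mat 1 $ i $ k" by simp
  then have "(\<Sum>j\<in>UNIV. gi z $ i $ j * (pd j X z \<bullet> pd k X z)) = (if i = k then 1 else 0)"
    by (simp add: matrix_matrix_mult_def first_form_def mat_def)
  from arg_cong[OF this, of "\<lambda>t. area_density X z * t"] show ?thesis
    by (simp add: weight_def sum_distrib_left mult.assoc)
qed

text \<open>Jacobi's formula for the derivative of a determinant, halved by the square root.
  Differentiating the square of the density avoids the derivative of the root.\<close>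

lemma pd_density:
  assumes x: "x \<in> V"
  shows "pd k (area_density X) x = (\<Sum>i\<in>UNIV. \<Sum>j\<in>UNIV. weight i j x * (pd j X x \<bullet> pd k (pd i X) x))"
proof -
  let ?A = "area_density X x"
  have "pd k (\<lambda>z. area_density X z * area_density X z) x = 2 * ?A * pd k (area_density X) x"
    using density_diff[OF x] by (simp add: pd_mult)
  moreover have "pd k (\<lambda>z. area_density X z * area_density X z) x = pd k (\<lambda>z. det (first_form X z)) x"
  proof (rule pd_cong[OF open_V x])
    show "(\<lambda>z. area_density X z * area_density X z) differentiable at x"
      using density_diff[OF x] by (intro derivative_intros)
    show "area_density X z * area_density X z = det (first_form X z)" if "z \<in> V" for z
      using det_pos[OF that] by (simp add: area_density_def)
  qed
  moreover have "pd k (\<lambda>z. det (first_form X z)) x =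
     2 * ((pd 2 X x \<bullet> pd 2 X x) * (pd 1 X x \<bullet> pd k (pd 1 X) x) + (pd 1 X x \<bullet> pd 1 X x) * (pd 2 X x \<bullet> pd k (pd 2 X) x)
      - (pd 1 X x \<bullet> pd 2 X x) * (pd 1 X x \<bullet> pd k (pd 2 X) x + pd 2 X x \<bullet> pd k (pd 1 X) x))"
  proof -
    have "((\<lambda>z. det (first_form X z)) has_derivative (\<lambda>w.
      (2 * ((pd 2 X x \<bullet> pd 2 X x) * (pd 1 X x \<bullet> frechet_derivative (pd 1 X) (at x) w) +
       (pd 1 X x \<bullet> pd 1 X x) * (pd 2 X x \<bullet> frechet_derivative (pd 2 X) (at x) w)
      - (pd 1 X x \<bullet> pd 2 X x) * (pd 1 X x \<bullet> frechet_derivative (pd 2 X) (at x) w +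
        pd 2 X x \<bullet> frechet_derivative (pd 1 X) (at x) w))))) (at x)"
      unfolding det_first_form power2_eq_square
      by (auto intro!: derivative_eq_intros pd_diff[OF x, unfolded frechet_derivative_works]
        simp: fun_eq_iff inner_commute algebra_simps)
    from pdI[OF this] show ?thesis unfolding pd_def[of k "pd _ X"] .
  qed
  ultimately have "pd k (area_density X) x =
     ((pd 2 X x \<bullet> pd 2 X x) * (pd 1 X x \<bullet> pd k (pd 1 X) x) + (pd 1 X x \<bullet> pd 1 X x) * (pd 2 X x \<bullet> pd k (pd 2 X) x)
      - (pd 1 X x \<bullet> pd 2 X x) * (pd 1 X x \<bullet> pd k (pd 2 X) x + pd 2 X x \<bullet> pd k (pd 1 X) x)) / ?A"
    using density_pos[OF x] by (simp add: eq_divide_eq algebra_simps)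
  then show ?thesis
    by (simp add: sum_2 weight_eq[OF x] inner_commute add_divide_distrib diff_divide_distrib algebra_simps)
qed

text \<open>Testing \<open>div (\<surd>g g\<^sup>-\<^sup>1 \<nabla>X)\<close> against \<open>\<partial>\<^sub>k X\<close> and integrating by parts leaves
  \<open>\<partial>\<^sub>k \<surd>g\<close> minus the variation of the area density, which cancel.\<close>

lemma lap_imm_orthogonal:
  assumes x: "x \<in> V"
  shows "lap_imm x \<bullet> pd k X x = 0"
proof -
  let ?A = "area_density X x"
  have "pd i (\<lambda>z. \<Sum>j\<in>UNIV. weight i j z * (pd j X z \<bullet> pd k X z)) x =
    (\<Sum>j\<in>UNIV. weight i j x * (pd i (pd j X) x \<bullet> pd k X x) + weight i j x * (pd j X x \<bullet> pd k (pd i X) x)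
      + pd i (weight i j) x * (pd j X x \<bullet> pd k X x))" for i
    using weight_diff[OF x] pd_diff[OF x] form_diff[OF x] pd_commute[OF open_V x C2, of k i]
    by (simp add: pd_sum pd_mult pd_inner differentiable_mult algebra_simps)
  moreover have "pd i (\<lambda>z. \<Sum>j\<in>UNIV. weight i j z * (pd j X z \<bullet> pd k X z)) x =
    (if i = k then pd k (area_density X) x else 0)" for i
  proof -
    have "pd i (\<lambda>z. \<Sum>j\<in>UNIV. weight i j z * (pd j X z \<bullet> pd k X z)) x =
      pd i (\<lambda>z. if i = k then area_density X z else 0) x"
    proof (rule pd_cong[OF open_V x _ weight_form])
      show "(\<lambda>z. \<Sum>j\<in>UNIV. weight i j z * (pd j X z \<bullet> pd k X z)) differentiable at x"
        using weight_diff[OF x] form_diff[OF x]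
        by (intro differentiable_sum differentiable_mult) auto
    qed
    then show ?thesis by (cases "i = k") (auto simp: pd_def[of _ "\<lambda>x. 0"])
  qed
  ultimately have "(\<Sum>i\<in>UNIV. \<Sum>j\<in>UNIV. weight i j x * (pd i (pd j X) x \<bullet> pd k X x)
      + weight i j x * (pd j X x \<bullet> pd k (pd i X) x)
      + pd i (weight i j) x * (pd j X x \<bullet> pd k X x)) = (\<Sum>i\<in>UNIV. if i = k then pd k (area_density X) x else 0)"
    by simp
  also have "\<dots> = (\<Sum>i\<in>UNIV. \<Sum>j\<in>UNIV. weight i j x * (pd j X x \<bullet> pd k (pd i X) x))"
    by (simp add: pd_density[OF x] del: sum_2)
  finally have "(\<Sum>i\<in>UNIV. \<Sum>j\<in>UNIV. weight i j x * (pd i (pd j X) x \<bullet> pd k X x)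
      + pd i (weight i j) x * (pd j X x \<bullet> pd k X x)) = 0"
    by (simp add: sum.distrib)
  moreover have "?A * (lap_imm x \<bullet> pd k X x) = (\<Sum>i\<in>UNIV. \<Sum>j\<in>UNIV. weight i j x * (pd i (pd j X) x \<bullet> pd k X x)
      + pd i (weight i j) x * (pd j X x \<bullet> pd k X x))"
    using density_pos[OF x]
    by (simp add: lap_imm_def drift_def weight_def sum_2 inner_add_left field_simps)
  ultimately show ?thesis using density_pos[OF x] by simp
qed

text \<open>If \<open>P\<close> has the columns \<open>v k\<close> and \<open>G\<close> is the first
  form, orthonormality says that the transpose of \<open>P\<close> times \<open>G ** P\<close> is
  the identity, so the inverse of \<open>G\<close> is \<open>P\<close> times its transpose.\<close>

lemma orthonormal_inverse:
  fixes v :: "2 \<Rightarrow> real^2"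
  assumes "x \<in> V"
    and "\<And>i j. frechet_derivative X (at x) (v i) \<bullet> frechet_derivative X (at x) (v j) = (if i = j then 1 else 0)"
  shows "gi x $ i $ j = (\<Sum>k\<in>UNIV. v k $ i * v k $ j)"
proof -
  let ?P = "(\<chi> i k. v k $ i) :: real^2^2" and ?G = "first_form X x"
  have "transpose ?P ** (?G ** ?P) = mat 1"
  proof -
    have "(transpose ?P ** (?G ** ?P)) $ i $ j =
      frechet_derivative X (at x) (v i) \<bullet> frechet_derivative X (at x) (v j)" for i j
      by (simp add: frechet_derivative_pd[OF diff[OF assms(1)]] matrix_matrix_mult_def transpose_def
        first_form_def sum_2 inner_add_left inner_add_right algebra_simps inner_commute)
    then show ?thesis using assms(2) by (simp add: vec_eq_iff mat_def)
  qed
  then have "?G ** (?P ** transpose ?P) = mat 1"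
    using matrix_left_right_inverse by (metis matrix_mul_assoc)
  from matrix_inv_unique[OF this] show ?thesis
    by (simp add: matrix_matrix_mult_def transpose_def)
qed

lemma second_form_trace_orthonormal:
  fixes v :: "2 \<Rightarrow> real^2"
  assumes "x \<in> V"
    and "\<And>i j. frechet_derivative X (at x) (v i) \<bullet> frechet_derivative X (at x) (v j) = (if i = j then 1 else 0)"
  shows "trace (gi x ** second_form X n x) = (\<Sum>k\<in>UNIV. second_dd X x (v k) \<bullet> n)"
  by (simp add: second_dd_pd[OF open_V assms(1) C2] trace_def matrix_matrix_mult_def second_form_def
      orthonormal_inverse[OF assms] sum_2 inner_add_left algebra_simps)

lemma lap_imm_orthonormal:
  fixes v :: "2 \<Rightarrow> real^2"
  assumes "x \<in> V"
    and "\<And>i j. frechet_derivative X (at x) (v i) \<bullet> frechet_derivative X (at x) (v j) = (if i = j then 1 else 0)"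
  shows "lap_imm x = (\<Sum>k\<in>UNIV. second_dd X x (v k)) + (\<Sum>j\<in>UNIV. drift j x *\<^sub>R pd j X x)"
  by (simp add: second_dd_pd[OF open_V assms(1) C2] lap_imm_def
      orthonormal_inverse[OF assms] sum_2 algebra_simps)

text \<open>Turns the trace part into second derivatives along two lines, the quantities that a
  second variation can bound.\<close>

lemma laplacian_coord_orthonormal:
  fixes v :: "2 \<Rightarrow> real^2"
  assumes x: "x \<in> V"
    and v: "\<And>i j. frechet_derivative X (at x) (v i) \<bullet> frechet_derivative X (at x) (v j) = (if i = j then 1 else 0)"
    and U: "x \<in> U" "open U" and u: "Ck_on 2 u U"
  shows "laplacian_coord X u x = (\<Sum>k\<in>UNIV. second_dd u x (v k)) + (\<Sum>j\<in>UNIV. drift j x * pd j u x)"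
  by (simp add: laplacian_coord_expand[OF U(1) x U(2) u] second_dd_pd[OF U(2,1) u]
      orthonormal_inverse[OF x v] sum_2 algebra_simps)

end

section \<open>Second variation of the distance between two surfaces\<close>

text \<open>\<open>\<phi>'\<close> need only be differentiable at 0. If \<open>D > 0\<close>, then
  \<open>\<phi>'\<close> is positive just to the right of its zero at 0, and the mean value theorem
  pushes \<phi> above its maximum.\<close>

lemma second_order_local_max:
  fixes \<phi> :: "real \<Rightarrow> real"
  assumes max: "\<forall>\<^sub>F s in nhds 0. \<phi> s \<le> \<phi> 0"
    and der: "\<forall>\<^sub>F s in nhds 0. (\<phi> has_vector_derivative \<phi>' s) (at s)"
    and der2: "(\<phi>' has_vector_derivative D) (at 0)"
  shows "\<phi>' 0 = 0" "D \<le> 0"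
proof -
  obtain e where e: "e > 0" "\<And>s. \<bar>s\<bar> < e \<Longrightarrow> \<phi> s \<le> \<phi> 0 \<and> (\<phi> has_real_derivative \<phi>' s) (at s)"
    using eventually_conj[OF max der] unfolding eventually_nhds_metric
    by (auto simp: dist_real_def has_real_derivative_iff_has_vector_derivative)
  show z: "\<phi>' 0 = 0"
    using DERIV_local_max[of \<phi> "\<phi>' 0" 0 e] e by simp
  show "D \<le> 0"
  proof (rule ccontr)
    assume "\<not> D \<le> 0"
    then obtain d where d: "d > 0" "\<And>h. 0 < h \<Longrightarrow> h < d \<Longrightarrow> \<phi>' 0 < \<phi>' (0 + h)"
      using DERIV_pos_inc_right[of \<phi>' D 0] der2 by (auto simp: has_real_derivative_iff_has_vector_derivative)
    define h where "h = min d e / 2"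
    have h: "0 < h" "h < d" "h < e" using d e by (auto simp: h_def)
    have "\<exists>z. 0 < z \<and> z < h \<and> \<phi> h - \<phi> 0 = (h - 0) * \<phi>' z"
      using h by (intro MVT2) (auto intro: e(2)[THEN conjunct2])
    then obtain r where r: "0 < r" "r < h" "\<phi> h - \<phi> 0 = h * \<phi>' r" by auto
    then have "\<phi> h - \<phi> 0 > 0" using d(2)[of r] h z by simp
    then show False using e(2)[of h] h by simp
  qed
qed

text \<open>The joint maximum is restricted to the line with velocity \<open>(v, w)\<close>. The two
  velocities are independent, so \<open>w\<close> may be fitted to \<open>v\<close> afterwards, and
  \<open>v = 0\<close> or \<open>w = 0\<close> varies one point alone.\<close>

lemma two_point_second_order:
  fixes X Y :: "real^2 \<Rightarrow> real^3" and g :: "real^2 \<Rightarrow> real" and x y v w :: "real^2"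
  defines "c \<equiv> X x - Y y"
    and "c' \<equiv> frechet_derivative X (at x) v - frechet_derivative Y (at y) w"
    and "c'' \<equiv> second_dd X x v - second_dd Y y w"
  assumes U: "open U" "x \<in> U" "Ck_on 2 X U" "Ck_on 2 g U" and V: "open V" "y \<in> V" "Ck_on 2 Y V"
    and max: "\<And>p q. p \<in> U \<Longrightarrow> q \<in> V \<Longrightarrow>
      exp (- b * ((X p - Y q) \<bullet> (X p - Y q))) + g p \<le> exp (- b * ((X x - Y y) \<bullet> (X x - Y y))) + g x"
  shows "frechet_derivative g (at x) v = exp (- b * (c \<bullet> c)) * (2 * b * (c \<bullet> c'))"
    and "second_dd g x v \<le> exp (- b * (c \<bullet> c)) * (2 * b * (c' \<bullet> c' + c \<bullet> c'') - 4 * b\<^sup>2 * (c \<bullet> c')\<^sup>2)"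
proof -
  define C where "C = (\<lambda>s. X (x + s *\<^sub>R v) - Y (y + s *\<^sub>R w))"
  define C' where "C' = (\<lambda>s. frechet_derivative X (at (x + s *\<^sub>R v)) v - frechet_derivative Y (at (y + s *\<^sub>R w)) w)"
  define G' where "G' = (\<lambda>s. frechet_derivative g (at (x + s *\<^sub>R v)) v)"
  let ?\<phi> = "\<lambda>s. exp (- b * (C s \<bullet> C s)) + g (x + s *\<^sub>R v)"
  let ?\<phi>' = "\<lambda>s. exp (- b * (C s \<bullet> C s)) * (- b * (2 * (C s \<bullet> C' s))) + G' s"
  have C0: "C 0 = c" "C' 0 = c'" "G' 0 = frechet_derivative g (at x) v"
    by (simp_all add: C_def C'_def c_def c'_def G'_def)
  have dC: "\<forall>\<^sub>F s in nhds 0. (C has_vector_derivative C' s) (at s)"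
    using twice_along_line(1)[OF U(1,2,3), of v] twice_along_line(1)[OF V, of w]
    unfolding C_def C'_def by eventually_elim (rule has_vector_derivative_diff)
  have dC': "(C' has_vector_derivative c'') (at 0)"
    unfolding C'_def c''_def
    by (intro has_vector_derivative_diff twice_along_line(2)[OF U(1,2,3)] twice_along_line(2)[OF V])
  have dG: "\<forall>\<^sub>F s in nhds 0. ((\<lambda>s. g (x + s *\<^sub>R v)) has_vector_derivative G' s) (at s)"
    using twice_along_line(1)[OF U(1,2,4)] unfolding G'_def .
  have dG': "(G' has_vector_derivative second_dd g x v) (at 0)"
    using twice_along_line(2)[OF U(1,2,4)] unfolding G'_def .
  have d1: "\<forall>\<^sub>F s in nhds 0. (?\<phi> has_vector_derivative ?\<phi>' s) (at s)"
    using dC dG unfolding has_vector_derivative_def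
    by eventually_elim (auto intro!: derivative_eq_intros simp: fun_eq_iff inner_commute algebra_simps)
  have dC0: "(C has_vector_derivative c') (at 0)"
    using eventually_nhds_x_imp_x[OF dC] by (simp add: C0)
  have d2: "(?\<phi>' has_vector_derivative
     exp (- b * (c \<bullet> c)) * ((- b * (2 * (c \<bullet> c')))\<^sup>2 - 2 * b * (c' \<bullet> c' + c \<bullet> c'')) + second_dd g x v) (at 0)"
    using dC0 dC' dG' unfolding has_vector_derivative_def
    by (auto intro!: derivative_eq_intros simp: C0 fun_eq_iff inner_commute algebra_simps power2_eq_square)
  have m: "\<forall>\<^sub>F s in nhds 0. ?\<phi> s \<le> ?\<phi> 0"
    using eventually_along_line[OF U(1,2), of v] eventually_along_line[OF V(1,2), of w]
    by eventually_elim (use max in \<open>simp add: C_def\<close>)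
  from second_order_local_max[OF m d1 d2]
  show "frechet_derivative g (at x) v = exp (- b * (c \<bullet> c)) * (2 * b * (c \<bullet> c'))"
    and "second_dd g x v \<le> exp (- b * (c \<bullet> c)) * (2 * b * (c' \<bullet> c' + c \<bullet> c'') - 4 * b\<^sup>2 * (c \<bullet> c')\<^sup>2)"
    by (auto simp: C0 algebra_simps power_mult_distrib)
qed

text \<open>A plane in an inner product space always contains a direction orthogonal to a given
  vector; the second frame vector comes from Gram-Schmidt in the pulled-back metric.\<close>

lemma orthonormal_frame_orthogonal_to:
  fixes D :: "real^2 \<Rightarrow> 'a::real_inner"
  assumes "linear D" "inj D"
  obtains v :: "2 \<Rightarrow> real^2" where "\<And>i j. D (v i) \<bullet> D (v j) = (if i = j then 1 else 0)" "D (v 1) \<bullet> c = 0"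
proof -
  interpret linear D by fact
  have D0: "D p \<noteq> 0" if "p \<noteq> 0" for p using assms that linear_injective_0 by blast
  define a where "a i = D (axis i 1)" for i :: 2
  have Da: "D p = p $ 1 *\<^sub>R a 1 + p $ 2 *\<^sub>R a 2" for p
    by (subst real2_expand[of p]) (simp only: add scaleR sum_2 a_def)
  have "\<exists>p. p \<noteq> 0 \<and> D p \<bullet> c = 0"
  proof (cases "a 1 \<bullet> c = 0")
    case True
    then show ?thesis by (intro exI[of _ "axis 1 1"]) (auto simp: a_def axis_eq_0_iff)
  next
    case False
    let ?p = "vector [a 2 \<bullet> c, - (a 1 \<bullet> c)] :: real^2"
    have "?p $ 2 \<noteq> 0" using False by simp
    then have "?p \<noteq> 0" by (metis zero_index)
    then show ?thesis by (intro exI[of _ ?p]) (auto simp: Da inner_add_left inner_diff_left)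
  qed
  then obtain p where p: "p \<noteq> 0" "D p \<bullet> c = 0" by blast
  define p1 where "p1 = (1 / norm (D p)) *\<^sub>R p"
  have p1: "p1 \<noteq> 0" "norm (D p1) = 1" "D p1 \<bullet> c = 0" using p D0[OF p(1)] by (auto simp: p1_def scaleR)
  \<comment> \<open>The quarter turn of \<open>p1\<close> in coordinates is independent of
    \<open>p1\<close>; its component along \<open>p1\<close>, measured through \<open>D\<close>, is
    removed.\<close>
  define q where "q = vector [- p1 $ 2, p1 $ 1] - (D (vector [- p1 $ 2, p1 $ 1]) \<bullet> D p1) *\<^sub>R p1"
  have "q \<noteq> 0"
  proof
    assume "q = 0"
    then obtain t where t: "vector [- p1 $ 2, p1 $ 1] = t *\<^sub>R p1" unfolding q_def by auto
    have "- p1 $ 2 = t * p1 $ 1" "p1 $ 1 = t * p1 $ 2"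
      using arg_cong[OF t, of "\<lambda>z. z $ 1"] arg_cong[OF t, of "\<lambda>z. z $ 2"] by auto
    then have "(1 + t * t) * p1 $ 1 = 0" "(1 + t * t) * p1 $ 2 = 0" by algebra+
    moreover have "1 + t * t \<noteq> 0" using zero_le_square[of t] by linarith
    ultimately have "p1 = 0" by (auto simp: vec_eq_iff forall_2)
    then show False using p1 by simp
  qed
  have one: "D p1 \<bullet> D p1 = 1" using p1 by (simp add: norm_eq_1)
  have qo: "D q \<bullet> D p1 = 0" unfolding q_def using one by (simp add: diff scaleR inner_diff_left)
  define p2 where "p2 = (1 / norm (D q)) *\<^sub>R q"
  have p2: "norm (D p2) = 1" "D p2 \<bullet> D p1 = 0"
    using D0[OF \<open>q \<noteq> 0\<close>] qo by (auto simp: p2_def scaleR)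
  have two: "D p2 \<bullet> D p2 = 1" using p2 by (simp add: norm_eq_1)
  show thesis
    by (rule that[of "\<lambda>i. if i = 1 then p1 else p2"])
      (use one two p2 p1 in \<open>auto simp: inner_commute\<close>, metis exhaust_2)
qed

lemma orthonormal_expansion_3:
  fixes x :: "real^3"
  assumes "norm a = 1" "norm b = 1" "norm c = 1" "a \<bullet> b = 0" "a \<bullet> c = 0" "b \<bullet> c = 0"
  shows "x = (x \<bullet> a) *\<^sub>R a + (x \<bullet> b) *\<^sub>R b + (x \<bullet> c) *\<^sub>R c"
proof -
  let ?S = "{a, b, c}"
  let ?y = "x - ((x \<bullet> a) *\<^sub>R a + (x \<bullet> b) *\<^sub>R b + (x \<bullet> c) *\<^sub>R c)"
  have one: "a \<bullet> a = 1" "b \<bullet> b = 1" "c \<bullet> c = 1" using assms by (auto simp: norm_eq_1)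
  have ne: "a \<noteq> b" "a \<noteq> c" "b \<noteq> c" using assms one by auto
  have "pairwise orthogonal ?S" "0 \<notin> ?S"
    using assms one by (auto simp: pairwise_def orthogonal_def inner_commute)
  then have "independent ?S" by (rule pairwise_orthogonal_independent)
  moreover have "card ?S = 3" using ne by simp
  ultimately have "dim ?S = DIM(real^3)" by (simp add: dim_eq_card_independent)
  then have sp: "span ?S = UNIV" by (simp only: dim_eq_full)
  have "?y \<bullet> z = 0" if "z \<in> ?S" for z
    using that one assms
    by (auto simp: inner_diff_left inner_add_left inner_diff_right inner_add_right inner_commute)
  then have "orthogonal ?y ?y"
    by (intro orthogonal_to_span[of ?y ?S]) (simp_all add: sp orthogonal_def)
  then show ?thesis by (simp add: orthogonal_def)
qed

text \<open>The range of \<open>D\<close> is a plane contained in the plane orthogonal to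
  \<open>c\<close>, so the two coincide.\<close>

lemma range_eq_orthogonal_complement:
  fixes D :: "real^2 \<Rightarrow> real^3"
  assumes "linear D" "inj D" "c \<noteq> 0" "\<And>w. c \<bullet> D w = 0" "c \<bullet> e = 0"
  shows "e \<in> range D"
proof -
  have "subspace (range D)" using assms by (intro linear_subspace_image) (auto simp: subspace_UNIV)
  moreover have "dim (range D) = 2" using dim_image_eq[OF assms(1), of UNIV] assms(2) by simp
  moreover have "subspace {x. c \<bullet> x = 0}" by (rule subspace_hyperplane)
  moreover have "dim {x. c \<bullet> x = 0} = 2" using dim_hyperplane[OF assms(3)] by simp
  ultimately have "range D = {x. c \<bullet> x = 0}"
    by (intro subspace_dim_equal) (use assms(4) in auto)
  then show ?thesis using assms(5) by blast
qed

text \<open>\<kappa> and \<sigma> are the cosine and sine of the angle between the tangent planes.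
  Replacing \<open>Q1 + Q2\<close> by \<open>Q1 + \<kappa>\<^sup>2 * Q2\<close> costs at most
  \<open>\<sigma>\<^sup>2\<close>, which the dilation multiplies by at most 4; with the free
  \<open>\<sigma>\<^sup>2\<close> this makes the 5 that \<open>2 * b * \<rho>\<^sup>2\<close>
  dominates. The terms \<open>\<rho> * H\<close> cancel, and the gain
  \<open>2 * s * \<rho> * H\<close> exceeds the cost \<open>2 * s\<^sup>2\<close> by at least
  \<open>s * d * H\<close>.\<close>

lemma two_point_arithmetic:
  fixes b s d H \<rho> \<kappa> \<sigma> Q1 Q2 L :: real
  assumes "H > 0" "d > 0" "0 \<le> s" "s \<le> 1" "2 * s \<le> d * H" "5 \<le> 2 * b * d\<^sup>2" "d \<le> \<rho>" "b > 0"
    and "\<rho> * H \<le> Q1 + Q2" "Q2 \<le> 1" "L \<le> \<rho> * H" "\<kappa>\<^sup>2 + \<sigma>\<^sup>2 = 1"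
  shows "2 * b * (s\<^sup>2 + \<sigma>\<^sup>2 + s\<^sup>2 * \<kappa>\<^sup>2 - (1 + s)\<^sup>2 * (Q1 + \<kappa>\<^sup>2 * Q2) + L) - 4 * b\<^sup>2 * (\<rho> * \<sigma>)\<^sup>2
    \<le> - (2 * b * s * d * H)"
proof -
  have s2: "\<sigma>\<^sup>2 \<ge> 0" "\<kappa>\<^sup>2 \<le> 1" "\<kappa>\<^sup>2 = 1 - \<sigma>\<^sup>2" using assms(12) zero_le_power2[of \<sigma>] by linarith+
  have "\<sigma>\<^sup>2 * Q2 \<le> \<sigma>\<^sup>2" using assms(10) s2(1) by (simp add: mult_left_le)
  then have "Q1 + \<kappa>\<^sup>2 * Q2 \<ge> \<rho> * H - \<sigma>\<^sup>2" using assms(9) by (simp add: s2(3) algebra_simps)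
  then have 1: "(1 + s)\<^sup>2 * (Q1 + \<kappa>\<^sup>2 * Q2) \<ge> (1 + s)\<^sup>2 * (\<rho> * H - \<sigma>\<^sup>2)" by (intro mult_left_mono) auto
  have "\<rho> * H \<ge> 0" using assms by simp
  then have 2: "(1 + s)\<^sup>2 * (\<rho> * H) \<ge> (1 + 2 * s) * (\<rho> * H)"
    by (intro mult_right_mono) (auto simp: power2_sum)
  have "(1 + s)\<^sup>2 \<le> 2\<^sup>2" using assms by (intro power_mono) auto
  then have 3: "(1 + s)\<^sup>2 * \<sigma>\<^sup>2 \<le> 4 * \<sigma>\<^sup>2" using s2 by (intro mult_right_mono) auto
  have 4: "s\<^sup>2 * \<kappa>\<^sup>2 \<le> s\<^sup>2" using s2 by (simp add: mult_left_le)
  have 5: "2 * s\<^sup>2 \<le> s * d * H" using mult_left_mono[OF assms(5,3)] by (simp add: power2_eq_square algebra_simps)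
  have 6: "s * d * H \<le> s * (\<rho> * H)"
    using mult_right_mono[OF assms(7), of "s * H"] assms by (simp add: algebra_simps)
  have "2 * b * d\<^sup>2 \<le> 2 * b * \<rho>\<^sup>2" using assms by (intro mult_left_mono power_mono) auto
  then have "5 \<le> 2 * b * \<rho>\<^sup>2" using assms(6) by linarith
  then have 7: "5 * \<sigma>\<^sup>2 \<le> 2 * b * \<rho>\<^sup>2 * \<sigma>\<^sup>2" using s2 by (intro mult_right_mono)
  have "s\<^sup>2 + \<sigma>\<^sup>2 + s\<^sup>2 * \<kappa>\<^sup>2 - (1 + s)\<^sup>2 * (Q1 + \<kappa>\<^sup>2 * Q2) + L - 2 * b * \<rho>\<^sup>2 * \<sigma>\<^sup>2 \<le> - (s * d * H)"
    using 1 2 3 4 5 6 7 assms(11) unfolding right_diff_distrib left_diff_distrib distrib_right by linarith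
  from mult_left_mono[OF this, of "2 * b"] show ?thesis
    using assms(8) by (simp add: power2_eq_square algebra_simps)
qed
lemma second_dd_0:
  fixes f :: "real^2 \<Rightarrow> 'b::real_normed_vector"
  assumes "open S" "x \<in> S" "Ck_on 2 f S"
  shows "second_dd f x 0 = 0"
  using second_dd_scaleR[OF assms, of 0 0] by simp

text \<open>The comparison displacement of the foot point is \<open>1 + s\<close> times the projected displacement of
  the point on the first surface; the dilation by \<open>s > 0\<close> gains \<open>2 s H\<close> from the mean curvature of
  the second surface at the cost \<open>O(s\<^sup>2)\<close>, which is what makes the inequality strict.\<close>

lemma two_point_laplacian:
  fixes X Y :: "real^2 \<Rightarrow> real^3" and g :: "real^2 \<Rightarrow> real" and x y :: "real^2"
  defines "c \<equiv> X x - Y y"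
  assumes patches: "immersion_patch U X" "immersion_patch V Y" and x: "x \<in> U" and y: "y \<in> V"
    and g: "Ck_on 2 g U"
    and max: "\<And>p q. p \<in> U \<Longrightarrow> q \<in> V \<Longrightarrow>
      exp (- b * ((X p - Y q) \<bullet> (X p - Y q))) + g p \<le> exp (- b * ((X x - Y y) \<bullet> (X x - Y y))) + g x"
    and par: "H > 0" "d > 0" "0 \<le> s" "s \<le> 1" "2 * s \<le> d * H" "5 \<le> 2 * b * d\<^sup>2" "d \<le> norm c" "b > 0"
    and HX: "norm (immersion_patch.lap_imm X x) \<le> H"
    and HY: "trace (matrix_inv (first_form Y y) ** second_form Y (c /\<^sub>R norm c) y) \<ge> H"
  shows "laplacian_coord X g x \<le> - (2 * b * s * d * H) * exp (- b * (c \<bullet> c))"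
proof -
  interpret X: immersion_patch U X by fact
  interpret Y: immersion_patch V Y by fact
  let ?DX = "frechet_derivative X (at x)" and ?DY = "frechet_derivative Y (at y)"
  let ?u = "exp (- b * (c \<bullet> c))" and ?\<rho> = "norm c"
  define n where "n = c /\<^sub>R norm c"
  note U = X.open_V x X.C2 g and V = Y.open_V y Y.C2
  note first = two_point_second_order(1)[OF U V max, folded c_def]
  note second = two_point_second_order(2)[OF U V max, folded c_def]
  have lin: "linear ?DX" "linear ?DY"
    using X.diff[OF x] Y.diff[OF y] by (auto intro: linear_frechet_derivative)
  have rho: "?\<rho> > 0" using par by linarith
  have c: "c = ?\<rho> *\<^sub>R n" and n: "norm n = 1" using rho by (auto simp: n_def)
  have nn: "n \<bullet> n = 1" using n by (simp add: norm_eq_1)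
  \<comment> \<open>Only the foot point moves (\<open>v = 0\<close>), so \<open>g\<close> does not
    vary and the first-order condition concerns the distance alone.\<close>
  have normalY: "c \<bullet> ?DY w = 0" for w
    using first[of 0 w] par(8) linear_0[OF lin(1)] linear_0[OF linear_frechet_derivative[of g "at x"]]
      Ck_on_2D(1)[OF g x] by simp
  \<comment> \<open>Only the point of the first surface moves (\<open>w = 0\<close>).\<close>
  have gradg: "frechet_derivative g (at x) v = ?u * (2 * b * (c \<bullet> ?DX v))" for v
    using first[of v 0] linear_0[OF lin(2)] by simp
  \<comment> \<open>The choice \<open>?DX (v 1) \<bullet> c = 0\<close> makes \<open>e1\<close>
    tangent to both surfaces, because the tangent plane of \<open>Y\<close> is the orthogonal
    complement of \<open>c\<close>. All tilt is then in \<open>e2\<close>.\<close>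
  obtain v :: "2 \<Rightarrow> real^2" where v: "\<And>i j. ?DX (v i) \<bullet> ?DX (v j) = (if i = j then 1 else 0)" "?DX (v 1) \<bullet> c = 0"
    using orthonormal_frame_orthogonal_to[OF lin(1) X.inj_D[OF x]] by metis
  define e1 e2 where "e1 = ?DX (v 1)" and "e2 = ?DX (v 2)"
  obtain w :: "2 \<Rightarrow> real^2" where w: "\<And>i j. ?DY (w i) \<bullet> ?DY (w j) = (if i = j then 1 else 0)" "?DY (w 1) \<bullet> e1 = 0"
    using orthonormal_frame_orthogonal_to[OF lin(2) Y.inj_D[OF y]] by metis
  define w2 f where "w2 = w 1" and "f = ?DY w2"
  have "e1 \<in> range ?DY"
    using rho v(2) normalY
    by (intro range_eq_orthogonal_complement[OF lin(2) Y.inj_D[OF y]]) (auto simp: e1_def inner_commute)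
  then obtain w1 where w1: "?DY w1 = e1" by auto
  have ne12: "(1::2) \<noteq> 2" by simp
  have orth: "e1 \<bullet> e1 = 1" "e2 \<bullet> e2 = 1" "e1 \<bullet> e2 = 0" "f \<bullet> f = 1" "e1 \<bullet> f = 0" "c \<bullet> f = 0" "c \<bullet> e1 = 0"
    using v w normalY ne12 by (auto simp: e1_def e2_def f_def w2_def inner_commute)
  have orthn: "e1 \<bullet> n = 0" "f \<bullet> n = 0" using orth rho by (auto simp: n_def inner_commute)
  \<comment> \<open>\<open>e2\<close> is orthogonal to \<open>e1\<close>, so it lies in the plane of
    \<open>f\<close> and \<open>n\<close>; these are its coordinates there.\<close>
  define \<kappa> \<sigma> where "\<kappa> = e2 \<bullet> f" and "\<sigma> = e2 \<bullet> n"
  have e2: "e2 = \<kappa> *\<^sub>R f + \<sigma> *\<^sub>R n"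
    using orthonormal_expansion_3[of e1 f n e2] orth orthn n
    by (simp add: norm_eq_1 \<kappa>_def \<sigma>_def inner_commute)
  have ks: "\<kappa>\<^sup>2 + \<sigma>\<^sup>2 = 1"
    using orth(2) unfolding e2 using orth(4) nn orthn(2)
    by (simp add: inner_add_left inner_add_right inner_commute power2_eq_square)
  define Q1 Q2 where "Q1 = c \<bullet> second_dd Y y w1" and "Q2 = c \<bullet> second_dd Y y w2"
  \<comment> \<open>Second variation with the first point fixed: at a nearest point, the normal
    curvature towards \<open>x\<close> is at most the reciprocal of the distance.\<close>
  have "exp (- b * (c \<bullet> c)) * (2 * b * (1 - Q2)) \<ge> 0"
    using second[of 0 w2] orth(4,6) linear_0[OF lin(1)] second_dd_0[OF U(1,2,3)] second_dd_0[OF U(1,2,4)]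
    by (simp add: f_def[symmetric] Q2_def)
  then have Q2: "Q2 \<le> 1" using par(8) by (simp add: zero_le_mult_iff)
  define ww :: "2 \<Rightarrow> real^2" where "ww i = (if i = 1 then w1 else w2)" for i
  have ww: "?DY (ww i) \<bullet> ?DY (ww j) = (if i = j then 1 else 0)" for i j
    using orth w1 ne12 exhaust_2[of i] exhaust_2[of j] by (auto simp: ww_def f_def[symmetric] inner_commute)
  have "trace (matrix_inv (first_form Y y) ** second_form Y n y) = second_dd Y y w1 \<bullet> n + second_dd Y y w2 \<bullet> n"
    using Y.second_form_trace_orthonormal[OF y ww] by (simp add: sum_2 ww_def)
  also have "\<dots> = (Q1 + Q2) / ?\<rho>"
    using rho by (simp add: Q1_def Q2_def n_def inner_commute divide_inverse distrib_right distrib_left mult.commute)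
  finally have "(Q1 + Q2) / ?\<rho> \<ge> H" using HY by (simp add: n_def)
  then have Q12: "?\<rho> * H \<le> Q1 + Q2" using rho by (simp add: field_simps)
  define S1 S2 where "S1 = c \<bullet> second_dd X x (v 1)" and "S2 = c \<bullet> second_dd X x (v 2)"
  \<comment> \<open>In the common direction the foot point moves by \<open>1 + s\<close> times the
    same vector, so the points separate by \<open>- s *\<^sub>R e1\<close>, orthogonally to
    \<open>c\<close>.\<close>
  have g1: "second_dd g x (v 1) \<le> ?u * (2 * b * (s\<^sup>2 + S1 - (1 + s)\<^sup>2 * Q1))"
  proof -
    have 1: "?DX (v 1) - ?DY ((1 + s) *\<^sub>R w1) = - (s *\<^sub>R e1)" (is "?c' = _")
      unfolding linear_cmul[OF lin(2)] w1 e1_def[symmetric] by (simp add: algebra_simps)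
    have 2: "?c' \<bullet> ?c' = s\<^sup>2" unfolding 1 using orth by (simp add: power2_eq_square)
    have 3: "c \<bullet> ?c' = 0" unfolding 1 using orth by simp
    have 4: "c \<bullet> (second_dd X x (v 1) - second_dd Y y ((1 + s) *\<^sub>R w1)) = S1 - (1 + s)\<^sup>2 * Q1"
      by (simp only: second_dd_scaleR[OF V] inner_diff_right inner_scaleR_right S1_def Q1_def)
    show ?thesis
      using second[of "v 1" "(1 + s) *\<^sub>R w1"] unfolding 2 3 4 by (simp add: add_diff_eq)
  qed
  \<comment> \<open>The tangential part of \<open>e2\<close> is \<open>\<kappa> *\<^sub>R f\<close>,
    again dilated by \<open>1 + s\<close>. The uncompensated part
    \<open>\<sigma> *\<^sub>R n\<close> is parallel to \<open>c\<close> and yields the negative term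
    in \<open>b\<^sup>2\<close>.\<close>
  have g2: "second_dd g x (v 2) \<le> ?u * (2 * b * (\<sigma>\<^sup>2 + s\<^sup>2 * \<kappa>\<^sup>2 + S2 - (1 + s)\<^sup>2 * \<kappa>\<^sup>2 * Q2) - 4 * b\<^sup>2 * (?\<rho> * \<sigma>)\<^sup>2)"
  proof -
    have 1: "?DX (v 2) - ?DY (((1 + s) * \<kappa>) *\<^sub>R w2) = \<sigma> *\<^sub>R n - (s * \<kappa>) *\<^sub>R f" (is "?c' = _")
      unfolding linear_cmul[OF lin(2)] e2_def[symmetric] f_def[symmetric] by (subst e2) (simp add: algebra_simps)
    have 2: "?c' \<bullet> ?c' = \<sigma>\<^sup>2 + s\<^sup>2 * \<kappa>\<^sup>2"
      unfolding 1 using nn orth(4) orthn(2)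
      by (simp add: inner_diff_left inner_diff_right inner_commute power2_eq_square algebra_simps)
    have "c \<bullet> n = ?\<rho>" by (subst c) (simp add: nn)
    then have 3: "c \<bullet> ?c' = ?\<rho> * \<sigma>" unfolding 1 using orth(6) by (simp add: inner_diff_right)
    have 4: "c \<bullet> (second_dd X x (v 2) - second_dd Y y (((1 + s) * \<kappa>) *\<^sub>R w2)) = S2 - (1 + s)\<^sup>2 * \<kappa>\<^sup>2 * Q2"
      by (simp only: second_dd_scaleR[OF V] inner_diff_right inner_scaleR_right S2_def Q2_def power_mult_distrib)
    show ?thesis
      using second[of "v 2" "((1 + s) * \<kappa>) *\<^sub>R w2"] unfolding 2 3 4 by (simp add: add_diff_eq)
  qed
  have alg: "u * (2 * b * (p + S1 - t * Q1)) + u * (2 * b * (q + r + S2 - t * k * Q2) - z) + u * (2 * b * (L - S1 - S2))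
    = u * (2 * b * (p + q + r - t * (Q1 + k * Q2) + L) - z)" for u p q r t k z L :: real
    by (simp add: algebra_simps)
  have "laplacian_coord X g x = second_dd g x (v 1) + second_dd g x (v 2) + (\<Sum>j\<in>UNIV. X.drift j x * pd j g x)"
    using X.laplacian_coord_orthonormal[OF x v(1) x X.open_V g] by (simp add: sum_2)
  \<comment> \<open>By \<open>gradg\<close>, the drift of \<open>g\<close> is that of
    \<open>X\<close> paired with \<open>c\<close>. Rewriting the latter as \<open>lap_imm\<close>
    minus second derivatives cancels \<open>S1\<close> and \<open>S2\<close>.\<close>
  also have "(\<Sum>j\<in>UNIV. X.drift j x * pd j g x) = ?u * (2 * b * (c \<bullet> (\<Sum>j\<in>UNIV. X.drift j x *\<^sub>R pd j X x)))"
    unfolding pd_def[of _ g] gradg by (simp add: pd_def[of _ X] sum_2 inner_add_right algebra_simps)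
  also have "c \<bullet> (\<Sum>j\<in>UNIV. X.drift j x *\<^sub>R pd j X x) = c \<bullet> X.lap_imm x - S1 - S2"
    using X.lap_imm_orthonormal[OF x v(1)] by (simp add: sum_2 inner_add_right S1_def S2_def)
  also have "second_dd g x (v 1) + second_dd g x (v 2) + ?u * (2 * b * (c \<bullet> X.lap_imm x - S1 - S2)) \<le>
    ?u * (2 * b * (s\<^sup>2 + S1 - (1 + s)\<^sup>2 * Q1)) +
    ?u * (2 * b * (\<sigma>\<^sup>2 + s\<^sup>2 * \<kappa>\<^sup>2 + S2 - (1 + s)\<^sup>2 * \<kappa>\<^sup>2 * Q2) - 4 * b\<^sup>2 * (?\<rho> * \<sigma>)\<^sup>2)
    + ?u * (2 * b * (c \<bullet> X.lap_imm x - S1 - S2))"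
    by (intro add_mono g1 g2 order_refl)
  also have "\<dots> = ?u * (2 * b * (s\<^sup>2 + \<sigma>\<^sup>2 + s\<^sup>2 * \<kappa>\<^sup>2 - (1 + s)\<^sup>2 * (Q1 + \<kappa>\<^sup>2 * Q2) + c \<bullet> X.lap_imm x)
    - 4 * b\<^sup>2 * (?\<rho> * \<sigma>)\<^sup>2)"
    by (rule alg)
  also have "\<dots> \<le> ?u * - (2 * b * s * d * H)"
  proof (intro mult_left_mono two_point_arithmetic[OF par])
    have "c \<bullet> X.lap_imm x \<le> ?\<rho> * norm (X.lap_imm x)" by (rule norm_cauchy_schwarz)
    also have "\<dots> \<le> ?\<rho> * H" using HX by (intro mult_left_mono) auto
    finally show "c \<bullet> X.lap_imm x \<le> ?\<rho> * H" .
  qed (simp_all add: Q12 Q2 ks)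
  finally show ?thesis by (simp only: mult.commute)
qed

section \<open>Parametrizations, normals and foot points\<close>

lemma chart_facts:
  assumes "smooth_atlas S" "(V, \<psi>) \<in> params S"
  shows "open V" "openin (topo S) (\<psi> ` V)" "inj_on \<psi> V"
    "continuous_map (top_of_set V) (topo S) \<psi>" "open_map (top_of_set V) (topo S) \<psi>"
proof -
  have *: "open V \<and> openin (topo S) (\<psi> ` V) \<and>
     homeomorphic_map (top_of_set V) (subtopology (topo S) (\<psi> ` V)) \<psi>"
    using assms unfolding smooth_atlas_def by blast
  then show "open V" "openin (topo S) (\<psi> ` V)" by auto
  show "inj_on \<psi> V" using * homeomorphic_imp_injective_map[of "top_of_set V"] by fastforce
  show "continuous_map (top_of_set V) (topo S) \<psi>"
    using * homeomorphic_imp_continuous_map continuous_map_into_fulltopology by blast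
  show "open_map (top_of_set V) (topo S) \<psi>"
    using * homeomorphic_imp_open_map open_map_from_subtopology
    by (metis open_map_def openin_trans_full)
qed

lemma chart_image_open:
  assumes "smooth_atlas S" "(V, \<psi>) \<in> params S" "open U" "U \<subseteq> V"
  shows "openin (topo S) (\<psi> ` U)"
  using chart_facts[OF assms(1,2)] assms(3,4) by (auto simp: open_map_def openin_open_eq)

lemma chart_preimage_open:
  assumes "smooth_atlas S" "(V, \<psi>) \<in> params S" "openin (topo S) O'"
  shows "open {x \<in> V. \<psi> x \<in> O'}"
  using openin_continuous_map_preimage[OF chart_facts(4)[OF assms(1,2)] assms(3)]
    chart_facts(1)[OF assms(1,2)] by (simp add: openin_open_eq)

lemma chart_mem_points:
  assumes "smooth_atlas S" "(V, \<psi>) \<in> params S" "x \<in> V"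
  shows "\<psi> x \<in> points S"
  using chart_facts(2)[OF assms(1,2)] openin_subset assms(3) by fastforce

lemma param_at_chart:
  assumes "smooth_atlas S" "p \<in> points S"
  shows "(fst (param_at S p), coord_map S p) \<in> params S" "coord S p \<in> fst (param_at S p)"
    "coord_map S p (coord S p) = p"
proof -
  have "\<exists>c. c \<in> params S \<and> p \<in> snd c ` fst c"
    using assms unfolding smooth_atlas_def by force
  then have *: "param_at S p \<in> params S \<and> p \<in> snd (param_at S p) ` fst (param_at S p)"
    unfolding param_at_def by (rule someI_ex)
  then show 1: "(fst (param_at S p), coord_map S p) \<in> params S" by (simp add: coord_map_def)
  have inj: "inj_on (coord_map S p) (fst (param_at S p))" using chart_facts(3)[OF assms(1) 1] .
  show "coord S p \<in> fst (param_at S p)" "coord_map S p (coord S p) = p"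
    unfolding coord_def using * inj
    by (auto simp: coord_map_def intro: the_inv_into_into f_the_inv_into_f)
qed

lemma continuous_map_from_charts:
  fixes f :: "'a \<Rightarrow> 'b::topological_space"
  assumes "smooth_atlas S" "\<And>V \<psi>. (V, \<psi>) \<in> params S \<Longrightarrow> continuous_on V (f \<circ> \<psi>)"
  shows "continuous_map (topo S) euclidean f"
  unfolding continuous_map_def
proof safe
  fix U :: "'b set" assume "openin euclidean U"
  then have U: "open U" by simp
  have "{p \<in> points S. f p \<in> U} = (\<Union>(V, \<psi>)\<in>params S. \<psi> ` {x \<in> V. f (\<psi> x) \<in> U})"
  proof -
    have "points S = (\<Union>(V, \<psi>)\<in>params S. \<psi> ` V)" using assms(1) by (simp add: smooth_atlas_def)
    then show ?thesis by auto
  qed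
  moreover have "openin (topo S) (\<psi> ` {x \<in> V. f (\<psi> x) \<in> U})" if c: "(V, \<psi>) \<in> params S" for V \<psi>
  proof (rule chart_image_open[OF assms(1) c])
    have "open (V \<inter> (f \<circ> \<psi>) -` U)"
      using continuous_open_preimage[OF assms(2)[OF c] chart_facts(1)[OF assms(1) c] U] .
    then show "open {x \<in> V. f (\<psi> x) \<in> U}" by (simp add: vimage_def Int_def)
  qed auto
  ultimately show "openin (topo S) {p \<in> points S. f p \<in> U}" by auto
qed auto

lemma immersed_patch:
  assumes "immersed_surface S" "p \<in> points S"
  shows "immersion_patch (fst (param_at S p)) (imm S \<circ> coord_map S p)"
proof
  have atl: "smooth_atlas S" using assms by (simp add: immersed_surface_def smooth_surface_def)
  note c = param_at_chart[OF atl assms(2)]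
  show "open (fst (param_at S p))" using chart_facts(1)[OF atl c(1)] .
  show "Ck_on 2 (imm S \<circ> coord_map S p) (fst (param_at S p))"
    using assms(1) c(1) unfolding immersed_surface_def smooth_map_def smooth_on_def by fastforce
  show "inj (frechet_derivative (imm S \<circ> coord_map S p) (at x))" if "x \<in> fst (param_at S p)" for x
    using assms(1) c(1) that unfolding immersed_surface_def by fastforce
qed

lemma immersion_continuous:
  assumes "immersed_surface S"
  shows "continuous_map (topo S) euclidean (imm S)"
proof (rule continuous_map_from_charts)
  show "smooth_atlas S" using assms by (simp add: immersed_surface_def smooth_surface_def)
  fix V \<psi> assume "(V, \<psi>) \<in> params S"
  then have "Ck_on 0 (imm S \<circ> \<psi>) V"
    using assms unfolding immersed_surface_def smooth_map_def smooth_on_def by fast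
  then show "continuous_on V (imm S \<circ> \<psi>)" by simp
qed

section \<open>Tangent planes, unit normals and the mean curvature vector\<close>

lemma range_derivative_subset_tangent_space:
  assumes "smooth_atlas S" "p \<in> points S"
  shows "range (frechet_derivative (imm S \<circ> coord_map S p) (at (coord S p))) \<subseteq> tangent_space S p"
  using param_at_chart[OF assms] unfolding tangent_space_def by fast

text \<open>\<open>tangent_space\<close> collects vectors from all charts; the chain rule through
  the transition map brings each into the chosen chart.\<close>

lemma tangent_space_subset_range_derivative:
  assumes S: "immersed_surface S" and p: "p \<in> points S"
  shows "tangent_space S p \<subseteq> range (frechet_derivative (imm S \<circ> coord_map S p) (at (coord S p)))"
proof
  have atl: "smooth_atlas S" using S by (simp add: immersed_surface_def smooth_surface_def)
  let ?W = "fst (param_at S p)" and ?\<phi> = "coord_map S p" and ?y = "coord S p"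
  note c = param_at_chart[OF atl p]
  fix w assume "w \<in> tangent_space S p"
  then obtain V \<psi> x v where V: "(V, \<psi>) \<in> params S" "x \<in> V" "\<psi> x = p"
    "w = frechet_derivative (imm S \<circ> \<psi>) (at x) v" unfolding tangent_space_def by blast
  let ?h = "the_inv_into ?W ?\<phi> \<circ> \<psi>" and ?U = "{z \<in> V. \<psi> z \<in> ?\<phi> ` ?W}"
  have "p \<in> ?\<phi> ` ?W" using c(2) c(3)[symmetric] by (rule rev_image_eqI)
  then have U: "open ?U" "x \<in> ?U"
    using chart_preimage_open[OF atl V(1) chart_facts(2)[OF atl c(1)]] V(2,3) by auto
  have "smooth_on (V \<inter> \<psi> -` (?\<phi> ` ?W)) ?h"
    using atl V(1) c(1) unfolding smooth_atlas_def by fastforce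
  then have "Ck_on 1 ?h ?U" unfolding smooth_on_def by (simp add: vimage_def Int_def)
  then have dh: "(?h has_derivative frechet_derivative ?h (at x)) (at x)"
    using U(2) by (simp add: frechet_derivative_works)
  have hx: "?h x = ?y" using V(3) by (simp add: coord_def)
  have "((imm S \<circ> ?\<phi>) has_derivative frechet_derivative (imm S \<circ> ?\<phi>) (at ?y)) (at (?h x))"
    unfolding hx using immersion_patch.diff[OF immersed_patch[OF S p] c(2)] frechet_derivative_works by blast
  from has_derivative_compose[OF dh this]
  have "((imm S \<circ> \<psi>) has_derivative
      (\<lambda>v. frechet_derivative (imm S \<circ> ?\<phi>) (at ?y) (frechet_derivative ?h (at x) v))) (at x)"
  proof (rule has_derivative_transform_within_open[OF _ U])
    fix z assume "z \<in> ?U"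
    then show "(imm S \<circ> ?\<phi>) (?h z) = (imm S \<circ> \<psi>) z"
      using f_the_inv_into_f[OF chart_facts(3)[OF atl c(1)]] by simp
  qed
  from frechet_derivative_at[OF this] V(4)
  show "w \<in> range (frechet_derivative (imm S \<circ> ?\<phi>) (at ?y))" by (metis rangeI)
qed

lemma (in immersion_patch) normal_decomposition:
  assumes x: "x \<in> V" and n: "norm n = 1" "\<And>v. n \<bullet> frechet_derivative X (at x) v = 0"
    and z: "\<And>v. z \<bullet> frechet_derivative X (at x) v = 0"
  shows "z = (z \<bullet> n) *\<^sub>R n"
proof -
  obtain v :: "2 \<Rightarrow> real^2" where v: "\<And>i j. frechet_derivative X (at x) (v i) \<bullet> frechet_derivative X (at x) (v j)
      = (if i = j then 1 else 0)"
    using orthonormal_frame_orthogonal_to[OF linear_frechet_derivative[OF diff[OF x]] inj_D[OF x]] by metis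
  have ne: "(1::2) \<noteq> 2" by simp
  show ?thesis
    using orthonormal_expansion_3[of "frechet_derivative X (at x) (v 1)" "frechet_derivative X (at x) (v 2)" n z]
      v ne n z by (simp add: norm_eq_1 inner_commute)
qed

text \<open>\<open>lap_imm\<close> is normal, so its length is its component along \<open>n\<close>,
  and the drift part of that component vanishes because it is tangential.\<close>

lemma (in immersion_patch) norm_lap_imm:
  assumes x: "x \<in> V" and n: "norm n = 1" "\<And>v. n \<bullet> frechet_derivative X (at x) v = 0"
  shows "norm (lap_imm x) = \<bar>trace (gi x ** second_form X n x)\<bar>"
proof -
  have pdn: "pd j X x \<bullet> n = 0" for j using n(2) by (simp add: pd_def inner_commute)
  obtain v :: "2 \<Rightarrow> real^2" where v: "\<And>i j. frechet_derivative X (at x) (v i) \<bullet> frechet_derivative X (at x) (v j)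
      = (if i = j then 1 else 0)"
    using orthonormal_frame_orthogonal_to[OF linear_frechet_derivative[OF diff[OF x]] inj_D[OF x]] by metis
  have "lap_imm x \<bullet> frechet_derivative X (at x) v = 0" for v
    using lap_imm_orthogonal[OF x] by (simp add: frechet_derivative_pd[OF diff[OF x]] inner_sum_right)
  from normal_decomposition[OF x n this]
  have "norm (lap_imm x) = \<bar>lap_imm x \<bullet> n\<bar>" using n(1) by (metis mult.right_neutral norm_scaleR)
  also have "lap_imm x \<bullet> n = trace (gi x ** second_form X n x)"
    using lap_imm_orthonormal[OF x v] second_form_trace_orthonormal[OF x v]
    by (simp add: inner_add_left inner_sum_left pdn)
  finally show ?thesis .
qed

text \<open>Guarantees that the \<open>SOME\<close> in \<open>mean_curvature_vector\<close> picks a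
  genuine unit normal.\<close>

lemma unit_normals_nonempty:
  assumes S: "immersed_surface S" and p: "p \<in> points S"
  shows "unit_normals S p \<noteq> {}"
proof -
  let ?D = "frechet_derivative (imm S \<circ> coord_map S p) (at (coord S p))"
  have atl: "smooth_atlas S" using S by (simp add: immersed_surface_def smooth_surface_def)
  note c = param_at_chart[OF atl p]
  have lin: "linear ?D"
    using linear_frechet_derivative[OF immersion_patch.diff[OF immersed_patch[OF S p] c(2)]] .
  have "dim (range ?D) \<le> 2" using dim_image_le[OF lin, of UNIV] by simp
  then have "span (range ?D) \<noteq> UNIV" using dim_eq_full[of "range ?D"] by simp
  from span_not_univ_subset_hyperplane[OF this] obtain a
    where a: "a \<noteq> 0" "span (range ?D) \<subseteq> {x. a \<bullet> x = 0}" by blast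
  have "a /\<^sub>R norm a \<in> unit_normals S p"
  proof -
    have "a \<bullet> w = 0" if "w \<in> tangent_space S p" for w
      using that a(2) span_superset[of "range ?D"] tangent_space_subset_range_derivative[OF S p] by blast
    then show ?thesis using a(1) by (simp add: unit_normals_def)
  qed
  then show ?thesis by blast
qed

lemma norm_lap_imm_mean_curvature_vector:
  assumes S: "immersed_surface S" and p: "p \<in> points S"
  shows "norm (immersion_patch.lap_imm (imm S \<circ> coord_map S p) (coord S p)) = norm (mean_curvature_vector S p)"
proof -
  have atl: "smooth_atlas S" using S by (simp add: immersed_surface_def smooth_surface_def)
  define n where "n = (SOME n. n \<in> unit_normals S p)"
  have "n \<in> unit_normals S p" unfolding n_def using unit_normals_nonempty[OF S p] some_in_eq by blast
  then have n: "norm n = 1" "\<And>v. n \<bullet> frechet_derivative (imm S \<circ> coord_map S p) (at (coord S p)) v = 0"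
    using range_derivative_subset_tangent_space[OF atl p] by (auto simp: unit_normals_def)
  show ?thesis
    using immersion_patch.norm_lap_imm[OF immersed_patch[OF S p] param_at_chart(2)[OF atl p] n]
    unfolding mean_curvature_vector_def Let_def n_def[symmetric]
    by (simp add: n(1) mean_curvature_def shape_operator_def Let_def)
qed

text \<open>Short rays along \<open>Z\<close> from points near \<open>a\<close> miss the whole
  opposite ray at \<open>a\<close>. At a crossing the tangential displacement, at least
  \<open>m\<close> times the distance of the parameters, would have to be balanced by errors of at
  most half that size; so \<open>b = a\<close>, and opposite rays from one point are
  disjoint.\<close>

lemma normal_rays_do_not_cross:
  fixes Y :: "real^2 \<Rightarrow> real^3"
  assumes Y: "Y differentiable (at a)" "inj (frechet_derivative Y (at a))" and Z: "Z differentiable (at a)"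
    and n: "norm (Z a) = 1" "\<And>w. Z a \<bullet> frechet_derivative Y (at a) w = 0"
  obtains \<delta> where "\<delta> > 0" "\<And>b t \<tau>. \<lbrakk>dist b a < \<delta>; 0 < t; t < \<delta>; 0 < \<tau>\<rbrakk> \<Longrightarrow> Y b + t *\<^sub>R Z b \<noteq> Y a - \<tau> *\<^sub>R Z a"
proof -
  let ?D = "frechet_derivative Y (at a)" and ?E = "frechet_derivative Z (at a)"
  obtain m where m: "m > 0" "\<And>h. m * norm h \<le> norm (?D h)"
    using linear_inj_bounded_below_pos[OF linear_frechet_derivative[OF Y(1)] Y(2)] by blast
  have m4: "m / 4 > 0" using m by simp
  obtain d1 where d1: "d1 > 0" "\<And>b. norm (b - a) < d1 \<Longrightarrow> norm (Y b - Y a - ?D (b - a)) \<le> m / 4 * norm (b - a)"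
    using Y(1) m4 unfolding frechet_derivative_works has_derivative_at_alt by blast
  obtain d2 where d2: "d2 > 0" "\<And>b. norm (b - a) < d2 \<Longrightarrow> norm (Z b - Z a - ?E (b - a)) \<le> 1 * norm (b - a)"
    using Z zero_less_one unfolding frechet_derivative_works has_derivative_at_alt by blast
  obtain B where B: "B > 0" "\<And>h. norm (?E h) \<le> norm h * B"
    using bounded_linear.pos_bounded[of ?E] Z unfolding frechet_derivative_works
    by (metis has_derivative_bounded_linear)
  \<comment> \<open>\<open>1 + B\<close> is a Lipschitz bound for \<open>Z\<close> at
    \<open>a\<close>, so the last entry keeps the drift of the normal over time \<open>t\<close>
    below \<open>m / 4\<close> times the displacement.\<close>
  define \<delta> where "\<delta> = min (min d1 d2) (m / (4 * (1 + B)))"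
  have "\<delta> > 0" using d1 d2 m B by (simp add: \<delta>_def)
  moreover have False if b: "dist b a < \<delta>" and t: "0 < t" "t < \<delta>" and \<tau>: "0 < \<tau>"
    and eq: "Y b + t *\<^sub>R Z b = Y a - \<tau> *\<^sub>R Z a" for b t \<tau>
  proof -
    define h r q where "h = b - a" and "r = Y b - Y a - ?D h" and "q = Z b - Z a"
    have r: "norm r \<le> m / 4 * norm h" using d1(2)[of b] b by (simp add: r_def h_def \<delta>_def dist_norm)
    have "norm q \<le> norm (q - ?E h) + norm (?E h)" using norm_triangle_ineq[of "q - ?E h" "?E h"] by simp
    also have "\<dots> \<le> (1 + B) * norm h"
      using d2(2)[of b] b B(2)[of h] by (simp add: q_def h_def \<delta>_def dist_norm algebra_simps)
    finally have q: "norm q \<le> (1 + B) * norm h" .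
    have "t * norm q \<le> m / (4 * (1 + B)) * ((1 + B) * norm h)"
      using t q by (intro mult_mono) (auto simp: \<delta>_def intro: order_trans[OF norm_ge_zero])
    also have "\<dots> = m / 4 * norm h" using B by (simp add: field_simps)
    finally have tq: "t * norm q \<le> m / 4 * norm h" .
    have e: "?D h + r + t *\<^sub>R q + (t + \<tau>) *\<^sub>R Z a = 0"
      using eq by (simp add: r_def q_def algebra_simps)
    \<comment> \<open>Pairing with \<open>?D h\<close> eliminates the multiple of the normal
      \<open>Z a\<close>.\<close>
    have "?D h \<bullet> ?D h = - ((r + t *\<^sub>R q) \<bullet> ?D h)"
      using arg_cong[OF e, of "\<lambda>z. z \<bullet> ?D h"] n(2) by (simp add: inner_add_left algebra_simps)
    also have "\<dots> \<le> norm (r + t *\<^sub>R q) * norm (?D h)"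
      using norm_cauchy_schwarz[of "- (r + t *\<^sub>R q)" "?D h"] by (metis inner_minus_left norm_minus_cancel)
    also have "\<dots> \<le> (m / 2 * norm h) * norm (?D h)"
      using norm_triangle_ineq[of r "t *\<^sub>R q"] r tq t by (intro mult_right_mono) auto
    finally have "norm (?D h) * norm (?D h) \<le> (m / 2 * norm h) * norm (?D h)"
      by (simp add: power2_norm_eq_inner flip: power2_eq_square)
    then have "norm (?D h) \<le> m / 2 * norm h \<or> norm (?D h) = 0" by (metis mult_le_cancel_right norm_not_less_zero norm_le_zero_iff norm_eq_zero not_le)
    then have "h = 0"
    proof
      assume "norm (?D h) \<le> m / 2 * norm h"
      then have "m / 2 * norm h \<le> 0" using m(2)[of h] by (simp add: field_simps)
      then show ?thesis using m(1) by (simp add: mult_le_0_iff)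
    next
      assume "norm (?D h) = 0"
      then show ?thesis using m(2)[of h] m(1) by (simp add: mult_le_0_iff)
    qed
    then have "r = 0" "q = 0" "?D h = 0" using r q linear_0[OF linear_frechet_derivative[OF Y(1)]] by auto
    then have "(t + \<tau>) *\<^sub>R Z a = 0" using e by simp
    then show False using t \<tau> n(1) by auto
  qed
  ultimately show thesis using that by blast
qed

text \<open>Several sheets may pass through the foot point, and each has normal \<open>n\<close> or
  \<open>- n\<close> there. Were it \<open>- n\<close> on all of them, the points of the segment
  near \<open>z\<close> would not be reached by short rays along \<xi>, against
  \<open>points_into\<close>. Properness makes the fibre compact, so finitely many local statements
  suffice.\<close>

lemma foot_point_normal:
  fixes N :: "'b surface_in_space"
  assumes N: "properly_immersed_surface N" and \<xi>: "mean_curvature_normal N \<xi>"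
    and W: "W \<in> components (- (imm N ` points N))" and x: "x \<in> W"
    and into: "\<And>z. z \<in> imm N ` points N \<inter> frontier W \<Longrightarrow> points_into N \<xi> W z"
    and z: "z \<in> imm N ` points N" and near: "\<And>z'. z' \<in> imm N ` points N \<Longrightarrow> dist x z \<le> dist x z'"
  obtains q where "q \<in> points N" "imm N q = z" "\<xi> q = (x - z) /\<^sub>R norm (x - z)"
proof -
  note witness = that
  let ?I = "imm N ` points N"
  define \<rho> n where "\<rho> = norm (x - z)" and "n = (x - z) /\<^sub>R \<rho>"
  have imN: "immersed_surface N" and pm: "proper_map (topo N) euclidean (imm N)"
    using N by (auto simp: properly_immersed_surface_def)
  have atl: "smooth_atlas N" using imN by (simp add: immersed_surface_def smooth_surface_def)
  have WI: "W \<subseteq> - ?I" using W by (rule in_components_subset)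
  have "x \<noteq> z" using x z WI by blast
  then have rho: "\<rho> > 0" by (simp add: \<rho>_def)
  have xz: "x = z + \<rho> *\<^sub>R n" and nn: "norm n = 1" using rho by (simp_all add: n_def, simp add: \<rho>_def)
  \<comment> \<open>A point of the image on the half-open segment would be closer to
    \<open>x\<close> than \<open>z\<close>; a connected set avoiding the image and containing
    \<open>x\<close> stays in the component.\<close>
  have ray: "z + \<tau> *\<^sub>R n \<in> W" if "0 < \<tau>" "\<tau> \<le> \<rho>" for \<tau>
  proof -
    let ?T = "(\<lambda>\<tau>. z + \<tau> *\<^sub>R n) ` {0<..\<rho>}"
    have "connected ?T" by (intro connected_continuous_image continuous_intros) auto
    moreover have "?T \<subseteq> - ?I"
    proof clarsimp
      fix \<tau> q assume t: "0 < \<tau>" "\<tau> \<le> \<rho>" and q: "z + \<tau> *\<^sub>R n = imm N q" "q \<in> points N"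
      have "dist x z \<le> dist x (z + \<tau> *\<^sub>R n)" using near q by (metis imageI)
      also have "\<dots> = norm ((\<rho> - \<tau>) *\<^sub>R n)" by (simp add: xz dist_norm algebra_simps)
      also have "\<dots> = \<rho> - \<tau>" using t nn by simp
      finally show False using t by (simp add: \<rho>_def dist_norm)
    qed
    moreover have "x \<in> ?T" using xz rho by auto
    ultimately have "?T \<subseteq> W" using components_maximal[OF W] x by blast
    moreover have "z + \<tau> *\<^sub>R n \<in> ?T" using that by (intro image_eqI[of _ _ \<tau>]) auto
    ultimately show ?thesis by blast
  qed
  define y where "y k = z + (\<rho> / (real k + 1)) *\<^sub>R n" for k
  have "(\<lambda>k. \<rho> / (real k + 1)) \<longlonglongrightarrow> 0"
    using tendsto_mult[OF tendsto_const[of \<rho>] LIMSEQ_inverse_real_of_nat] by (simp add: divide_inverse add.commute)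
  then have "y \<longlonglongrightarrow> z + 0 *\<^sub>R n" unfolding y_def by (intro tendsto_intros)
  then have ylim: "y \<longlonglongrightarrow> z" by simp
  have tk: "0 < \<rho> / (real k + 1)" "\<rho> / (real k + 1) \<le> \<rho>" for k using rho by (auto simp: divide_le_eq)
  have yW: "y k \<in> W" for k unfolding y_def using ray tk by blast
  have "z \<in> closure W" using ylim yW closure_sequential by blast
  moreover have "z \<notin> interior W" using z WI interior_subset by blast
  ultimately have zf: "z \<in> ?I \<inter> frontier W" using z by (simp add: frontier_def)
  \<comment> \<open>At a nearest point the derivative of the squared distance vanishes in a chart
    around each preimage.\<close>
  have normal: "\<xi> q = n \<or> \<xi> q = - n" if q: "q \<in> points N" "imm N q = z" for q
  proof -
    let ?Y = "imm N \<circ> coord_map N q" and ?y = "coord N q" and ?V = "fst (param_at N q)"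
    note c = param_at_chart[OF atl q(1)]
    interpret P: immersion_patch ?V ?Y using immersed_patch[OF imN q(1)] .
    have Yy: "?Y ?y = z" using c(3) q(2) by simp
    let ?D = "frechet_derivative ?Y (at ?y)"
    have "(?Y has_derivative ?D) (at ?y)" using P.diff[OF c(2)] frechet_derivative_works by blast
    from has_derivative_diff[OF has_derivative_const this, of x]
    have dY: "((\<lambda>b. x - ?Y b) has_derivative (\<lambda>v. 0 - ?D v)) (at ?y)" .
    have "(\<lambda>v. (x - z) \<bullet> (0 - ?D v) + (0 - ?D v) \<bullet> (x - z)) = (\<lambda>v. 0)"
      using has_derivative_inner[OF dY dY] unfolding Yy
    proof (rule differential_zero_maxmin[OF c(2) P.open_V])
      have "(x - z) \<bullet> (x - z) \<le> (x - ?Y b) \<bullet> (x - ?Y b)" if "b \<in> ?V" for b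
        using near[of "?Y b"] chart_mem_points[OF atl c(1) that]
        by (simp add: dist_norm norm_le)
      then show "(\<forall>b\<in>?V. (x - ?Y b) \<bullet> (x - ?Y b) \<le> (x - ?Y ?y) \<bullet> (x - ?Y ?y)) \<or>
        (\<forall>b\<in>?V. (x - ?Y ?y) \<bullet> (x - ?Y ?y) \<le> (x - ?Y b) \<bullet> (x - ?Y b))"
        unfolding Yy by blast
    qed
    then have "(x - z) \<bullet> frechet_derivative ?Y (at ?y) v = 0" for v
      by (auto simp: fun_eq_iff inner_commute)
    then have nD: "n \<bullet> frechet_derivative ?Y (at ?y) v = 0" for v by (simp add: n_def)
    have "\<xi> q \<in> unit_normals N q" using \<xi> q by (simp add: mean_curvature_normal_def)
    then have xi: "norm (\<xi> q) = 1" "\<And>v. \<xi> q \<bullet> frechet_derivative ?Y (at ?y) v = 0"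
      using range_derivative_subset_tangent_space[OF atl q(1)] by (auto simp: unit_normals_def)
    have "\<xi> q = (\<xi> q \<bullet> n) *\<^sub>R n" using P.normal_decomposition[OF c(2) nn nD xi(2)] .
    moreover from this have "\<bar>\<xi> q \<bullet> n\<bar> = 1" using xi(1) nn by (metis mult.right_neutral norm_scaleR)
    ultimately show ?thesis
      by (metis abs_eq_iff' abs_one scaleR_minus1_left scaleR_one)
  qed
  show thesis
  proof (rule ccontr)
    assume no: "\<not> thesis"
    have no': "\<xi> q \<noteq> n" if "q \<in> points N" "imm N q = z" for q
      using no witness[OF that] unfolding n_def \<rho>_def by blast
    define K where "K = {q \<in> points N. imm N q = z}"
    have K: "compactin (topo N) K" using pm by (simp add: proper_map_def K_def)
    \<comment> \<open>\<open>\<tau>\<close> is unbounded: only the length of the rays along \<xi>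
      has to be short.\<close>
    define good where "good G \<delta> \<longleftrightarrow> (\<forall>q\<in>G. \<forall>t \<tau>. 0 < t \<and> t < \<delta> \<and> 0 < \<tau> \<longrightarrow> imm N q + t *\<^sub>R \<xi> q \<noteq> z + \<tau> *\<^sub>R n)" for G \<delta>
    have local: "\<exists>G \<delta>. openin (topo N) G \<and> q \<in> G \<and> \<delta> > 0 \<and> good G \<delta>" if "q \<in> K" for q
    proof -
      have q: "q \<in> points N" "imm N q = z" using that by (auto simp: K_def)
      let ?Y = "imm N \<circ> coord_map N q" and ?y = "coord N q" and ?V = "fst (param_at N q)"
      let ?Z = "\<xi> \<circ> coord_map N q"
      note c = param_at_chart[OF atl q(1)]
      interpret P: immersion_patch ?V ?Y using immersed_patch[OF imN q(1)] .
      have xiq: "\<xi> q = - n" using normal[OF q] no'[OF q] by blast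
      have "Ck_on 1 ?Z ?V"
        using \<xi> c(1) unfolding mean_curvature_normal_def smooth_map_def smooth_on_def by fast
      then have dZ: "?Z differentiable (at ?y)" using c(2) by simp
      have "\<xi> q \<in> unit_normals N q" using \<xi> q by (simp add: mean_curvature_normal_def)
      then have xi: "norm (?Z ?y) = 1" "\<And>v. ?Z ?y \<bullet> frechet_derivative ?Y (at ?y) v = 0"
        using range_derivative_subset_tangent_space[OF atl q(1)] c(3) by (auto simp: unit_normals_def)
      obtain \<delta> where \<delta>: "\<delta> > 0" "\<And>b t \<tau>. \<lbrakk>dist b ?y < \<delta>; 0 < t; t < \<delta>; 0 < \<tau>\<rbrakk> \<Longrightarrow> ?Y b + t *\<^sub>R ?Z b \<noteq> ?Y ?y - \<tau> *\<^sub>R ?Z ?y"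
        using normal_rays_do_not_cross[OF P.diff[OF c(2)] P.inj_D[OF c(2)] dZ xi] by metis
      let ?G = "coord_map N q ` (?V \<inter> ball ?y \<delta>)"
      have "openin (topo N) ?G"
        using P.open_V by (intro chart_image_open[OF atl c(1)]) auto
      moreover have "q \<in> ?G" using c \<delta>(1) by (intro image_eqI[of _ _ ?y]) auto
      moreover have "good ?G \<delta>"
        using \<delta>(2) c(3) q(2) xiq by (auto simp: good_def dist_commute)
      ultimately show ?thesis using \<delta>(1) by blast
    qed
    let ?\<U> = "{G. openin (topo N) G \<and> (\<exists>\<delta>>0. good G \<delta>)}"
    have "K \<subseteq> \<Union>?\<U>" using local by blast
    then obtain F where F: "finite F" "F \<subseteq> ?\<U>" "K \<subseteq> \<Union>F"
      using K unfolding compactin_def by (metis (no_types, lifting) mem_Collect_eq)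
    have "\<exists>\<delta>>0. good (\<Union>F) \<delta>" using F(1,2)
    proof (induction F rule: finite_induct)
      case empty
      then show ?case by (intro exI[of _ 1]) (simp add: good_def)
    next
      case (insert G F)
      then obtain a b where "a > 0" "good G a" "b > 0" "good (\<Union>F) b" by blast
      then show ?case by (intro exI[of _ "min a b"]) (auto simp: good_def)
    qed
    then obtain \<delta> where \<delta>: "\<delta> > 0" "good (\<Union>F) \<delta>" by blast
    have "openin (topo N) (\<Union>F)" using F(2) by blast
    then have "closedin (topo N) (points N - \<Union>F)" by blast
    then have "closed (imm N ` (points N - \<Union>F))"
      using pm unfolding proper_map_def closed_map_def by (metis closed_closedin)
    moreover have "z \<notin> imm N ` (points N - \<Union>F)" using F(3) by (auto simp: K_def)
    ultimately have op: "open (- imm N ` (points N - \<Union>F))" "z \<in> - imm N ` (points N - \<Union>F)" by auto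
    \<comment> \<open>A neighbourhood of \<open>z\<close> in the image all of whose preimages lie in
      the finite union; the removed set is closed because a proper map is closed.\<close>
    let ?V = "?I \<inter> - imm N ` (points N - \<Union>F)"
    have "openin (top_of_set ?I) ?V" using op(1) by (simp add: openin_open_Int)
    moreover have "z \<in> ?V" using op(2) z by blast
    ultimately have "\<forall>\<^sub>F k in sequentially. \<exists>q\<in>points N. \<exists>t. imm N q \<in> ?V \<and> 0 < t \<and> t < \<delta> \<and>
              y k = imm N q + t *\<^sub>R \<xi> q"
      using into[OF zf] yW ylim \<delta>(1) unfolding points_into_def by blast
    then obtain k q t where q: "q \<in> points N" "imm N q \<in> ?V" "0 < t" "t < \<delta>" "y k = imm N q + t *\<^sub>R \<xi> q"
      by (auto simp: eventually_sequentially)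
    then have "q \<in> \<Union>F" by blast
    then show False using \<delta>(2) q(3,4,5) tk[of k] unfolding good_def y_def by metis
  qed
qed

section \<open>Measure, cutoff functions and the heat kernel\<close>

lemma openin_sets:
  assumes "riemannian_measure S \<mu>" "openin (topo S) U"
  shows "U \<in> sets \<mu>"
  using assms by (auto simp: riemannian_measure_def)

lemma closedin_sets:
  assumes "riemannian_measure S \<mu>" "closedin (topo S) U"
  shows "U \<in> sets \<mu>"
proof -
  have "space \<mu> - (points S - U) \<in> sets \<mu>"
    using assms by (intro sets.Diff sets.top openin_sets[OF assms(1)]) (auto simp: closedin_def)
  moreover have "space \<mu> - (points S - U) = U"
    using assms by (auto simp: riemannian_measure_def dest: closedin_subset)
  ultimately show ?thesis by simp
qed

lemma continuous_map_borel_measurable: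
  fixes f :: "'a \<Rightarrow> real"
  assumes "riemannian_measure S \<mu>" "continuous_map (topo S) euclideanreal f"
  shows "f \<in> borel_measurable \<mu>"
proof (rule borel_measurableI)
  fix U :: "real set" assume "open U"
  then have "openin (topo S) {x \<in> points S. f x \<in> U}"
    using openin_continuous_map_preimage[OF assms(2)] by simp
  moreover have "f -` U \<inter> space \<mu> = {x \<in> points S. f x \<in> U}"
    using assms(1) by (auto simp: riemannian_measure_def)
  ultimately show "f -` U \<inter> space \<mu> \<in> sets \<mu>" using openin_sets[OF assms(1)] by simp
qed

text \<open>The area density is continuous, hence bounded on a closed coordinate ball.\<close>

lemma locally_finite_riemannian_measure:
  assumes S: "immersed_surface S" and \<mu>: "riemannian_measure S \<mu>" and p: "p \<in> points S"
  obtains G where "openin (topo S) G" "p \<in> G" "emeasure \<mu> G < \<infinity>"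
proof -
  have atl: "smooth_atlas S" using S by (simp add: immersed_surface_def smooth_surface_def)
  let ?V = "fst (param_at S p)" and ?\<psi> = "coord_map S p" and ?y = "coord S p"
  let ?X = "imm S \<circ> ?\<psi>"
  note c = param_at_chart[OF atl p]
  interpret P: immersion_patch ?V ?X using immersed_patch[OF S p] .
  obtain r where r: "r > 0" "cball ?y r \<subseteq> ?V" using P.open_V c(2) open_contains_cball by blast
  let ?G = "?\<psi> ` ball ?y r"
  have bV: "ball ?y r \<subseteq> ?V" using r(2) by auto
  have G: "openin (topo S) ?G" using chart_image_open[OF atl c(1) open_ball bV] .
  have pG: "p \<in> ?G" using c(3) r(1) by (intro image_eqI[of _ _ ?y]) auto
  have eq: "{x \<in> ?V. ?\<psi> x \<in> ?G} = ball ?y r"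
    using chart_facts(3)[OF atl c(1)] bV by (auto simp: inj_on_def)
  have "continuous_on (cball ?y r) (area_density ?X)"
    using r(2) by (intro continuous_at_imp_continuous_on ballI differentiable_imp_continuous_within P.density_diff) auto
  then have "compact (area_density ?X ` cball ?y r)" by (intro compact_continuous_image) auto
  then obtain C where C: "\<And>x. x \<in> cball ?y r \<Longrightarrow> area_density ?X x \<le> C"
    by (meson bounded_imp_bdd_above compact_imp_bounded bdd_above.E imageI)
  have "emeasure \<mu> ?G = (\<integral>\<^sup>+ x\<in>{x\<in>?V. ?\<psi> x \<in> ?G}. ennreal (area_density ?X x) \<partial>lborel)"
    using \<mu> c(1) openin_sets[OF \<mu> G] bV unfolding riemannian_measure_def by fast
  also have "\<dots> \<le> (\<integral>\<^sup>+ x. ennreal C * indicator (ball ?y r) x \<partial>lborel)"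
    unfolding eq using C by (intro nn_integral_mono) (auto simp: indicator_def intro!: ennreal_leI)
  also have "\<dots> = ennreal C * emeasure lborel (ball ?y r)"
    by (simp add: nn_integral_cmult_indicator)
  also have "\<dots> < \<infinity>" using emeasure_lborel_ball_finite[of ?y r] by (simp add: ennreal_mult_less_top)
  finally show thesis using that[OF G pG] by blast
qed

lemma compact_finite_measure:
  assumes S: "immersed_surface S" and \<mu>: "riemannian_measure S \<mu>" and K: "compactin (topo S) K"
  shows "emeasure \<mu> K < \<infinity>"
proof -
  let ?\<U> = "{G. openin (topo S) G \<and> emeasure \<mu> G < \<infinity>}"
  have "K \<subseteq> \<Union>?\<U>"
    using locally_finite_riemannian_measure[OF S \<mu>] compactin_subset_topspace[OF K] by blast
  then obtain F where F: "finite F" "F \<subseteq> ?\<U>" "K \<subseteq> \<Union>F"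
    using K unfolding compactin_def by (metis (no_types, lifting) mem_Collect_eq)
  have "emeasure \<mu> K \<le> emeasure \<mu> (\<Union>F)"
    using F openin_sets[OF \<mu>] by (intro emeasure_mono) auto
  also have "\<dots> \<le> (\<Sum>G\<in>F. emeasure \<mu> G)"
    using emeasure_subadditive_finite[OF F(1), of "\<lambda>G. G" \<mu>] F(2) openin_sets[OF \<mu>] by auto
  also have "\<dots> < \<infinity>" using F(1,2) by (auto simp: less_top)
  finally show ?thesis .
qed

text \<open>Finite sums approximate the integral uniformly in the parameter, so that properties stable
  under finite linear combinations need no differentiation under the integral sign.\<close>

lemma uniform_riemann_sum:
  fixes F :: "'x \<Rightarrow> 'a \<Rightarrow> real"
  assumes \<mu>: "riemannian_measure S \<mu>" and haus: "Hausdorff_space (topo S)"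
    and F: "continuous_map (prod_topology X (topo S)) euclideanreal (\<lambda>(x, y). F x y)"
    and C: "compactin X C"
    and K: "compactin (topo S) K" "emeasure \<mu> K < \<infinity>"
    and f: "continuous_map (topo S) euclideanreal f" "\<And>y. y \<in> points S \<Longrightarrow> 0 \<le> f y \<and> f y \<le> 1"
      "\<And>y. y \<in> points S - K \<Longrightarrow> f y = 0"
    and \<epsilon>: "0 < \<epsilon>"
  obtains n :: nat and c y where "\<And>k. k < n \<Longrightarrow> y k \<in> K"
    "\<And>x. x \<in> C \<Longrightarrow> \<bar>(LINT z|\<mu>. F x z * f z) - (\<Sum>k<n. c k * F x (y k))\<bar> \<le> \<epsilon>"
proof -
  have CX: "C \<subseteq> topspace X" and KS: "K \<subseteq> points S"
    using C K compactin_subset_topspace by auto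
  have Kset: "K \<in> sets \<mu>" using closedin_sets[OF \<mu> compactin_imp_closedin[OF haus K(1)]] .
  have sp: "space \<mu> = points S" using \<mu> by (simp add: riemannian_measure_def)
  \<comment> \<open>The summand 1 covers the case that \<open>K\<close> has measure zero.\<close>
  define e where "e = \<epsilon> / (measure \<mu> K + 1)"
  have mK: "measure \<mu> K + 1 > 0" using measure_nonneg[of \<mu> K] by linarith
  have e: "e > 0" using \<epsilon> mK by (simp add: e_def)
  have Fslice: "continuous_map (topo S) euclideanreal (F x)" if "x \<in> topspace X" for x
    using continuous_map_compose[OF _ F, of "topo S" "\<lambda>y. (x, y)"] that
    by (simp add: o_def continuous_map_paired)
  \<comment> \<open>Compactness of \<open>C\<close> and the tube lemma give a neighbourhood of
    \<open>z\<close> that works for all parameters at once.\<close>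
  have "\<exists>U. openin (topo S) U \<and> z \<in> U \<and> (\<forall>x\<in>C. \<forall>y\<in>U. \<bar>F x y - F x z\<bar> < e)" if z: "z \<in> K" for z
  proof -
    have "continuous_map (prod_topology X (topo S)) (prod_topology X (topo S)) (\<lambda>w. (fst w, z))"
      using z KS by (intro continuous_map_pairedI continuous_map_fst) auto
    from continuous_map_compose[OF this F]
    have "continuous_map (prod_topology X (topo S)) euclideanreal (\<lambda>w. F (fst w) z)" by (simp add: o_def)
    from continuous_map_diff[OF F this]
    have W1: "openin (prod_topology X (topo S))
        {w \<in> topspace (prod_topology X (topo S)). (case w of (x, y) \<Rightarrow> F x y) - F (fst w) z \<in> {-e<..<e}}" (is "openin _ ?W")
      by (rule openin_continuous_map_preimage) auto
    have W2: "C \<times> {z} \<subseteq> ?W" using CX z KS e by auto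
    have "z \<in> topspace (topo S)" using z KS by blast
    from tube_lemma_left[OF W1 C this W2]
    obtain U U' where U: "openin X U" "openin (topo S) U'" "C \<subseteq> U" "z \<in> U'" "U \<times> U' \<subseteq> ?W"
      by (elim exE conjE)
    have "\<bar>F x y - F x z\<bar> < e" if "x \<in> C" "y \<in> U'" for x y
    proof -
      have "(x, y) \<in> ?W" using U that by blast
      then show ?thesis by auto
    qed
    then show ?thesis using U by blast
  qed
  then obtain U where U: "\<And>z. z \<in> K \<Longrightarrow> openin (topo S) (U z)" "\<And>z. z \<in> K \<Longrightarrow> z \<in> U z"
    "\<And>z x y. \<lbrakk>z \<in> K; x \<in> C; y \<in> U z\<rbrakk> \<Longrightarrow> \<bar>F x y - F x z\<bar> < e" by metis
  have "K \<subseteq> \<Union>(U ` K)" using U(2) by blast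
  then obtain \<F> where "finite \<F>" "\<F> \<subseteq> U ` K" "K \<subseteq> \<Union>\<F>"
    using K(1) U(1) unfolding compactin_def by (metis (no_types, lifting) imageE)
  then obtain I where I: "finite I" "I \<subseteq> K" "K \<subseteq> \<Union>(U ` I)"
    by (metis finite_subset_image)
  obtain y where y: "bij_betw y {..<card I} I"
    using ex_bij_betw_nat_finite[OF I(1)] by (auto simp: atLeast0LessThan)
  let ?n = "card I"
  have yK: "y k \<in> K" if "k < ?n" for k using y I(2) that by (auto simp: bij_betw_def)
  \<comment> \<open>The cover made disjoint; the coefficient of each sample point will be the
    integral of \<open>f\<close> over its piece.\<close>
  define A where "A k = K \<inter> (U (y k) - (\<Union>j<k. U (y j)))" for k
  have Aset: "A k \<in> sets \<mu>" if "k < ?n" for k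
    unfolding A_def using Kset openin_sets[OF \<mu> U(1)] yK that
    by (intro sets.Int sets.Diff sets.finite_UN) auto
  have AK: "A k \<subseteq> K" for k by (auto simp: A_def)
  have Afin: "emeasure \<mu> (A k) < \<infinity>" if "k < ?n" for k
    using emeasure_mono[OF AK Kset, of k] K(2) by (metis order_le_less_trans)
  have disj: "A i \<inter> A j = {}" if "i < j" for i j
    using that by (auto simp: A_def)
  have dj: "disjoint_family_on A {..<?n}"
    unfolding disjoint_family_on_def using disj by (metis Int_commute linorder_neqE_nat)
  have cover: "\<exists>k<?n. z \<in> A k" if z: "z \<in> K" for z
  proof -
    have "y ` {..<?n} = I" using y by (simp add: bij_betw_def)
    then have "K \<subseteq> (\<Union>k<?n. U (y k))" using I(3) by (metis image_image)
    then have "\<exists>k. k < ?n \<and> z \<in> U (y k)" using z by blast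
    then obtain k where "k < ?n" "z \<in> U (y k)" "\<And>j. j < k \<Longrightarrow> \<not> (j < ?n \<and> z \<in> U (y j))"
      using exists_least_iff[of "\<lambda>k. k < ?n \<and> z \<in> U (y k)"] by blast
    then have "z \<in> A k" using z by (auto simp: A_def)
    then show ?thesis using \<open>k < ?n\<close> by blast
  qed
  have fm: "f \<in> borel_measurable \<mu>" using continuous_map_borel_measurable[OF \<mu> f(1)] .
  define c where "c k = (LINT z|\<mu>. indicator (A k) z * f z)" for k
  have int1: "integrable \<mu> (\<lambda>z. indicator (A k) z * f z)" if k: "k < ?n" for k
    using f(2) sp Aset[OF k] fm
    by (intro Bochner_Integration.integrable_bound[OF integrable_real_indicator[OF Aset[OF k] Afin[OF k]]])
      (auto simp: indicator_def)
  have "\<bar>(LINT z|\<mu>. F x z * f z) - (\<Sum>k<?n. c k * F x (y k))\<bar> \<le> \<epsilon>" if x: "x \<in> C" for x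
  proof -
    let ?d = "\<lambda>k z. (F x z - F x (y k)) * (indicator (A k) z * f z)"
    have Fm: "F x \<in> borel_measurable \<mu>"
      using continuous_map_borel_measurable[OF \<mu> Fslice] x CX by blast
    have bd: "norm (?d k z) \<le> e * indicator (A k) z" if k: "k < ?n" and z: "z \<in> space \<mu>" for k z
    proof (cases "z \<in> A k")
      case True
      then have "\<bar>F x z - F x (y k)\<bar> \<le> e" using U(3)[OF yK[OF k] x, of z] by (auto simp: A_def)
      then have "\<bar>F x z - F x (y k)\<bar> * \<bar>f z\<bar> \<le> e * 1" using f(2)[of z] z sp e by (intro mult_mono) auto
      then show ?thesis using True by (simp add: abs_mult)
    qed simp
    have inte: "integrable \<mu> (\<lambda>z. e * indicator (A k) z)" if k: "k < ?n" for k
      using integrable_real_indicator[OF Aset[OF k] Afin[OF k]] by simp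
    have int2: "integrable \<mu> (?d k)" if k: "k < ?n" for k
    proof (rule Bochner_Integration.integrable_bound[OF inte[OF k]])
      show "?d k \<in> borel_measurable \<mu>"
        using Aset[OF k] fm Fm by measurable
      show "AE z in \<mu>. norm (?d k z) \<le> norm (e * indicator (A k) z)"
        by (intro AE_I2 order_trans[OF bd[OF k]]) (auto simp: abs_ge_self)
    qed
    have decomp: "F x z * f z = (\<Sum>k<?n. F x (y k) * (indicator (A k) z * f z) + ?d k z)"
      if z: "z \<in> space \<mu>" for z
    proof (cases "z \<in> K")
      case True
      then obtain k where k: "k < ?n" "z \<in> A k" using cover by blast
      have "indicator (A j) z = (if j = k then 1 else 0 :: real)" for j
        using disj[of j k] disj[of k j] k(2) by (cases j k rule: linorder_cases) (auto simp: indicator_def)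
      then have "(\<Sum>k<?n. F x (y k) * (indicator (A k) z * f z) + ?d k z) =
          (\<Sum>j<?n. if j = k then F x z * f z else 0)"
        by (intro sum.cong) (auto simp: algebra_simps)
      then show ?thesis using k(1) by simp
    next
      case False
      then show ?thesis using f(3) z sp by simp
    qed
    have "(LINT z|\<mu>. F x z * f z) = (LINT z|\<mu>. (\<Sum>k<?n. F x (y k) * (indicator (A k) z * f z) + ?d k z))"
      by (rule Bochner_Integration.integral_cong[OF refl decomp])
    also have "\<dots> = (\<Sum>k<?n. F x (y k) * c k + integral\<^sup>L \<mu> (?d k))"
      using int1 int2 by (subst Bochner_Integration.integral_sum) (auto simp: c_def)
    finally have "(LINT z|\<mu>. F x z * f z) - (\<Sum>k<?n. c k * F x (y k)) = (\<Sum>k<?n. integral\<^sup>L \<mu> (?d k))"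
      by (simp add: sum.distrib mult.commute)
    also have "\<bar>\<dots>\<bar> \<le> (\<Sum>k<?n. e * measure \<mu> (A k))"
    proof (rule order_trans[OF sum_abs sum_mono])
      fix k assume "k \<in> {..<?n}"
      then have k: "k < ?n" by simp
      have "norm (integral\<^sup>L \<mu> (?d k)) \<le> (LINT z|\<mu>. e * indicator (A k) z)"
        by (rule order_trans[OF integral_norm_bound Bochner_Integration.integral_mono[OF integrable_norm[OF int2[OF k]] inte[OF k]]]) (rule bd[OF k])
      also have "\<dots> = e * measure \<mu> (A k)" using Aset[OF k] Afin[OF k] by simp
      finally show "\<bar>integral\<^sup>L \<mu> (?d k)\<bar> \<le> e * measure \<mu> (A k)" by simp
    qed
    also have "\<dots> = e * (\<Sum>k<?n. measure \<mu> (A k))" by (simp add: sum_distrib_left)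
    also have "(\<Sum>k<?n. measure \<mu> (A k)) = measure \<mu> (\<Union>k<?n. A k)"
      using Aset Afin dj by (intro measure_finite_Union[symmetric]) (auto simp: less_top)
    also have "\<dots> \<le> measure \<mu> K"
      using AK Aset Kset K(2) by (intro measure_mono_fmeasurable) (auto simp: fmeasurable_def)
    finally have "\<bar>(LINT z|\<mu>. F x z * f z) - (\<Sum>k<?n. c k * F x (y k))\<bar> \<le> e * measure \<mu> K" using e by simp
    also have "\<dots> \<le> e * (measure \<mu> K + 1)" using e by simp
    also have "\<dots> = \<epsilon>" using mK by (simp add: e_def)
    finally show ?thesis .
  qed
  then show thesis using that[of ?n y c] yK by blast
qed

text \<open>An exhausted Hausdorff space is locally compact, hence completely regular, which
  suffices to separate a compact closure from the closed complement of the next set.\<close>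

lemma exhaustion_cutoff:
  assumes "Hausdorff_space X" "compact_exhaustion X \<Omega>"
  obtains f :: "nat \<Rightarrow> 'a \<Rightarrow> real" where "\<And>k. continuous_map X euclideanreal (f k)"
    "\<And>k x. x \<in> topspace X \<Longrightarrow> 0 \<le> f k x \<and> f k x \<le> 1" "\<And>k x. x \<in> \<Omega> k \<Longrightarrow> f k x = 1"
    "\<And>k x. x \<in> topspace X - \<Omega> (Suc k) \<Longrightarrow> f k x = 0"
proof -
  have \<Omega>: "openin X (\<Omega> k)" "compactin X (X closure_of \<Omega> k)" "X closure_of \<Omega> k \<subseteq> \<Omega> (Suc k)" for k
    using assms(2) by (auto simp: compact_exhaustion_def)
  have un: "(\<Union>k. \<Omega> k) = topspace X"
    using assms(2) by (simp add: compact_exhaustion_def)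
  have sub: "\<Omega> k \<subseteq> X closure_of \<Omega> k" for k
    using closure_of_subset[of "\<Omega> k" X] openin_subset[OF \<Omega>(1)] by blast
  have "locally_compact_space X"
    unfolding locally_compact_space_def using \<Omega> un sub by (metis UN_E)
  then have "completely_regular_space X"
    using locally_compact_regular_imp_completely_regular_space assms(1) by blast
  have "\<exists>f. continuous_map X euclideanreal f \<and> (\<forall>x\<in>topspace X. 0 \<le> f x \<and> f x \<le> 1) \<and>
     (\<forall>x\<in>\<Omega> k. f x = 1) \<and> (\<forall>x\<in>topspace X - \<Omega> (Suc k). f x = (0::real))" for k
  proof -
    have "closedin X (topspace X - \<Omega> (Suc k))" "disjnt (topspace X - \<Omega> (Suc k)) (X closure_of \<Omega> k)"
      using \<Omega>(1,3) by (auto simp: disjnt_iff)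
    then obtain g where g: "continuous_map X (top_of_set {0..1::real}) g"
      "g ` (X closure_of \<Omega> k) \<subseteq> {0}" "g ` (topspace X - \<Omega> (Suc k)) \<subseteq> {1}"
      using Urysohn_completely_regular_closed_compact[OF zero_le_one \<open>completely_regular_space X\<close>
          _ \<Omega>(2), of "topspace X - \<Omega> (Suc k)" k] by metis
    then have "continuous_map X euclideanreal g" "g ` topspace X \<subseteq> {0..1}"
      by (auto simp: continuous_map_in_subtopology)
    then show ?thesis using g(2,3) sub[of k]
      by (intro exI[of _ "\<lambda>x. 1 - g x"]) (auto intro!: continuous_map_diff simp: image_subset_iff)
  qed
  then show thesis using that by metis
qed

section \<open>Linearity of the Laplacian, time slices and cutoff integrals of the kernel\<close>

lemma pd_cmult:
  fixes h :: "real^2 \<Rightarrow> real"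
  assumes "h differentiable (at x)"
  shows "pd i (\<lambda>z. a * h z) x = a * pd i h x"
  using pd_mult[of "\<lambda>_. a" x h i] assms by (simp add: pd_def[of i "\<lambda>_. a"])

lemma (in immersion_patch) laplacian_coord_sum:
  fixes h :: "'k \<Rightarrow> real^2 \<Rightarrow> real"
  assumes x: "x \<in> U" "x \<in> V" and U: "open U" and h: "\<And>k. k \<in> I \<Longrightarrow> Ck_on 2 (h k) U"
  shows "Ck_on 2 (\<lambda>z. \<Sum>k\<in>I. a k * h k z) U"
    "laplacian_coord X (\<lambda>z. \<Sum>k\<in>I. a k * h k z) x = (\<Sum>k\<in>I. a k * laplacian_coord X (h k) x)"
proof -
  let ?s = "\<lambda>z. \<Sum>k\<in>I. a k * h k z"
  show C: "Ck_on 2 ?s U"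
    using Ck_on_sum[OF U, of I 2 "\<lambda>k z. a k *\<^sub>R h k z"] Ck_on_scaleR[OF U h] by simp
  have 1: "pd j ?s y = (\<Sum>k\<in>I. a k * pd j (h k) y)" if "y \<in> U" for j y
  proof -
    have "h k differentiable (at y)" if "k \<in> I" for k using Ck_on_2D(1)[OF h] that \<open>y \<in> U\<close> by blast
    then show ?thesis by (simp add: pd_sum pd_cmult differentiable_mult)
  qed
  have 2: "pd i (pd j ?s) x = (\<Sum>k\<in>I. a k * pd i (pd j (h k)) x)" for i j
  proof -
    have "pd j ?s differentiable (at x)" unfolding pd_def using Ck_on_2D(2)[OF C x(1)] .
    from pd_cong[OF U x(1) this 1]
    have "pd i (pd j ?s) x = pd i (\<lambda>y. \<Sum>k\<in>I. a k * pd j (h k) y) x" .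
    moreover have "pd j (h k) differentiable (at x)" if "k \<in> I" for k
      unfolding pd_def using Ck_on_2D(2)[OF h[OF that] x(1)] .
    ultimately show ?thesis by (simp add: pd_sum pd_cmult differentiable_mult)
  qed
  show "laplacian_coord X ?s x = (\<Sum>k\<in>I. a k * laplacian_coord X (h k) x)"
    by (simp add: laplacian_coord_expand[OF x U C] laplacian_coord_expand[OF x U h] 1[OF x(1)] 2
        sum_2 sum.distrib sum_distrib_left algebra_simps)
qed

lemma dirichlet_heat_kernel_slice:
  assumes S: "immersed_surface S" and q: "dirichlet_heat_kernel S \<mu> \<Omega> q" and \<Omega>: "openin (topo S) \<Omega>"
    and c: "(V, \<psi>) \<in> params S" and t: "0 < t" and y: "y \<in> \<Omega>"
  shows "Ck_on k (\<lambda>a. q t (\<psi> a) y) {a \<in> V. \<psi> a \<in> \<Omega>}"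
proof -
  have atl: "smooth_atlas S" using S by (simp add: immersed_surface_def smooth_surface_def)
  have yS: "y \<in> points S" using y openin_subset[OF \<Omega>] by blast
  let ?W = "fst (param_at S y)" and ?\<phi> = "coord_map S y" and ?b = "coord S y"
  note d = param_at_chart[OF atl yS]
  let ?f = "\<lambda>(t::real, a, b). q t (\<psi> a) (?\<phi> b)"
  let ?T = "{(t::real, a, b). 0 < t \<and> a \<in> V \<and> \<psi> a \<in> \<Omega> \<and> b \<in> ?W \<and> ?\<phi> b \<in> \<Omega>}"
  have "\<forall>(V, \<psi>)\<in>params S. \<forall>(W, \<phi>)\<in>params S.
      smooth_on {(t, a, b). 0 < t \<and> a \<in> V \<and> \<psi> a \<in> \<Omega> \<and> b \<in> W \<and> \<phi> b \<in> \<Omega>}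
        (\<lambda>(t, a, b). q t (\<psi> a) (\<phi> b))"
    using q unfolding dirichlet_heat_kernel_def by (elim conjE)
  from bspec[OF this c] have "\<forall>(W, \<phi>)\<in>params S.
      smooth_on {(t, a, b). 0 < t \<and> a \<in> V \<and> \<psi> a \<in> \<Omega> \<and> b \<in> W \<and> \<phi> b \<in> \<Omega>}
        (\<lambda>(t, a, b). q t (\<psi> a) (\<phi> b))" by (simp only: prod.case)
  from bspec[OF this d(1)] have "smooth_on ?T ?f" by (simp only: prod.case)
  then have f: "Ck_on k ?f ?T" by (simp add: smooth_on_def)
  have Teq: "?T = {0<..} \<times> {a \<in> V. \<psi> a \<in> \<Omega>} \<times> {b \<in> ?W. ?\<phi> b \<in> \<Omega>}" by auto
  have oT: "open ?T"
    unfolding Teq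
    by (intro open_Times open_greaterThan chart_preimage_open[OF atl c \<Omega>] chart_preimage_open[OF atl d(1) \<Omega>])
  have L: "bounded_linear (\<lambda>a::real^2. (0::real, a, 0::real^2))"
    by (intro bounded_linear_Pair bounded_linear_zero bounded_linear_ident)
  from Ck_on_compose_affine[OF oT L f, of "(t, 0, ?b)"]
  show ?thesis using t y d(2,3) by (simp add: vimage_def)
qed

lemma heat_kernel_cutoff:
  assumes "immersed_surface S" and \<mu>: "riemannian_measure S \<mu>" and p: "heat_kernel S \<mu> p"
    and x: "x \<in> points S" and one: "(LINT y|\<mu>. p 1 x y) = 1" and \<epsilon>: "0 < \<epsilon>"
  obtains \<Omega> q f K where "openin (topo S) \<Omega>" "compactin (topo S) (topo S closure_of \<Omega>)" "x \<in> \<Omega>"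
    "dirichlet_heat_kernel S \<mu> \<Omega> q" "continuous_map (topo S) euclideanreal f"
    "\<And>y. y \<in> points S \<Longrightarrow> 0 \<le> f y \<and> f y \<le> 1" "compactin (topo S) K" "K \<subseteq> \<Omega>"
    "\<And>y. y \<in> points S - K \<Longrightarrow> f y = 0" "(LINT y|\<mu>. q 1 x y * f y) > 1 - \<epsilon>"
proof -
  have haus: "Hausdorff_space (topo S)"
    using assms(1) by (simp add: immersed_surface_def smooth_surface_def)
  have sp: "space \<mu> = points S" using \<mu> by (simp add: riemannian_measure_def)
  obtain \<Omega> q where ex: "compact_exhaustion (topo S) \<Omega>" and dk: "\<And>k. dirichlet_heat_kernel S \<mu> (\<Omega> k) (q k)"
    and lim: "\<And>t x y. \<lbrakk>t > 0; x \<in> points S; y \<in> points S\<rbrakk> \<Longrightarrow> incseq (\<lambda>k. q k t x y) \<and> (\<lambda>k. q k t x y) \<longlonglongrightarrow> p t x y"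
    using p unfolding heat_kernel_def by blast
  have \<Omega>: "openin (topo S) (\<Omega> k)" "compactin (topo S) (topo S closure_of \<Omega> k)"
    "topo S closure_of \<Omega> k \<subseteq> \<Omega> (Suc k)" for k
    using ex by (auto simp: compact_exhaustion_def)
  have un: "(\<Union>k. \<Omega> k) = points S" using ex by (simp add: compact_exhaustion_def)
  have sub: "\<Omega> k \<subseteq> topo S closure_of \<Omega> k" for k
    using closure_of_subset[of "\<Omega> k" "topo S"] openin_subset[OF \<Omega>(1)] by blast
  have mono: "\<Omega> i \<subseteq> \<Omega> j" if "i \<le> j" for i j
    using that by (rule lift_Suc_mono_le[rotated]) (use sub \<Omega>(3) in blast)
  obtain f where f: "\<And>k. continuous_map (topo S) euclideanreal (f k)"
    "\<And>k x. x \<in> points S \<Longrightarrow> 0 \<le> f k x \<and> f k x \<le> 1" "\<And>k x. x \<in> \<Omega> k \<Longrightarrow> f k x = 1"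
    "\<And>k x. x \<in> points S - \<Omega> (Suc k) \<Longrightarrow> f k x = (0::real)"
    using exhaustion_cutoff[OF haus ex] by metis
  \<comment> \<open>The shift by two puts the support of \<open>f k\<close>, contained in the
    compact closure of \<open>\<Omega> (Suc k)\<close>, inside the domain of the kernel.\<close>
  let ?q = "\<lambda>k. q (Suc (Suc k))"
  have pos: "0 \<le> q k 1 x y" for k y using dk[of k] by (simp add: dirichlet_heat_kernel_def)
  have qcont: "continuous_map (topo S) euclideanreal (q k 1 x)" for k
  proof -
    have A: "continuous_map (prod_topology (top_of_set {0<..}) (prod_topology (topo S) (topo S)))
       euclideanreal (\<lambda>(t, x, y). q k t x y)" using dk[of k] by (simp add: dirichlet_heat_kernel_def)
    have B: "continuous_map (topo S) (prod_topology (top_of_set {0<..}) (prod_topology (topo S) (topo S)))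
       (\<lambda>y. (1::real, x, y))"
      using x by (intro continuous_map_pairedI) auto
    from continuous_map_compose[OF B A] show ?thesis by (simp add: o_def)
  qed
  have "(\<lambda>k. LINT y|\<mu>. ?q k 1 x y * f k y) \<longlonglongrightarrow> (LINT y|\<mu>. p 1 x y)"
  proof (rule integral_dominated_convergence)
    \<comment> \<open>A non-integrable function has integral 0 by convention, so the value 1 forces
      integrability; \<open>p 1 x\<close> then dominates the increasing kernels.\<close>
    show int: "integrable \<mu> (p 1 x)" using one not_integrable_integral_eq by fastforce
    then show "p 1 x \<in> borel_measurable \<mu>" by auto
    show "(\<lambda>y. ?q k 1 x y * f k y) \<in> borel_measurable \<mu>" for k
      using continuous_map_borel_measurable[OF \<mu> qcont] continuous_map_borel_measurable[OF \<mu> f(1)]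
      by (intro borel_measurable_times) auto
    show "AE y in \<mu>. (\<lambda>k. ?q k 1 x y * f k y) \<longlonglongrightarrow> p 1 x y"
    proof (intro AE_I2)
      fix y assume "y \<in> space \<mu>"
      then have y: "y \<in> points S" using sp by simp
      then obtain m where m: "y \<in> \<Omega> m" using un by blast
      have "(\<lambda>k. ?q k 1 x y) \<longlonglongrightarrow> p 1 x y"
        using LIMSEQ_ignore_initial_segment[of "\<lambda>k. q k 1 x y" "p 1 x y" 2] lim[OF zero_less_one x y]
        by simp
      moreover have "?q k 1 x y = ?q k 1 x y * f k y" if "k \<ge> m" for k
        using f(3)[of y k] mono[OF that] m by auto
      then have "\<forall>\<^sub>F k in sequentially. ?q k 1 x y = ?q k 1 x y * f k y"
        by (intro eventually_sequentiallyI[of m]) blast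
      ultimately show "(\<lambda>k. ?q k 1 x y * f k y) \<longlonglongrightarrow> p 1 x y"
        by (rule Lim_transform_eventually)
    qed
    show "AE y in \<mu>. norm (?q k 1 x y * f k y) \<le> p 1 x y" for k
    proof (intro AE_I2)
      fix y assume "y \<in> space \<mu>"
      then have y: "y \<in> points S" using sp by simp
      have "norm (?q k 1 x y * f k y) \<le> ?q k 1 x y * 1"
        using pos[of "Suc (Suc k)" y] f(2)[OF y, of k] by (simp add: abs_mult mult_left_le)
      also have "\<dots> \<le> p 1 x y" using lim[OF zero_less_one x y] incseq_le[of "\<lambda>k. q k 1 x y"] by simp
      finally show "norm (?q k 1 x y * f k y) \<le> p 1 x y" .
    qed
  qed
  then have "\<forall>\<^sub>F k in sequentially. (LINT y|\<mu>. ?q k 1 x y * f k y) > 1 - \<epsilon>"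
    unfolding one using \<epsilon> by (intro order_tendstoD(1)) auto
  moreover obtain m where "x \<in> \<Omega> m" using un x by blast
  then have "\<forall>\<^sub>F k in sequentially. x \<in> \<Omega> (Suc (Suc k))"
    using mono by (intro eventually_sequentiallyI[of m]) (meson le_Suc_eq subsetD)
  ultimately obtain k where k: "(LINT y|\<mu>. ?q k 1 x y * f k y) > 1 - \<epsilon>" "x \<in> \<Omega> (Suc (Suc k))"
    using eventually_happens'[OF sequentially_bot eventually_conj] by blast
  show thesis
  proof (rule that[OF \<Omega>(1,2) k(2) dk f(1) _ \<Omega>(2) \<Omega>(3) _ k(1)])
    show "f k y = 0" if "y \<in> points S - topo S closure_of \<Omega> (Suc k)" for y
      using that sub f(4) by blast
  qed (use f(2) in auto)
qed

section \<open>The weak maximum principle\<close>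

text \<open>One-sided, because the maximum in time may occur at the final time.\<close>

lemma left_maximum_derivative_nonneg:
  fixes \<phi> :: "real \<Rightarrow> real"
  assumes "a < b" "\<And>s. \<lbrakk>a \<le> s; s \<le> b\<rbrakk> \<Longrightarrow> \<phi> s \<le> \<phi> b" "(\<phi> has_real_derivative D) (at b)"
  shows "D \<ge> 0"
proof (rule ccontr)
  assume "\<not> D \<ge> 0"
  then obtain d where d: "d > 0" "\<And>h. \<lbrakk>0 < h; h < d\<rbrakk> \<Longrightarrow> \<phi> b < \<phi> (b - h)"
    using DERIV_neg_dec_left[OF assms(3)] by auto
  define h where "h = min (d / 2) (b - a)"
  have "0 < h" "h < d" "h \<le> b - a" using d(1) assms(1) by (auto simp: h_def)
  then show False using d(2)[of h] assms(2)[of "b - h"] by auto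
qed

text \<open>If the conclusion failed, \<open>u\<close> would be a viscosity subsolution of \<open>\<Delta>u \<ge> \<kappa>u\<close>, so
  \<open>(1 + \<kappa>t) u\<close> would be one of the heat equation; comparing it with
  \<open>sup u + \<kappa> sup u (1 - P\<^sub>t1)\<close> contradicts \<open>P\<^sub>t1 = 1\<close>.\<close>

lemma weak_maximum_principle:
  fixes u :: "'a \<Rightarrow> real"
  assumes S: "immersed_surface S" and stoch: "stochastically_complete S"
    and u: "continuous_map (topo S) euclideanreal u" "\<And>p. p \<in> points S \<Longrightarrow> 0 < u p" "bdd_above (u ` points S)"
    and \<kappa>: "\<kappa> > 0"
  obtains p g U where "p \<in> points S" "open U" "coord S p \<in> U" "U \<subseteq> fst (param_at S p)"
    "Ck_on 2 (g \<circ> coord_map S p) U"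
    "\<And>a. a \<in> U \<Longrightarrow> u (coord_map S p a) + g (coord_map S p a) \<le> u p + g p"
    "laplacian S g p + \<kappa> * u p > 0"
proof -
  have haus: "Hausdorff_space (topo S)" and ne: "points S \<noteq> {}" and atl: "smooth_atlas S"
    using S by (auto simp: immersed_surface_def smooth_surface_def)
  obtain \<mu> hk where \<mu>: "riemannian_measure S \<mu>" and hk: "heat_kernel S \<mu> hk"
    and one: "\<And>x t. x \<in> points S \<Longrightarrow> t > 0 \<Longrightarrow> (LINT y|\<mu>. hk t x y) = 1"
    using stoch unfolding stochastically_complete_def by blast
  define A where "A = (SUP p\<in>points S. u p)"
  have uA: "u p \<le> A" if "p \<in> points S" for p
    unfolding A_def using cSUP_upper[OF that u(3)] .
  obtain p0 where "p0 \<in> points S" using ne by blast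
  then have A: "A > 0" using u(2) uA by (meson less_le_trans)
  \<comment> \<open>A point where \<open>u\<close> nearly attains its supremum: after time at least
    1/2 the growing factor lifts its value above \<open>A\<close>, and \<gamma> measures the
    excess.\<close>
  have "A / (1 + \<kappa> / 2) < A" using A \<kappa> by (simp add: divide_less_eq)
  then obtain x0 where x0: "x0 \<in> points S" "A / (1 + \<kappa> / 2) < u x0"
    unfolding A_def using ne u(3) by (auto simp: less_cSUP_iff)
  define \<gamma> where "\<gamma> = (1 + \<kappa> / 2) * u x0 - A"
  have \<gamma>: "\<gamma> > 0" using x0(2) \<kappa> by (simp add: \<gamma>_def field_simps)
  \<comment> \<open>Over a time interval of length at most 1 the growing factor adds at most
    \<open>\<kappa> * A\<close>, so \<open>A + B\<close> is a barrier where the kernel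
    vanishes.\<close>
  define B where "B = \<kappa> * A"
  have B: "B > 0" using A \<kappa> by (simp add: B_def)
  \<comment> \<open>With \<open>B * \<epsilon> = \<gamma> / 16\<close> and \<eta> equal to
    \<open>\<gamma> / 4\<close>, at least \<open>5 * \<gamma> / 8\<close> of the excess survives at
    \<open>x0\<close>, against an initial error of
    \<open>2 * B * \<epsilon> = \<gamma> / 8\<close>.\<close>
  define \<epsilon> where "\<epsilon> = \<gamma> / (16 * B)"
  define \<eta> where "\<eta> = \<gamma> / 4"
  have \<epsilon>: "\<epsilon> > 0" "B * \<epsilon> = \<gamma> / 16" and \<eta>: "\<eta> > 0" using \<gamma> B by (auto simp: \<epsilon>_def \<eta>_def)
  obtain \<Omega> q f K where \<Omega>: "openin (topo S) \<Omega>" "compactin (topo S) (topo S closure_of \<Omega>)" "x0 \<in> \<Omega>"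
    and q: "dirichlet_heat_kernel S \<mu> \<Omega> q" and f: "continuous_map (topo S) euclideanreal f"
    "\<And>y. y \<in> points S \<Longrightarrow> 0 \<le> f y \<and> f y \<le> 1" and K: "compactin (topo S) K" "K \<subseteq> \<Omega>"
    and fK: "\<And>y. y \<in> points S - K \<Longrightarrow> f y = 0" and big: "(LINT y|\<mu>. q 1 x0 y * f y) > 1 - \<epsilon>"
    by (rule heat_kernel_cutoff[OF S \<mu> hk x0(1) one[OF x0(1) zero_less_one] \<epsilon>(1)]) (rule that)
  have \<Omega>S: "\<Omega> \<subseteq> points S" using openin_subset[OF \<Omega>(1)] .
  have clS: "topo S closure_of \<Omega> \<subseteq> points S" by (rule closure_of_subset_topspace)
  have zero: "q t x y = 0" if "t > 0" "x \<notin> \<Omega>" for t x y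
    using q that by (simp add: dirichlet_heat_kernel_def)
  have qcont: "continuous_map (prod_topology (top_of_set {0<..}) (prod_topology (topo S) (topo S)))
       euclideanreal (\<lambda>(t, x, y). q t x y)" using q by (simp add: dirichlet_heat_kernel_def)
  have heat: "((\<lambda>s. q s x y) has_real_derivative laplacian S (\<lambda>z. q t z y) x) (at t)"
    if "t > 0" "x \<in> \<Omega>" "y \<in> \<Omega>" for t x y
    using q that by (simp add: dirichlet_heat_kernel_def)
  have initial: "\<forall>f. continuous_map (topo S) euclideanreal f \<and>
      (\<exists>K. compactin (topo S) K \<and> K \<subseteq> \<Omega> \<and> (\<forall>x\<in>points S - K. f x = 0)) \<longrightarrow>
      uniform_limit \<Omega> (\<lambda>t x. LINT y|\<mu>. q t x y * f y) f (at_right 0)"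
    using q unfolding dirichlet_heat_kernel_def by (elim conjE)
  have "continuous_map (topo S) euclideanreal f \<and>
      (\<exists>K. compactin (topo S) K \<and> K \<subseteq> \<Omega> \<and> (\<forall>x\<in>points S - K. f x = 0))"
    using f(1) K fK by blast
  from initial[THEN spec, THEN mp, OF this]
  have "uniform_limit \<Omega> (\<lambda>t x. LINT y|\<mu>. q t x y * f y) f (at_right 0)" .
  from uniform_limitD[OF this \<epsilon>(1)]
  have "\<forall>\<^sub>F t in at_right 0. \<forall>x\<in>\<Omega>. dist (LINT y|\<mu>. q t x y * f y) (f x) < \<epsilon>" .
  then obtain b where b: "b > 0" "\<And>t. \<lbrakk>0 < t; t < b\<rbrakk> \<Longrightarrow> \<forall>x\<in>\<Omega>. dist (LINT y|\<mu>. q t x y * f y) (f x) < \<epsilon>"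
    unfolding eventually_at_right_field by blast
  \<comment> \<open>The kernel is controlled for positive times only, so the comparison starts at
    \<open>t0\<close>, where the uniform initial limit already bounds the integral by
    \<open>1 + \<epsilon>\<close> on \<Omega>. The bound 1/2 leaves half a unit of time.\<close>
  define t0 where "t0 = min (b / 2) (1 / 2)"
  have t0: "0 < t0" "t0 < b" "t0 \<le> 1 / 2" using b by (auto simp: t0_def)
  let ?X = "prod_topology (top_of_set {0::real<..}) (topo S)"
  let ?C = "{t0..1} \<times> topo S closure_of \<Omega>"
  have C: "compactin ?X ?C"
    unfolding compactin_Times using \<Omega>(2) t0(1) by (auto simp: compactin_subtopology)
  have "continuous_map (prod_topology ?X (topo S)) (prod_topology (top_of_set {0<..}) (prod_topology (topo S) (topo S)))
     (\<lambda>w. (fst (fst w), snd (fst w), snd w))"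
    by (intro continuous_map_pairedI continuous_map_snd
        continuous_map_compose[OF continuous_map_fst continuous_map_fst, unfolded o_def]
        continuous_map_compose[OF continuous_map_fst continuous_map_snd, unfolded o_def])
  from continuous_map_compose[OF this qcont]
  have F: "continuous_map (prod_topology ?X (topo S)) euclideanreal (\<lambda>(w, y). q (fst w) (snd w) y)"
    by (simp add: o_def case_prod_unfold)
  obtain n :: nat and c y where y: "\<And>k. k < n \<Longrightarrow> y k \<in> K" and
    approx: "\<And>w. w \<in> ?C \<Longrightarrow> \<bar>(LINT z|\<mu>. q (fst w) (snd w) z * f z) - (\<Sum>k<n. c k * q (fst w) (snd w) (y k))\<bar> \<le> \<epsilon>"
    by (rule uniform_riemann_sum[OF \<mu> haus F C K(1) compact_finite_measure[OF S \<mu> K(1)] f fK \<epsilon>(1)], assumption, assumption) (rule that)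
  define G where "G t x = (\<Sum>k<n. c k * q t x (y k))" for t x
  have y\<Omega>: "y k \<in> \<Omega>" if "k < n" for k using y[OF that] K(2) by blast
  have Gapprox: "\<bar>(LINT z|\<mu>. q t x z * f z) - G t x\<bar> \<le> \<epsilon>" if "t0 \<le> t" "t \<le> 1" "x \<in> topo S closure_of \<Omega>" for t x
    using approx[of "(t, x)"] that by (simp add: G_def)
  have x0cl: "x0 \<in> topo S closure_of \<Omega>" using \<Omega>(3) closure_of_subset[OF \<Omega>S] by blast
  have Gcont: "continuous_map ?X euclideanreal (\<lambda>w. G (fst w) (snd w))"
    unfolding G_def
  proof (intro continuous_map_sum continuous_map_real_mult_left)
    fix k assume "k \<in> {..<n}"
    then have "y k \<in> points S" using y\<Omega> \<Omega>S by blast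
    then have "continuous_map ?X (prod_topology ?X (topo S)) (\<lambda>w. (w, y k))"
      by (intro continuous_map_pairedI) auto
    from continuous_map_compose[OF this F]
    show "continuous_map ?X euclideanreal (\<lambda>w. q (fst w) (snd w) (y k))" by (simp add: o_def)
  qed simp
  \<comment> \<open>Growing subsolution minus barrier, with \<open>G\<close> in place of the cutoff
    integral; the \<eta> term makes the final inequality strict.\<close>
  define \<phi> where "\<phi> t x = (1 + \<kappa> * (t - t0)) * u x - A - B * (1 - G t x) - \<eta> * (t - t0)" for t x
  have "continuous_map ?X euclideanreal (\<lambda>w. u (snd w))"
    using continuous_map_compose[OF continuous_map_snd u(1)] by (simp add: o_def)
  moreover have "continuous_map ?X euclideanreal fst"
    using continuous_map_into_fulltopology[OF continuous_map_fst] .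
  ultimately have "continuous_map ?X euclideanreal (\<lambda>w. \<phi> (fst w) (snd w))"
    unfolding \<phi>_def
    by (intro continuous_map_diff continuous_map_add continuous_map_real_mult Gcont) auto
  from image_compactin[OF C this] have "compact ((\<lambda>w. \<phi> (fst w) (snd w)) ` ?C)" by simp
  moreover have "?C \<noteq> {}" using x0cl t0 by auto
  ultimately have "\<exists>w1\<in>?C. \<forall>w\<in>?C. \<phi> (fst w) (snd w) \<le> \<phi> (fst w1) (snd w1)"
    using compact_attains_sup[of "(\<lambda>w. \<phi> (fst w) (snd w)) ` ?C"]
    by (simp only: image_is_empty ball_simps bex_simps not_False_eq_True)
  then obtain w1 where w1: "w1 \<in> ?C" "\<And>w. w \<in> ?C \<Longrightarrow> \<phi> (fst w) (snd w) \<le> \<phi> (fst w1) (snd w1)"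
    by blast
  obtain t1 p1 where tp: "w1 = (t1, p1)" by (cases w1)
  have t1: "t0 \<le> t1" "t1 \<le> 1" and p1: "p1 \<in> topo S closure_of \<Omega>" using w1(1) tp by auto
  have max: "\<phi> t x \<le> \<phi> t1 p1" if "t0 \<le> t" "t \<le> 1" "x \<in> topo S closure_of \<Omega>" for t x
    using w1(2)[of "(t, x)"] that tp by simp
  have p1S: "p1 \<in> points S" using p1 clS by blast
  have "2 * (B * \<epsilon>) < \<phi> 1 x0"
  proof -
    have "G 1 x0 \<ge> 1 - 2 * \<epsilon>" using Gapprox[of 1 x0] big t0 x0cl by auto
    then have "B * (1 - G 1 x0) \<le> B * (2 * \<epsilon>)" using B by (intro mult_left_mono) auto
    then have 1: "B * (1 - G 1 x0) \<le> 2 * (B * \<epsilon>)" by (simp add: mult.left_commute)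
    have "\<kappa> * (1 / 2) \<le> \<kappa> * (1 - t0)" using \<kappa> t0 by (intro mult_left_mono) auto
    then have 2: "(1 + \<kappa> / 2) * u x0 \<le> (1 + \<kappa> * (1 - t0)) * u x0"
      using u(2)[OF x0(1)] by (intro mult_right_mono) auto
    have 3: "\<eta> * (1 - t0) \<le> \<gamma> / 4" using \<eta> t0 \<gamma> by (simp add: \<eta>_def)
    show ?thesis using 1 2 3 \<epsilon>(2) \<gamma> \<gamma>_def unfolding \<phi>_def by linarith
  qed
  also have "\<dots> \<le> \<phi> t1 p1" using max[of 1 x0] x0cl t0 by simp
  finally have large: "2 * (B * \<epsilon>) < \<phi> t1 p1" .
  \<comment> \<open>Outside \<Omega> the kernel vanishes, so the barrier is \<open>A + B\<close>
    there and \<phi> is not positive.\<close>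
  have p1\<Omega>: "p1 \<in> \<Omega>"
  proof (rule ccontr)
    assume "p1 \<notin> \<Omega>"
    then have "G t1 p1 = 0" unfolding G_def using zero t0 t1 by simp
    moreover have "\<kappa> * (t1 - t0) * u p1 \<le> \<kappa> * 1 * A"
      using \<kappa> t0 t1 uA[OF p1S] u(2)[OF p1S] by (intro mult_mono) auto
    moreover have "\<eta> * (t1 - t0) \<ge> 0" using \<eta> t1 by simp
    ultimately have "\<phi> t1 p1 \<le> 0" using uA[OF p1S] unfolding \<phi>_def B_def by (simp add: algebra_simps)
    then show False using large \<epsilon>(2) \<gamma> by linarith
  qed
  \<comment> \<open>Initially \<open>G\<close> exceeds 1 by at most \<open>2 * \<epsilon>\<close>:
    one \<epsilon> from the initial limit, one from the Riemann sum.\<close>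
  have "t1 \<noteq> t0"
  proof
    assume "t1 = t0"
    have "G t0 p1 \<le> 1 + 2 * \<epsilon>"
      using Gapprox[of t0 p1] b(2)[OF t0(1,2)] p1\<Omega> p1 t0 f(2)[OF p1S] by (auto simp: dist_real_def)
    then have "B * (G t0 p1 - 1) \<le> B * (2 * \<epsilon>)" using B by (intro mult_left_mono) auto
    then have "\<phi> t1 p1 \<le> 2 * (B * \<epsilon>)" using uA[OF p1S] unfolding \<phi>_def \<open>t1 = t0\<close> by (simp add: algebra_simps)
    then show False using large by simp
  qed
  then have t01: "t0 < t1" using t1 by simp
  have t1pos: "t1 > 0" using t0 t01 by simp
  define D where "D = (\<Sum>k<n. c k * laplacian S (\<lambda>z. q t1 z (y k)) p1)"
  have "((\<lambda>t. G t p1) has_real_derivative D) (at t1)"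
    unfolding G_def D_def using heat[OF t1pos p1\<Omega> y\<Omega>]
    by (intro DERIV_sum DERIV_cmult) auto
  then have "((\<lambda>t. \<phi> t p1) has_real_derivative \<kappa> * u p1 + B * D - \<eta>) (at t1)"
    unfolding \<phi>_def by (auto intro!: derivative_eq_intros)
  then have time: "\<kappa> * u p1 + B * D - \<eta> \<ge> 0"
    using max p1 t1 by (intro left_maximum_derivative_nonneg[OF t01, of "\<lambda>t. \<phi> t p1"]) auto
  \<comment> \<open>Dividing the spatial maximum of \<phi> at time \<open>t1\<close> by this growth
    factor leaves \<open>u + g\<close>.\<close>
  define e where "e = 1 + \<kappa> * (t1 - t0)"
  have e: "e \<ge> 1" using \<kappa> t1 by (simp add: e_def)
  define g where "g x = B / e * G t1 x" for x
  let ?\<psi> = "coord_map S p1" and ?V = "fst (param_at S p1)"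
  note ch = param_at_chart[OF atl p1S]
  define U where "U = {a \<in> ?V. ?\<psi> a \<in> \<Omega>}"
  have U: "open U" "coord S p1 \<in> U" "U \<subseteq> ?V"
    using chart_preimage_open[OF atl ch(1) \<Omega>(1)] ch(2,3) p1\<Omega> by (auto simp: U_def)
  interpret P: immersion_patch ?V "imm S \<circ> ?\<psi>" using immersed_patch[OF S p1S] .
  have slice: "Ck_on 2 (\<lambda>a. q t1 (?\<psi> a) (y k)) U" if "k \<in> {..<n}" for k
    unfolding U_def using that y\<Omega> by (intro dirichlet_heat_kernel_slice[OF S q \<Omega>(1) ch(1) t1pos]) auto
  have g: "g \<circ> ?\<psi> = (\<lambda>a. \<Sum>k<n. (B / e * c k) * q t1 (?\<psi> a) (y k))"
    by (simp add: g_def G_def fun_eq_iff sum_distrib_left mult.assoc)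
  note sum_rules = P.laplacian_coord_sum[where I = "{..<n}" and h = "\<lambda>k a. q t1 (?\<psi> a) (y k)"
      and a = "\<lambda>k. B / e * c k", OF U(2) ch(2) U(1) slice]
  have comp: "(\<lambda>z. q t1 z (y k)) \<circ> ?\<psi> = (\<lambda>a. q t1 (?\<psi> a) (y k))" for k by (simp add: o_def)
  have "laplacian S g p1 = (\<Sum>k<n. (B / e * c k) * laplacian S (\<lambda>z. q t1 z (y k)) p1)"
    unfolding laplacian_def g comp by (rule sum_rules(2))
  also have "\<dots> = B * D / e" by (simp add: D_def sum_distrib_left sum_divide_distrib mult.assoc)
  finally have "laplacian S g p1 = B * D / e" .
  moreover have "B * D / e \<ge> (\<eta> - \<kappa> * u p1) / e" using time e by (intro divide_right_mono) auto
  \<comment> \<open>Since \<open>e\<close> is at least 1 and \<open>u\<close> is positive, the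
    growth only helps, and \<eta> gives strictness.\<close>
  moreover have "(\<eta> - \<kappa> * u p1) / e + \<kappa> * u p1 > 0"
  proof -
    have "\<kappa> * u p1 \<le> e * (\<kappa> * u p1)" using mult_right_mono[OF e, of "\<kappa> * u p1"] \<kappa> u(2)[OF p1S] by simp
    then have "(\<eta> - \<kappa> * u p1) + e * (\<kappa> * u p1) > 0" using \<eta> by linarith
    then have "((\<eta> - \<kappa> * u p1) + e * (\<kappa> * u p1)) / e > 0" using e by (intro divide_pos_pos) auto
    then show ?thesis using e by (simp add: add_divide_distrib)
  qed
  ultimately have "laplacian S g p1 + \<kappa> * u p1 > 0" by linarith
  moreover have "Ck_on 2 (g \<circ> ?\<psi>) U"
    unfolding g by (rule sum_rules(1))
  moreover have "u (?\<psi> a) + g (?\<psi> a) \<le> u p1 + g p1" if "a \<in> U" for a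
  proof -
    have "?\<psi> a \<in> topo S closure_of \<Omega>" using that closure_of_subset[OF \<Omega>S] by (auto simp: U_def)
    from max[OF t1 this] have "e * u (?\<psi> a) + B * G t1 (?\<psi> a) \<le> e * u p1 + B * G t1 p1"
      by (simp add: \<phi>_def e_def algebra_simps)
    then have "(e * u (?\<psi> a) + B * G t1 (?\<psi> a)) / e \<le> (e * u p1 + B * G t1 p1) / e"
      using e by (intro divide_right_mono) auto
    then show ?thesis using e by (simp add: add_divide_distrib g_def)
  qed
  ultimately show thesis using that[OF p1S U] by blast
qed


section \<open>Contradiction from a positive distance\<close>

theorem theorem1p9:
  fixes M :: "'a surface_in_space" and N :: "'b surface_in_space" and \<xi> :: "'b \<Rightarrow> real^3"
  assumes "immersed_surface M" and "stochastically_complete M"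
    and "properly_immersed_surface N" and "geodesically_complete N" and "bounded_curvature N"
    and "mean_curvature_normal N \<xi>" and "well_oriented N \<xi> M"
    and "(SUP p\<in>points M. ereal (norm (mean_curvature_vector M p))) =
         (INF q\<in>points N. ereal (mean_curvature N (\<xi> q) q))"
    and "(INF q\<in>points N. ereal (mean_curvature N (\<xi> q) q)) > 0"
  shows "setdist (imm M ` points M) (imm N ` points N) = 0"
proof (rule ccontr)
  assume ne0: "setdist (imm M ` points M) (imm N ` points N) \<noteq> 0"
  define d where "d = setdist (imm M ` points M) (imm N ` points N)"
  have d: "d > 0" using ne0 setdist_pos_le unfolding d_def less_le by metis
  let ?I = "imm N ` points N"
  have imN: "immersed_surface N" and pm: "proper_map (topo N) euclidean (imm N)"
    using assms(3) by (auto simp: properly_immersed_surface_def)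
  have neN: "points N \<noteq> {}" and atlN: "smooth_atlas N"
    using imN by (auto simp: immersed_surface_def smooth_surface_def)
  have atlM: "smooth_atlas M" using assms(1) by (auto simp: immersed_surface_def smooth_surface_def)
  \<comment> \<open>The infimum over a nonempty set of reals is not plus infinity, and positivity
    excludes minus infinity.\<close>
  obtain H where H: "(INF q\<in>points N. ereal (mean_curvature N (\<xi> q) q)) = ereal H"
  proof (cases "INF q\<in>points N. ereal (mean_curvature N (\<xi> q) q)")
    case PInf
    obtain q where "q \<in> points N" using neN by blast
    then have "(INF q\<in>points N. ereal (mean_curvature N (\<xi> q) q)) \<le> ereal (mean_curvature N (\<xi> q) q)"
      by (rule INF_lower)
    then show ?thesis using PInf by simp
  qed (use assms(9) that in auto)
  have H0: "H > 0" using assms(9) unfolding H by simp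
  have HN: "H \<le> mean_curvature N (\<xi> q) q" if "q \<in> points N" for q
    using INF_lower[OF that, of "\<lambda>q. ereal (mean_curvature N (\<xi> q) q)"] unfolding H by simp
  have HM: "norm (mean_curvature_vector M p) \<le> H" if "p \<in> points M" for p
    using SUP_upper[OF that, of "\<lambda>p. ereal (norm (mean_curvature_vector M p))"] unfolding assms(8) H by simp
  \<comment> \<open>\<open>s\<close> and \<open>b\<close> satisfy the hypotheses of
    \<open>two_point_laplacian\<close>; \<open>b\<close> gives equality in
    \<open>5 \<le> 2 * b * d\<^sup>2\<close>.\<close>
  define s where "s = min 1 (d * H / 2)"
  define b where "b = 5 / (2 * d\<^sup>2)"
  have s: "0 < s" "s \<le> 1" "2 * s \<le> d * H" using d H0 by (auto simp: s_def)
  have b: "b > 0" "5 \<le> 2 * b * d\<^sup>2" using d by (auto simp: b_def)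
  have clI: "closed ?I"
    using pm unfolding proper_map_def closed_map_def by (metis closed_closedin closedin_topspace)
  define u where "u p = exp (- b * (infdist (imm M p) ?I)\<^sup>2)" for p
  have ucont: "continuous_map (topo M) euclideanreal u"
  proof -
    have "continuous_on UNIV (\<lambda>x. exp (- b * (infdist x ?I)\<^sup>2))"
      by (intro continuous_intros)
    then have "continuous_map euclidean euclideanreal (\<lambda>x. exp (- b * (infdist x ?I)\<^sup>2))" by simp
    from continuous_map_compose[OF immersion_continuous[OF assms(1)] this] show ?thesis
      by (simp add: u_def[abs_def] o_def)
  qed
  have "u p \<le> 1" for p using b by (simp add: u_def)
  have upos: "0 < u p" for p by (simp add: u_def)
  from \<open>\<And>p. u p \<le> 1\<close> have ubdd: "bdd_above (u ` points M)" by (intro bdd_aboveI[of _ 1]) auto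
  have lam: "2 * b * s * d * H > 0" using b s d H0 by simp
  obtain p g U where p: "p \<in> points M" and U: "open U" "coord M p \<in> U" "U \<subseteq> fst (param_at M p)"
    and g: "Ck_on 2 (g \<circ> coord_map M p) U"
    and max: "\<And>a. a \<in> U \<Longrightarrow> u (coord_map M p a) + g (coord_map M p a) \<le> u p + g p"
    and lap: "laplacian M g p + 2 * b * s * d * H * u p > 0"
    by (rule weak_maximum_principle[OF assms(1,2) ucont upos ubdd lam]) (rule that)
  obtain W where W: "W \<in> components (- ?I)" "imm M ` points M \<subseteq> W"
    "\<forall>z\<in>?I \<inter> frontier W. points_into N \<xi> W z"
    using assms(7) unfolding well_oriented_def by (elim conjE bexE)
  let ?x = "imm M p"
  obtain z where z: "z \<in> ?I" "infdist ?x ?I = dist ?x z"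
    using infdist_attains_inf[OF clI, of ?x] neN by blast
  have near: "dist ?x z \<le> dist ?x z'" if "z' \<in> ?I" for z' using infdist_le[OF that, of ?x] z(2) by simp
  have xW: "?x \<in> W" using W(2) p by blast
  obtain q where q: "q \<in> points N" "imm N q = z" "\<xi> q = (?x - z) /\<^sub>R norm (?x - z)"
    by (rule foot_point_normal[OF assms(3,6) W(1) xW W(3)[rule_format] z(1) near], assumption, assumption) (rule that)
  let ?X = "imm M \<circ> coord_map M p" and ?Y = "imm N \<circ> coord_map N q"
  note cM = param_at_chart[OF atlM p] and cN = param_at_chart[OF atlN q(1)]
  interpret P: immersion_patch "fst (param_at M p)" ?X using immersed_patch[OF assms(1) p] .
  \<comment> \<open>The chart is shrunk to the set on which the test function touches;
    \<open>second_dd\<close> and the Laplacian at the point do not change.\<close>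
  have PU: "immersion_patch U ?X"
    using U P.inj_D Ck_on_subset[OF P.C2 U(3)] by unfold_locales auto
  have Xx: "?X (coord M p) = ?x" and Yy: "?Y (coord N q) = z" using cM cN q by auto
  have gp: "(g \<circ> coord_map M p) (coord M p) = g p" using cM by simp
  have up: "u p = exp (- b * ((?x - z) \<bullet> (?x - z)))"
    by (simp add: u_def z(2) dist_norm power2_norm_eq_inner)
  have "laplacian_coord ?X (g \<circ> coord_map M p) (coord M p)
      \<le> - (2 * b * s * d * H) * exp (- b * ((?X (coord M p) - ?Y (coord N q)) \<bullet> (?X (coord M p) - ?Y (coord N q))))"
  proof (rule two_point_laplacian[OF PU immersed_patch[OF imN q(1)] U(2) cN(2) g])
    \<comment> \<open>The distance to the image is at most that to any of its points, with equality
      at the foot pair. So the smooth two-point function lies below \<open>u\<close> and inherits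
      its maximum with \<open>g\<close>.\<close>
    fix a c assume a: "a \<in> U" and c: "c \<in> fst (param_at N q)"
    have "?Y c \<in> ?I" using chart_mem_points[OF atlN cN(1) c] by simp
    then have "(infdist (?X a) ?I)\<^sup>2 \<le> (dist (?X a) (?Y c))\<^sup>2"
      by (intro power_mono infdist_le infdist_nonneg)
    then have "exp (- b * ((?X a - ?Y c) \<bullet> (?X a - ?Y c))) \<le> u (coord_map M p a)"
      using b(1) by (simp add: u_def dist_norm power2_norm_eq_inner)
    then show "exp (- b * ((?X a - ?Y c) \<bullet> (?X a - ?Y c))) + (g \<circ> coord_map M p) a \<le>
      exp (- b * ((?X (coord M p) - ?Y (coord N q)) \<bullet> (?X (coord M p) - ?Y (coord N q)))) + (g \<circ> coord_map M p) (coord M p)"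
      using max[OF a] unfolding Xx Yy gp up[symmetric] by simp
  next
    show "d \<le> norm (?X (coord M p) - ?Y (coord N q))"
      unfolding Xx Yy d_def dist_norm[symmetric] using z(1) p by (intro setdist_le_dist) auto
    show "norm (immersion_patch.lap_imm ?X (coord M p)) \<le> H"
      using norm_lap_imm_mean_curvature_vector[OF assms(1) p] HM[OF p] by simp
    \<comment> \<open>By the choice of \<open>q\<close>, the direction from foot point to
      \<open>x\<close> is \<open>\<xi> q\<close>, so the trace is the mean curvature of
      \<open>N\<close> there with the correct sign.\<close>
    show "H \<le> trace (matrix_inv (first_form ?Y (coord N q)) ** second_form ?Y
        ((?X (coord M p) - ?Y (coord N q)) /\<^sub>R norm (?X (coord M p) - ?Y (coord N q))) (coord N q))"
      using HN[OF q(1)] unfolding Xx Yy q(3)[symmetric]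
      by (simp add: mean_curvature_def shape_operator_def Let_def)
  qed (use H0 d s b in auto)
  then have "laplacian M g p \<le> - (2 * b * s * d * H) * u p"
    unfolding laplacian_def Xx Yy up .
  then show False using lap by simp
qed

end
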